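(* Assume that $|u(q^\dagger)|\ge c_0$ in $\Omega$ for some constant $c_0>0$, and that $q^\dagger-q^*\in H_0^\kappa(\Omega)$ with $\kappa>0$ and $\kappa\ne 1/2$. Consider, for an exponent $\alpha>0$, the variational source condition: there is a constant $C>0$ (independent of $q$) such that $$(q^\dagger-q^*,\,q^\dagger-q)_\Omega\le\tfrac14\|q-q^\dagger\|_{0,\Omega}^2+C\,\|u(q)-u(q^\dagger)\|_{1,\Omega}^{\alpha}\qquad\text{for all } q\in K.\qquad(\ast)$$ Then: - if $\kappa>1$, $(\ast)$ holds with $\alpha=1$; - if $\kappa\in(0,\tfrac12)\cup(\tfrac12,1]$, $(\ast)$ holds with some $\alpha<\frac{2\kappa}{1+\kappa}$ which can be chosen arbitrarily close to $\frac{2\kappa}{1+\kappa}$; that is, for every $\eta>0$ there is $\alpha>0$ with $\frac{2\kappa}{1+\kappa}-\eta<\alpha<\frac{2\kappa}{1+\kappa}$ for which $(\ast)$ holds.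
   Context: $\Omega\subset\mathbb{R}^d$ ($d=2,3$) is an open bounded connected domain with $C^2$ boundary. Standing assumptions: $a\in W^{1,\infty}(\Omega)$ has a positive lower bound, $f\in L^2(\Omega)$, $g\in H^{3/2}(\partial\Omega)$. With constants $0<\underline q\le\bar q$, the admissible set is $K=\{q\in L^2(\Omega): \underline q\le q\le\bar q \text{ a.e. in }\Omega\}$. For $q\in K$, $u(q)\in H^2(\Omega)$ denotes the unique solution of $$-\nabla\cdot(a\nabla u)+q u=f\ \text{ in }\Omega,\qquad u=g\ \text{ on }\partial\Omega.$$ $q^\dagger\in K$ is the true radiativity and $q^*\in K$ is an a priori estimate of it. $(\cdot,\cdot)_\Omega$ is the $L^2(\Omega)$ inner product, $\|\cdot\|_{s,\Omega}$ the norm of $H^s(\Omega)$ ($\|\cdot\|_{0,\Omega}$ the $L^2(\Omega)$ norm), and for $s>0$, $H^s_0(\Omega)$ is the completion of $C_c^\infty(\Omega)$ under $\|\cdot\|_{s,\Omega}$. *)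

theory Defs
  imports "HOL-Analysis.Analysis"
begin

text \<open>
  Elements of function spaces over a set \<open>\<Omega>\<close> are represented by total functions
  \<open>'a \<Rightarrow> real\<close> of which only the values on \<open>\<Omega>\<close> (up to null sets) matter.
\<close>

definition L2 :: "'a::euclidean_space set \<Rightarrow> ('a \<Rightarrow> real) set" where
  "L2 \<Omega> = {f. f \<in> borel_measurable (lebesgue_on \<Omega>) \<and> integrable (lebesgue_on \<Omega>) (\<lambda>x. (f x)\<^sup>2)}"

definition L2_inner :: "'a::euclidean_space set \<Rightarrow> ('a \<Rightarrow> real) \<Rightarrow> ('a \<Rightarrow> real) \<Rightarrow> real" where
  "L2_inner \<Omega> f g = (LINT x|lebesgue_on \<Omega>. f x * g x)"

definition L2_norm :: "'a::euclidean_space set \<Rightarrow> ('a \<Rightarrow> real) \<Rightarrow> real" where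
  "L2_norm \<Omega> f = sqrt (L2_inner \<Omega> f f)"

definition locally_integrable :: "'a::euclidean_space set \<Rightarrow> ('a \<Rightarrow> real) \<Rightarrow> bool" where
  "locally_integrable \<Omega> f \<longleftrightarrow> (\<forall>S. compact S \<and> S \<subseteq> \<Omega> \<longrightarrow> integrable (lebesgue_on S) f)"


text \<open>
  Iterated partial derivatives are indexed by words over the standard basis rather than by
  multi-indices. In the Sobolev norms below this counts a mixed derivative once for each order of
  differentiation, which changes the norms of order \<open>s \<ge> 2\<close> only up to equivalence and the norms
  of order \<open>s < 2\<close> not at all.
\<close>

definition basis_words :: "nat \<Rightarrow> 'a::euclidean_space list set" where
  "basis_words m = {vs. set vs \<subseteq> Basis \<and> length vs = m}"

fun partial_derivs :: "'a::euclidean_space list \<Rightarrow> ('a \<Rightarrow> real) \<Rightarrow> 'a \<Rightarrow> real" where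
  "partial_derivs [] f = f"
| "partial_derivs (v # vs) f = (\<lambda>x. frechet_derivative (partial_derivs vs f) (at x) v)"

fun C_k :: "nat \<Rightarrow> ('a::euclidean_space \<Rightarrow> real) \<Rightarrow> bool" where
  "C_k 0 f \<longleftrightarrow> continuous_on UNIV f"
| "C_k (Suc k) f \<longleftrightarrow> (\<forall>x. f differentiable (at x)) \<and>
     (\<forall>v\<in>Basis. C_k k (\<lambda>x. frechet_derivative f (at x) v))"

definition smooth :: "('a::euclidean_space \<Rightarrow> real) \<Rightarrow> bool" where
  "smooth f \<longleftrightarrow> (\<forall>k. C_k k f)"

definition test_functions :: "'a::euclidean_space set \<Rightarrow> ('a \<Rightarrow> real) set" where
  "test_functions \<Omega> =
     {\<phi>. smooth \<phi> \<and> compact (closure {x. \<phi> x \<noteq> 0}) \<and> closure {x. \<phi> x \<noteq> 0} \<subseteq> \<Omega>}"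


definition has_weak_deriv ::
    "'a::euclidean_space set \<Rightarrow> 'a list \<Rightarrow> ('a \<Rightarrow> real) \<Rightarrow> ('a \<Rightarrow> real) \<Rightarrow> bool" where
  "has_weak_deriv \<Omega> vs f g \<longleftrightarrow> locally_integrable \<Omega> f \<and> locally_integrable \<Omega> g \<and>
     (\<forall>\<phi>\<in>test_functions \<Omega>.
        L2_inner \<Omega> f (partial_derivs vs \<phi>) = (-1) ^ length vs * L2_inner \<Omega> g \<phi>)"

text \<open>
  A representative of the weak derivative; on open sets it is unique up to null sets. It is
  only used where a weak derivative is known to exist.
\<close>

definition weak_deriv ::
    "'a::euclidean_space set \<Rightarrow> 'a list \<Rightarrow> ('a \<Rightarrow> real) \<Rightarrow> 'a \<Rightarrow> real" where
  "weak_deriv \<Omega> vs f = (SOME g. has_weak_deriv \<Omega> vs f g)"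

definition W1_inf :: "'a::euclidean_space set \<Rightarrow> ('a \<Rightarrow> real) set" where
  "W1_inf \<Omega> = {f. \<forall>m\<le>1. \<forall>vs\<in>basis_words m. \<exists>g. has_weak_deriv \<Omega> vs f g \<and>
     (\<exists>M. AE x in lebesgue_on \<Omega>. \<bar>g x\<bar> \<le> M)}"

definition slobodeckij_sq :: "'a::euclidean_space set \<Rightarrow> real \<Rightarrow> ('a \<Rightarrow> real) \<Rightarrow> ennreal" where
  "slobodeckij_sq \<Omega> \<theta> f = (\<integral>\<^sup>+x. (\<integral>\<^sup>+y.
     ennreal ((f x - f y)\<^sup>2 / norm (x - y) powr (real DIM('a) + 2 * \<theta>))
       \<partial>lebesgue_on \<Omega>) \<partial>lebesgue_on \<Omega>)"

text \<open>
  \<open>H\<^sup>s(\<Omega>)\<close> and its norm for real \<open>s \<ge> 0\<close> (Sobolev--Slobodeckij). The integer part of \<open>s\<close> counts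
  weak derivatives, the fractional part (if nonzero) enters through the double-integral seminorm.
\<close>

definition sobolev :: "'a::euclidean_space set \<Rightarrow> real \<Rightarrow> ('a \<Rightarrow> real) set" where
  "sobolev \<Omega> s = {f \<in> L2 \<Omega>.
     (\<forall>m\<le>nat \<lfloor>s\<rfloor>. \<forall>vs\<in>basis_words m. \<exists>g\<in>L2 \<Omega>. has_weak_deriv \<Omega> vs f g) \<and>
     (frac s \<noteq> 0 \<longrightarrow> (\<forall>vs\<in>basis_words (nat \<lfloor>s\<rfloor>).
        slobodeckij_sq \<Omega> (frac s) (weak_deriv \<Omega> vs f) < \<infinity>))}"

definition sobolev_norm :: "'a::euclidean_space set \<Rightarrow> real \<Rightarrow> ('a \<Rightarrow> real) \<Rightarrow> real" where
  "sobolev_norm \<Omega> s f = sqrt (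
     (\<Sum>m\<le>nat \<lfloor>s\<rfloor>. \<Sum>vs\<in>basis_words m. (L2_norm \<Omega> (weak_deriv \<Omega> vs f))\<^sup>2) +
     (if frac s = 0 then 0
      else \<Sum>vs\<in>basis_words (nat \<lfloor>s\<rfloor>). enn2real (slobodeckij_sq \<Omega> (frac s) (weak_deriv \<Omega> vs f))))"

text \<open>
  The completion of \<open>C\<^sub>c\<^sup>\<infinity>(\<Omega>)\<close> under the norm of \<open>H\<^sup>s(\<Omega>)\<close>, realised as its closure in the
  complete space \<open>H\<^sup>s(\<Omega>)\<close>.
\<close>

definition sobolev0 :: "'a::euclidean_space set \<Rightarrow> real \<Rightarrow> ('a \<Rightarrow> real) set" where
  "sobolev0 \<Omega> s = {f \<in> sobolev \<Omega> s. \<exists>\<phi> :: nat \<Rightarrow> 'a \<Rightarrow> real. (\<forall>n. \<phi> n \<in> test_functions \<Omega>) \<and>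
     (\<lambda>n. sobolev_norm \<Omega> s (\<lambda>x. \<phi> n x - f x)) \<longlonglongrightarrow> 0}"


text \<open>
  Boundary charts: in a cylinder around \<open>x0\<close> with axis direction \<open>e\<close>, radius \<open>r\<close> and half-height
  \<open>h\<close>, the set \<open>\<Omega>\<close> is the part strictly above the graph of \<open>\<gamma>\<close>. The function \<open>\<gamma>\<close> is only evaluated
  on the hyperplane orthogonal to \<open>e\<close>. Taking \<open>e\<close> to be an arbitrary unit vector covers all rigid
  changes of coordinates.
\<close>

definition hproj :: "'a::euclidean_space \<Rightarrow> 'a \<Rightarrow> 'a" where
  "hproj e x = x - (x \<bullet> e) *\<^sub>R e"

definition cylinder :: "'a::euclidean_space \<Rightarrow> 'a \<Rightarrow> real \<Rightarrow> real \<Rightarrow> 'a set" where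
  "cylinder x0 e r h = {x. norm (hproj e (x - x0)) < r \<and> \<bar>(x - x0) \<bullet> e\<bar> < h}"

definition graph_point :: "'a::euclidean_space \<Rightarrow> ('a \<Rightarrow> real) \<Rightarrow> 'a \<Rightarrow> 'a" where
  "graph_point e \<gamma> x = hproj e x + \<gamma> (hproj e x) *\<^sub>R e"

definition C2_chart ::
    "'a::euclidean_space set \<Rightarrow> 'a \<Rightarrow> 'a \<Rightarrow> real \<Rightarrow> real \<Rightarrow> ('a \<Rightarrow> real) \<Rightarrow> bool" where
  "C2_chart \<Omega> x0 e r h \<gamma> \<longleftrightarrow> x0 \<in> frontier \<Omega> \<and> norm e = 1 \<and> r > 0 \<and> h > 0 \<and> C_k 2 \<gamma> \<and>
     (\<forall>x\<in>cylinder x0 e r h. graph_point e \<gamma> x \<in> cylinder x0 e r h \<and>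
        (x \<in> \<Omega> \<longleftrightarrow> \<gamma> (hproj e x) < x \<bullet> e))"

definition C2_boundary :: "'a::euclidean_space set \<Rightarrow> bool" where
  "C2_boundary \<Omega> \<longleftrightarrow> (\<forall>x0\<in>frontier \<Omega>. \<exists>e r h \<gamma>. C2_chart \<Omega> x0 e r h \<gamma>)"

text \<open>
  Function spaces on the boundary are defined through the charts. The pull-back of a boundary
  function is taken as a function on the whole cylinder which is constant in the axis direction.
  Since the cylinder is the product of a \<open>(d - 1)\<close>-dimensional ball and a bounded interval, such a
  function is in \<open>H\<^sup>s\<close> (or converges in \<open>L\<^sup>2\<close>) on the cylinder iff it is so on the ball; this
  avoids a separate type for the \<open>(d - 1)\<close>-dimensional parameter space. The pulled-back
  Lebesgue measure is equivalent to the surface measure, with density bounded above and below.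
  For a \<open>C\<^sup>2\<close> boundary the space is independent of the choice of charts for \<open>0 \<le> s \<le> 2\<close>.
\<close>

definition sobolev_boundary :: "'a::euclidean_space set \<Rightarrow> real \<Rightarrow> ('a \<Rightarrow> real) set" where
  "sobolev_boundary \<Omega> s = {g. \<forall>x0 e r h \<gamma>. C2_chart \<Omega> x0 e r h \<gamma> \<longrightarrow>
     (\<lambda>x. g (graph_point e \<gamma> x)) \<in> sobolev (cylinder x0 e r h) s}"

text \<open>
  The trace operator is the continuous extension to \<open>H\<^sup>1(\<Omega>)\<close> of the restriction to the boundary of
  functions smooth up to the boundary, with values in \<open>L\<^sup>2\<close> of the boundary (here \<open>s = 0\<close>).
\<close>

definition has_trace :: "'a::euclidean_space set \<Rightarrow> ('a \<Rightarrow> real) \<Rightarrow> ('a \<Rightarrow> real) \<Rightarrow> bool" where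
  "has_trace \<Omega> u g \<longleftrightarrow> u \<in> sobolev \<Omega> 1 \<and> g \<in> sobolev_boundary \<Omega> 0 \<and>
     (\<exists>w :: nat \<Rightarrow> 'a \<Rightarrow> real. (\<forall>n. smooth (w n)) \<and>
        (\<lambda>n. sobolev_norm \<Omega> 1 (\<lambda>x. w n x - u x)) \<longlonglongrightarrow> 0 \<and>
        (\<forall>x0 e r h \<gamma>. C2_chart \<Omega> x0 e r h \<gamma> \<longrightarrow>
           (\<lambda>n. L2_norm (cylinder x0 e r h)
              (\<lambda>x. w n (graph_point e \<gamma> x) - g (graph_point e \<gamma> x))) \<longlonglongrightarrow> 0))"


text \<open>
  \<open>u \<in> H\<^sup>2(\<Omega>)\<close> solves \<open>-\<nabla>\<cdot>(a\<nabla>u) + q u = f\<close> a.e. in \<open>\<Omega>\<close>, \<open>u = g\<close> on the boundary; \<open>p i\<close> is the weak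
  derivative of the \<open>i\<close>-th component of \<open>a\<nabla>u\<close> in direction \<open>i\<close>.
\<close>

definition solves_bvp ::
    "'a::euclidean_space set \<Rightarrow> ('a \<Rightarrow> real) \<Rightarrow> ('a \<Rightarrow> real) \<Rightarrow> ('a \<Rightarrow> real) \<Rightarrow> ('a \<Rightarrow> real)
      \<Rightarrow> ('a \<Rightarrow> real) \<Rightarrow> bool" where
  "solves_bvp \<Omega> a f g q u \<longleftrightarrow> u \<in> sobolev \<Omega> 2 \<and>
     (\<exists>p :: 'a \<Rightarrow> 'a \<Rightarrow> real.
        (\<forall>i\<in>Basis. has_weak_deriv \<Omega> [i] (\<lambda>x. a x * weak_deriv \<Omega> [i] u x) (p i)) \<and>
        (AE x in lebesgue_on \<Omega>. - (\<Sum>i\<in>Basis. p i x) + q x * u x = f x)) \<and>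
     has_trace \<Omega> u g"

definition admissible_set :: "'a::euclidean_space set \<Rightarrow> real \<Rightarrow> real \<Rightarrow> ('a \<Rightarrow> real) set" where
  "admissible_set \<Omega> qlo qhi = {q \<in> L2 \<Omega>. AE x in lebesgue_on \<Omega>. qlo \<le> q x \<and> q x \<le> qhi}"

text \<open>
  The variational source condition with exponent \<open>\<alpha>\<close>, for a parameter-to-solution map \<open>u\<close>, true
  parameter \<open>qd\<close> and a priori estimate \<open>qs\<close>.
\<close>

definition variational_source_condition ::
    "'a::euclidean_space set \<Rightarrow> ('a \<Rightarrow> real) set \<Rightarrow> (('a \<Rightarrow> real) \<Rightarrow> 'a \<Rightarrow> real)
      \<Rightarrow> ('a \<Rightarrow> real) \<Rightarrow> ('a \<Rightarrow> real) \<Rightarrow> real \<Rightarrow> bool" where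
  "variational_source_condition \<Omega> K u qd qs \<alpha> \<longleftrightarrow>
     (\<exists>C>0. \<forall>q\<in>K.
        L2_inner \<Omega> (\<lambda>x. qd x - qs x) (\<lambda>x. qd x - q x)
          \<le> 1/4 * (L2_norm \<Omega> (\<lambda>x. q x - qd x))\<^sup>2
            + C * sobolev_norm \<Omega> 1 (\<lambda>x. u q x - u qd x) powr \<alpha>)"

end

theory Submission
  imports Defs
begin

text \<open>
  Write \<open>p = q\<^sup>\<dagger> - q\<^sup>*\<close>. For a test function \<open>\<phi>\<close>, testing the difference of the two boundary value problems with
  \<open>\<phi> / u(q\<^sup>\<dagger>)\<close> bounds \<open>(\<phi>, q\<^sup>\<dagger> - q)\<close> by \<open>C (\<parallel>\<phi>\<parallel>\<^sub>\<infinity> + \<parallel>\<nabla>\<phi>\<parallel>) \<parallel>u(q) - u(q\<^sup>\<dagger>)\<parallel>\<^sub>1\<close>; the quotient is made admissible by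
  replacing \<open>u(q\<^sup>\<dagger>)\<close> with smooth functions converging to it in \<open>H\<^sup>1\<close>, which the trace condition provides.
  Since \<open>p\<close> is bounded, the approximants of \<open>p\<close> can be kept uniformly bounded, so no Sobolev embedding is needed.
  It remains to approximate \<open>p\<close> by uniformly bounded test functions with \<open>L2\<close> error \<open>O(\<epsilon>\<^sup>\<kappa>)\<close> and gradient
  \<open>O(\<epsilon>\<^sup>\<kappa>\<^sup>-\<^sup>1)\<close> and to balance the two terms. For \<open>\<kappa> \<ge> 1\<close> smooth truncation of the given approximants suffices. For
  \<open>\<kappa> < 1\<close> the approximants are cut off near the boundary and mollified at scale \<open>\<epsilon>\<close>; the cut-off costs the energy
  in a boundary layer of width \<open>~ \<epsilon>\<close>, which is \<open>O(\<epsilon>\<^sup>2\<^sup>\<kappa>)\<close> because the layer has volume \<open>O(\<epsilon>)\<close> if \<open>\<kappa> < 1/2\<close>, and by a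
  Hardy-type inequality if \<open>\<kappa> > 1/2\<close>. This even reaches the exponent \<open>2\<kappa> / (1 + \<kappa>)\<close> itself.
\<close>

subsection \<open>Smooth functions\<close>

text \<open>Dividing by \<open>u qd\<close> is delicate because it is a Sobolev function of
  unspecified sign. The quotient is formed as \<phi> G(w) with w smooth and close to
  \<open>u qd\<close>, where G is smooth and bounded, has bounded derivative and satisfies s G(s) =
  1 for |s| \<ge> c0. The gradient of this product contains \<phi> G'(w) \<nabla>w, and \<nabla>w is
  controlled only in L2; hence the supremum of \<phi> in the estimate and the search for bounded
  approximants.

  The two ranges of \<kappa> use different layer estimates. Volume gives order t, enough below 1/2
  since then t \<le> t^(2\<kappa>) for small t. Above 1/2 this power is too weak; comparing heights
  t and t/l costs a factor of order l and gains l^(-2\<kappa>), a contraction for large l. The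
  bounds must not depend on the distance from the support of \<phi> to the boundary, because the
  approximants may come arbitrarily close to it.

  The cut-off is a discontinuous truncation: increments between two retained points are paid for by
  the seminorm, increments across the cut by the layer energy, and mollification restores
  smoothness.\<close>

abbreviation pd :: "'a::euclidean_space \<Rightarrow> ('a \<Rightarrow> real) \<Rightarrow> 'a \<Rightarrow> real" where
  "pd v f \<equiv> (\<lambda>x. frechet_derivative f (at x) v)"

lemma C_k_SucD: "C_k (Suc k) f \<Longrightarrow> C_k k f"
proof (induction k arbitrary: f)
  case 0
  then show ?case
    by (auto intro!: continuous_at_imp_continuous_on differentiable_imp_continuous_within)
qed auto

lemma pd_eqI: "(f has_derivative f') (at x) \<Longrightarrow> frechet_derivative f (at x) v = f' v"
  by (metis frechet_derivative_at)

lemma frechet_has_derivative: "f differentiable at x \<Longrightarrow> (f has_derivative frechet_derivative f (at x)) (at x)"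
  by (simp add: frechet_derivative_works)

lemma C_k_const: "C_k k (\<lambda>x. c)"
  by (induction k arbitrary: c) auto

lemma C_k_add: "C_k k f \<Longrightarrow> C_k k g \<Longrightarrow> C_k k (\<lambda>x. f x + g x)"
proof (induction k arbitrary: f g)
  case (Suc k)
  have "pd v (\<lambda>x. f x + g x) = (\<lambda>x. pd v f x + pd v g x)" for v
    using Suc.prems
    by (intro ext pd_eqI) (auto intro!: derivative_intros frechet_has_derivative)
  then show ?case using Suc by auto
qed (auto intro: continuous_intros)

lemma C_k_mult: "C_k k f \<Longrightarrow> C_k k g \<Longrightarrow> C_k k (\<lambda>x. f x * g x)"
proof (induction k arbitrary: f g)
  case (Suc k)
  have "pd v (\<lambda>x. f x * g x) = (\<lambda>x. f x * pd v g x + pd v f x * g x)" for v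
    using Suc.prems
    by (intro ext pd_eqI) (auto intro!: derivative_intros frechet_has_derivative)
  moreover have "(\<lambda>x. f x * g x) differentiable at x" for x
    using Suc.prems by (auto intro!: differentiable_mult)
  moreover have "C_k k (\<lambda>x. f x * pd v g x + pd v f x * g x)" if "v \<in> Basis" for v
    using Suc.prems that C_k_SucD[OF Suc.prems(1)] C_k_SucD[OF Suc.prems(2)]
    by (intro C_k_add Suc.IH) auto
  ultimately show ?case by simp
qed (auto intro: continuous_intros)

lemma C_k_inverse: "C_k k f \<Longrightarrow> (\<And>x. f x \<noteq> 0) \<Longrightarrow> C_k k (\<lambda>x. inverse (f x))"
proof (induction k arbitrary: f)
  case (Suc k)
  have "pd v (\<lambda>x. inverse (f x)) = (\<lambda>x. - 1 * (inverse (f x) * pd v f x * inverse (f x)))" for v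
    using Suc.prems
    by (intro ext pd_eqI) (auto intro!: derivative_eq_intros frechet_has_derivative)
  moreover have "(\<lambda>x. inverse (f x)) differentiable at x" for x
    using Suc.prems by (auto intro!: differentiable_inverse)
  moreover have "C_k k (\<lambda>x. - 1 * (inverse (f x) * pd v f x * inverse (f x)))" if "v \<in> Basis" for v
    using Suc.prems that C_k_SucD[OF Suc.prems(1)]
    by (intro C_k_mult C_k_const Suc.IH) auto
  ultimately show ?case by simp
qed (auto intro: continuous_intros)

lemma C_k_compose:
  fixes g :: "real \<Rightarrow> real"
  shows "C_k k g \<Longrightarrow> C_k k f \<Longrightarrow> C_k k (\<lambda>x. g (f x))"
proof (induction k arbitrary: f g)
  case 0
  then have "continuous_on UNIV (g \<circ> f)"
    by (intro continuous_on_compose) (auto intro: continuous_on_subset)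
  then show ?case by (simp add: comp_def)
next
  case (Suc k)
  have "pd v (\<lambda>x. g (f x)) = (\<lambda>x. pd 1 g (f x) * pd v f x)" for v
  proof (intro ext pd_eqI)
    fix x
    have comp: "((\<lambda>x. g (f x)) has_derivative (\<lambda>v. frechet_derivative g (at (f x)) (frechet_derivative f (at x) v))) (at x)"
      using Suc.prems by (intro has_derivative_compose[of f _ x UNIV g]) (auto intro: frechet_has_derivative)
    have lin: "frechet_derivative g (at (f x)) y = frechet_derivative g (at (f x)) 1 * y" for y
      using linear_cmul[OF linear_frechet_derivative[of g "at (f x)"], of y 1] Suc.prems(1) by simp
    show "((\<lambda>x. g (f x)) has_derivative (\<lambda>v. pd 1 g (f x) * pd v f x)) (at x)"
      by (rule has_derivative_eq_rhs[OF comp]) (rule ext, rule lin)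
  qed
  moreover have "(\<lambda>x. g (f x)) differentiable at x" for x
    using Suc.prems by (intro differentiable_compose[of g f x UNIV]) simp_all
  moreover have "C_k k (\<lambda>x. pd 1 g (f x) * pd v f x)" if "v \<in> Basis" for v
    using Suc.prems that C_k_SucD[OF Suc.prems(2)] by (intro C_k_mult Suc.IH[of "pd 1 g"]) simp_all
  ultimately show ?case by simp
qed

lemma C_k_inner: "C_k k (\<lambda>x. x \<bullet> w)"
proof (cases k)
  case (Suc l)
  have "pd v (\<lambda>x. x \<bullet> w) = (\<lambda>x. v \<bullet> w)" for v :: 'a
    by (intro ext pd_eqI) (auto intro!: derivative_eq_intros)
  then show ?thesis using Suc by (auto intro!: C_k_const bounded_linear_imp_differentiable bounded_linear_inner_left)
qed (auto intro: continuous_intros)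

lemma pd_affine:
  assumes "f differentiable at (c *\<^sub>R x + d)"
  shows "pd v (\<lambda>x. f (c *\<^sub>R x + d)) x = c * pd v f (c *\<^sub>R x + d)"
    "(\<lambda>x. f (c *\<^sub>R x + d)) differentiable at x"
proof -
  have "((\<lambda>x. f (c *\<^sub>R x + d)) has_derivative (\<lambda>v. frechet_derivative f (at (c *\<^sub>R x + d)) (c *\<^sub>R v))) (at x)"
    using assms
    by (intro has_derivative_compose[of "\<lambda>x. c *\<^sub>R x + d" _ x UNIV f])
       (auto intro!: derivative_eq_intros frechet_has_derivative)
  then show "pd v (\<lambda>x. f (c *\<^sub>R x + d)) x = c * pd v f (c *\<^sub>R x + d)"
     "(\<lambda>x. f (c *\<^sub>R x + d)) differentiable at x"
    using linear_cmul[OF linear_frechet_derivative[OF assms], of c v]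
    by (auto simp: pd_eqI differentiable_def)
qed

lemma C_k_affine: "C_k k f \<Longrightarrow> C_k k (\<lambda>x. f (c *\<^sub>R x + d))"
proof (induction k arbitrary: f)
  case 0
  then have "continuous_on UNIV (f \<circ> (\<lambda>x. c *\<^sub>R x + d))"
    by (intro continuous_on_compose continuous_intros) (auto intro: continuous_on_subset)
  then show ?case by (simp add: comp_def)
next
  case (Suc k)
  then have eq: "pd v (\<lambda>x. f (c *\<^sub>R x + d)) = (\<lambda>x. c * pd v f (c *\<^sub>R x + d))" for v
    by (auto simp: pd_affine)
  have "C_k k (\<lambda>x. c * pd v f (c *\<^sub>R x + d))" if "v \<in> Basis" for v
    using Suc.prems that by (intro C_k_mult C_k_const Suc.IH) auto
  then show ?case using Suc.prems pd_affine(2)[of f c _ d] by (simp only: C_k.simps eq) simp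
qed

lemma smoothD: "smooth f \<Longrightarrow> C_k k f"
  by (simp add: smooth_def)

lemma smooth_const: "smooth (\<lambda>x. c)"
  and smooth_add: "smooth f \<Longrightarrow> smooth g \<Longrightarrow> smooth (\<lambda>x. f x + g x)"
  and smooth_mult: "smooth f \<Longrightarrow> smooth g \<Longrightarrow> smooth (\<lambda>x. f x * g x)"
  and smooth_inverse: "smooth f \<Longrightarrow> (\<And>x. f x \<noteq> 0) \<Longrightarrow> smooth (\<lambda>x. inverse (f x))"
  and smooth_inner: "smooth (\<lambda>x. x \<bullet> w)"
  and smooth_affine: "smooth f \<Longrightarrow> smooth (\<lambda>x. f (c *\<^sub>R x + d))"
  by (simp_all add: smooth_def C_k_const C_k_add C_k_mult C_k_inverse C_k_inner C_k_affine)

lemma smooth_compose: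
  fixes g :: "real \<Rightarrow> real"
  shows "smooth g \<Longrightarrow> smooth f \<Longrightarrow> smooth (\<lambda>x. g (f x))"
  by (simp add: smooth_def C_k_compose)

lemma smooth_diff: "smooth f \<Longrightarrow> smooth g \<Longrightarrow> smooth (\<lambda>x. f x - g x)"
  using smooth_add[of f "\<lambda>x. -1 * g x"] smooth_mult[of "\<lambda>x. -1" g] smooth_const by auto

lemma smooth_divide: "smooth f \<Longrightarrow> smooth g \<Longrightarrow> (\<And>x. g x \<noteq> 0) \<Longrightarrow> smooth (\<lambda>x. f x / g x)"
  by (simp add: divide_inverse smooth_mult smooth_inverse)

lemma smooth_prod: "finite B \<Longrightarrow> (\<And>b. b \<in> B \<Longrightarrow> smooth (f b)) \<Longrightarrow> smooth (\<lambda>x. \<Prod>b\<in>B. f b x)"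
  by (induction B rule: finite_induct) (auto intro!: smooth_mult smooth_const)

lemma smooth_sum: "finite B \<Longrightarrow> (\<And>b. b \<in> B \<Longrightarrow> smooth (f b)) \<Longrightarrow> smooth (\<lambda>x. \<Sum>b\<in>B. f b x)"
  by (induction B rule: finite_induct) (auto intro!: smooth_add smooth_const)

lemma smooth_pd: "smooth f \<Longrightarrow> v \<in> Basis \<Longrightarrow> smooth (pd v f)"
  unfolding smooth_def
proof
  fix k
  assume "\<forall>k. C_k k f" "v \<in> Basis"
  then have "C_k (Suc k) f" by blast
  then show "C_k k (pd v f)" using \<open>v \<in> Basis\<close> by simp
qed

lemma smooth_differentiable: "smooth f \<Longrightarrow> f differentiable at x"
  using smoothD[of f "Suc 0"] by simp

lemma smooth_has_derivative: "smooth f \<Longrightarrow> (f has_derivative frechet_derivative f (at x)) (at x)"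
  by (rule frechet_has_derivative[OF smooth_differentiable])

lemma smooth_continuous_on: "smooth f \<Longrightarrow> continuous_on S f"
  using smoothD[of f 0] by (auto intro: continuous_on_subset)

lemma smooth_pd_continuous_on: "smooth f \<Longrightarrow> v \<in> Basis \<Longrightarrow> continuous_on S (pd v f)"
  by (simp add: smooth_continuous_on smooth_pd)

lemma pd_mult:
  "smooth f \<Longrightarrow> smooth g \<Longrightarrow> pd v (\<lambda>x. f x * g x) x = f x * pd v g x + pd v f x * g x"
  by (intro pd_eqI) (auto intro!: derivative_intros smooth_has_derivative)

lemma pd_compose:
  fixes g :: "real \<Rightarrow> real"
  assumes "smooth g" "smooth f"
  shows "pd v (\<lambda>x. g (f x)) x = pd 1 g (f x) * pd v f x"
proof -
  have "((\<lambda>x. g (f x)) has_derivative (\<lambda>v. frechet_derivative g (at (f x)) (frechet_derivative f (at x) v))) (at x)"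
    by (intro has_derivative_compose[of f _ x UNIV g] smooth_has_derivative assms)
  then have "pd v (\<lambda>x. g (f x)) x = frechet_derivative g (at (f x)) (frechet_derivative f (at x) v *\<^sub>R 1)"
    by (subst pd_eqI) simp_all
  also have "\<dots> = frechet_derivative f (at x) v *\<^sub>R frechet_derivative g (at (f x)) 1"
    by (rule linear_cmul[OF linear_frechet_derivative]) (simp add: smooth_differentiable assms)
  finally show ?thesis by simp
qed

lemma smooth_real_deriv:
  fixes g :: "real \<Rightarrow> real"
  assumes "smooth g"
  shows "(g has_real_derivative pd 1 g x) (at x)"
proof -
  have "frechet_derivative g (at x) y = pd 1 g x * y" for y
    using linear_cmul[OF linear_frechet_derivative[OF smooth_differentiable[OF assms, of x]], of y 1]
    by simp
  then show ?thesis
    unfolding has_field_derivative_def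
    by (intro has_derivative_eq_rhs[OF smooth_has_derivative[OF assms, of x]] ext)
qed

section \<open>Smooth cut-off functions on the real line\<close>

text \<open>The classical function that is smooth but flat at 0. Every cut-off below is built from
  it: the bounded reciprocal, the truncation, the box bumps and the mollifier.\<close>

definition exp_bump :: "real \<Rightarrow> real" where
  "exp_bump x = (if x > 0 then exp (- 1 / x) else 0)"

lemma exp_bump_pos: "x > 0 \<Longrightarrow> exp_bump x > 0"
  and exp_bump_nonpos: "x \<le> 0 \<Longrightarrow> exp_bump x = 0"
  and exp_bump_nonneg: "exp_bump x \<ge> 0"
  by (auto simp: exp_bump_def)

text \<open>The derivative of exp(-1/x) / x^m is a combination of the same expressions with
  exponents m + 2 and m + 1. The family \<open>E\<close> is therefore closed under differentiation,
  and one induction on the order, for all m at once, gives every derivative; the bump is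
  \<open>E 0\<close>.\<close>

lemma smooth_exp_bump: "smooth exp_bump"
proof -
  define E where "E m x = (if x > 0 then exp (- 1 / x) / x ^ m else 0)" for m :: nat and x :: real
  have lim: "((\<lambda>x. exp (- 1 / x) / x ^ m) \<longlongrightarrow> 0) (at_right (0::real))" for m :: nat
  proof -
    have "((\<lambda>y::real. y ^ m / exp y) \<longlongrightarrow> 0) at_top" by (rule tendsto_power_div_exp_0)
    then have "((\<lambda>x::real. inverse x ^ m / exp (inverse x)) \<longlongrightarrow> 0) (at_right 0)"
      by (rule filterlim_compose) (rule filterlim_inverse_at_top_right)
    then show ?thesis by (simp add: field_simps exp_minus power_inverse)
  qed
  have der: "(E m has_real_derivative (E (m + 2) x - real m * E (m + 1) x)) (at x)" for m x
  proof (cases x "0::real" rule: linorder_cases)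
    case less
    have "(E m has_real_derivative 0) (at x)"
      by (rule has_field_derivative_transform_within[of "\<lambda>_. 0" _ x UNIV "-x"]) (use less in \<open>auto simp: E_def dist_real_def\<close>)
    then show ?thesis using less by (simp add: E_def)
  next
    case greater
    have "((\<lambda>x. exp (- 1 / x) / x ^ m) has_real_derivative (E (m + 2) x - real m * E (m + 1) x)) (at x)"
      using greater
      apply (auto intro!: derivative_eq_intros simp: E_def)
      apply (cases m)
       apply (auto simp: field_simps power2_eq_square)
      done
    then show ?thesis
      by (rule has_field_derivative_transform_within[of _ _ x UNIV x]) (use greater in \<open>auto simp: E_def dist_real_def\<close>)
  next
    \<comment> \<open>At the origin the right difference quotient is exp(-1/h) / h^(m + 1), which
      tends to 0 because the exponential beats every power; the left one is constantly 0.\<close>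
    case equal
    have "((\<lambda>h. (E m (0 + h) - E m 0) / h) \<longlongrightarrow> 0) (at_right 0)"
      using lim[of "Suc m"]
      by (rule Lim_transform_eventually)
         (auto simp: E_def field_simps eventually_at_filter)
    moreover have "((\<lambda>h. (E m (0 + h) - E m 0) / h) \<longlongrightarrow> 0) (at_left 0)"
      by (rule tendsto_eventually) (auto simp: E_def eventually_at_filter)
    ultimately have "((\<lambda>h. (E m (0 + h) - E m 0) / h) \<longlongrightarrow> 0) (at 0)"
      by (simp add: filterlim_split_at)
    then show ?thesis using equal by (simp add: DERIV_def E_def)
  qed
  have pdE: "pd 1 (E m) = (\<lambda>x. E (m + 2) x + (- real m) * E (m + 1) x)" for m
  proof
    fix x
    show "pd 1 (E m) x = E (m + 2) x + (- real m) * E (m + 1) x"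
      using pd_eqI[OF der[of m x, unfolded has_field_derivative_def], of 1] by simp
  qed
  have "C_k k (E m)" for k m
  proof (induction k arbitrary: m)
    case 0
    show ?case using der by (auto intro!: continuous_at_imp_continuous_on DERIV_isCont)
  next
    case (Suc k)
    have "E m differentiable at x" for x
      using der[of m x] by (auto simp: has_field_derivative_def differentiable_def)
    moreover have "C_k k (\<lambda>x. E (m + 2) x + (- real m) * E (m + 1) x)"
      by (intro C_k_add C_k_mult C_k_const Suc.IH)
    ultimately show ?case by (simp add: pdE)
  qed
  then have "smooth (E 0)" unfolding smooth_def by blast
  also have "E 0 = exp_bump" by (auto simp: exp_bump_def E_def)
  finally show ?thesis .
qed

lemma continuous_bounded_on_interval:
  fixes g :: "real \<Rightarrow> real"
  assumes "continuous_on UNIV g"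
  shows "\<exists>M\<ge>0. \<forall>s. \<bar>s\<bar> \<le> R \<longrightarrow> \<bar>g s\<bar> \<le> M"
proof -
  have "compact (g ` {-R..R})"
    by (intro compact_continuous_image continuous_on_subset[OF assms]) auto
  then obtain M where "\<forall>y\<in>g ` {-R..R}. norm y \<le> M"
    using compact_imp_bounded bounded_iff by metis
  then show ?thesis by (intro exI[of _ "max M 0"]) (auto simp: abs_le_iff le_max_iff_disj)
qed

text \<open>The denominator \<open>s\<^sup>2 + exp_bump (c\<^sup>2 - s\<^sup>2)\<close> is positive and equals \<open>s\<^sup>2\<close> for \<open>\<bar>s\<bar> \<ge> c\<close>.\<close>

lemma smooth_reciprocal:
  assumes "c > 0"
  obtains G :: "real \<Rightarrow> real" and M where "smooth G" "M \<ge> 0" "\<And>s. \<bar>G s\<bar> \<le> M" "\<And>s. \<bar>pd 1 G s\<bar> \<le> M"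
    "\<And>s. \<bar>s\<bar> \<ge> c \<Longrightarrow> s * G s = 1"
proof -
  define D where "D s = s * s + exp_bump (c\<^sup>2 - s * s)" for s
  have id: "smooth (\<lambda>s::real. s)" using smooth_inner[of "1::real"] by simp
  have D: "D s > 0" for s
    using assms exp_bump_pos[of "c\<^sup>2 - s * s"] exp_bump_nonneg[of "c\<^sup>2 - s * s"]
    by (cases "s = 0") (auto simp: D_def intro!: add_pos_nonneg simp flip: power2_eq_square)
  have smD: "smooth D" unfolding D_def
    by (intro smooth_add smooth_mult smooth_compose[OF smooth_exp_bump] smooth_diff smooth_const id)
  \<comment> \<open>Since \<open>D\<close> is even, \<open>G\<close> is odd: it inverts arguments of
    either sign beyond the gap.\<close>
  define G where "G s = s / D s" for s
  have G: "smooth G" unfolding G_def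
    by (intro smooth_divide id smD) (use D in \<open>metis less_irrefl\<close>)
  have GG: "s * G s = 1" "G s = 1 / s" if "\<bar>s\<bar> \<ge> c" for s
  proof -
    have "s * s \<ge> c\<^sup>2" using that assms by (metis abs_le_square_iff abs_of_pos power2_eq_square)
    then have "D s = s * s" by (simp add: D_def exp_bump_nonpos)
    then show "s * G s = 1" "G s = 1 / s" using that assms by (auto simp: G_def)
  qed
  obtain M1 where M1: "M1 \<ge> 0" "\<And>s. \<bar>s\<bar> \<le> c \<Longrightarrow> \<bar>G s\<bar> \<le> M1"
    using continuous_bounded_on_interval[OF smooth_continuous_on[OF G]] by blast
  obtain M2 where M2: "M2 \<ge> 0" "\<And>s. \<bar>s\<bar> \<le> c \<Longrightarrow> \<bar>pd 1 G s\<bar> \<le> M2"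
    using continuous_bounded_on_interval[of "pd 1 G", OF smooth_pd_continuous_on[OF G]] by auto
  have "\<bar>G s\<bar> \<le> M1 + 1 / c" for s
  proof (cases "\<bar>s\<bar> \<le> c")
    case False
    then have "\<bar>G s\<bar> \<le> 1 / c" using GG(2)[of s] assms by (auto intro!: divide_left_mono)
    then show ?thesis using M1(1) by simp
  qed (use M1(2)[of s] assms in \<open>auto intro: add_increasing2\<close>)
  moreover have "\<bar>pd 1 G s\<bar> \<le> M2 + 1 / c\<^sup>2" for s
  proof (cases "\<bar>s\<bar> \<le> c")
    case False
    have "((\<lambda>s. 1 / s) has_real_derivative - (1 / s\<^sup>2)) (at s)"
      using False assms by (auto intro!: derivative_eq_intros simp: power2_eq_square)
    then have "(G has_real_derivative - (1 / s\<^sup>2)) (at s)"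
      by (rule has_field_derivative_transform_within[of _ _ s UNIV "\<bar>s\<bar> - c"])
         (use False assms in \<open>auto simp: dist_real_def intro!: GG(2)[symmetric]\<close>)
    then have "pd 1 G s = - (1 / s\<^sup>2)"
      using smooth_real_deriv[OF G, of s] DERIV_unique by blast
    moreover have "1 / s\<^sup>2 \<le> 1 / c\<^sup>2"
      using False assms by (intro divide_left_mono) (auto simp: abs_le_square_iff[symmetric])
    ultimately show ?thesis using M2(1) by simp
  qed (use M2(2)[of s] in \<open>auto intro: add_increasing2\<close>)
  ultimately show thesis
    using that[OF G, of "max (M1 + 1 / c) (M2 + 1 / c\<^sup>2)"] GG(1) M1(1) assms
    by (auto simp: le_max_iff_disj)
qed

text \<open>\<open>N / D\<close> is a smooth cut-off, equal to 1 for |s| \<le> R and to 0 for |s|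
  \<ge> R + 1. The truncation fixes the range of p and is bounded and Lipschitz, so composing
  approximants of p with it makes them uniformly bounded at the price of a constant in all norms
  used.\<close>

lemma smooth_truncation:
  assumes "R > 0"
  obtains T :: "real \<Rightarrow> real" and M where "smooth T" "M \<ge> 0" "\<And>s. \<bar>T s\<bar> \<le> M" "\<And>s. \<bar>pd 1 T s\<bar> \<le> M"
    "\<And>s. \<bar>s\<bar> \<le> R \<Longrightarrow> T s = s"
proof -
  define N where "N s = exp_bump ((R + 1)\<^sup>2 - s * s)" for s
  define D where "D s = N s + exp_bump (s * s - R\<^sup>2)" for s
  have id: "smooth (\<lambda>s::real. s)" using smooth_inner[of "1::real"] by simp
  \<comment> \<open>Because of this gap every s satisfies s * s < (R + 1)^2 or s * s > R^2, so one
    of the two bumps in \<open>D\<close> is positive.\<close>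
  have lt: "R\<^sup>2 < (R + 1)\<^sup>2" using assms by (simp add: power_strict_mono)
  have D: "D s > 0" for s
    using assms exp_bump_pos[of "s * s - R\<^sup>2"] exp_bump_pos[of "(R + 1)\<^sup>2 - s * s"] lt
      exp_bump_nonneg[of "s * s - R\<^sup>2"] exp_bump_nonneg[of "(R + 1)\<^sup>2 - s * s"]
    by (cases "s * s < (R + 1)\<^sup>2") (auto simp: D_def N_def add_pos_nonneg add_nonneg_pos)
  have smN: "smooth N" unfolding N_def
    by (intro smooth_mult smooth_compose[OF smooth_exp_bump] smooth_diff smooth_const id)
  have smD: "smooth D" unfolding D_def
    by (intro smooth_add smN smooth_mult smooth_compose[OF smooth_exp_bump] smooth_diff smooth_const id)
  define T where "T s = s * (N s / D s)" for s
  have T: "smooth T" unfolding T_def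
    by (intro smooth_divide smooth_mult id smD smN) (use D in \<open>metis less_irrefl\<close>)
  have T_id: "T s = s" if "\<bar>s\<bar> \<le> R" for s
  proof -
    have "s * s \<le> R\<^sup>2" using that assms by (metis abs_le_square_iff abs_of_pos power2_eq_square)
    then have "D s = N s" by (simp add: D_def exp_bump_nonpos)
    then show ?thesis using D[of s] by (simp add: T_def)
  qed
  have T0: "T s = 0" if "\<bar>s\<bar> \<ge> R + 1" for s
  proof -
    have "s * s \<ge> (R + 1)\<^sup>2" using that assms abs_le_square_iff[of "R + 1" s] by (simp add: power2_eq_square)
    then have "N s = 0" by (simp add: N_def exp_bump_nonpos)
    then show ?thesis by (simp add: T_def)
  qed
  obtain M1 where M1: "M1 \<ge> 0" "\<And>s. \<bar>s\<bar> \<le> R + 1 \<Longrightarrow> \<bar>T s\<bar> \<le> M1"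
    using continuous_bounded_on_interval[OF smooth_continuous_on[OF T]] by blast
  obtain M2 where M2: "M2 \<ge> 0" "\<And>s. \<bar>s\<bar> \<le> R + 1 \<Longrightarrow> \<bar>pd 1 T s\<bar> \<le> M2"
    using continuous_bounded_on_interval[of "pd 1 T", OF smooth_pd_continuous_on[OF T]] by auto
  have "\<bar>T s\<bar> \<le> M1" for s
    using M1 T0[of s] by (cases "\<bar>s\<bar> \<le> R + 1") auto
  moreover have "\<bar>pd 1 T s\<bar> \<le> M2" for s
  proof (cases "\<bar>s\<bar> \<le> R + 1")
    case False
    have "T x = 0" if "dist x s < \<bar>s\<bar> - (R + 1)" for x
      by (rule T0) (use that in \<open>auto simp: dist_real_def\<close>)
    then have "(T has_real_derivative 0) (at s)"
      by - (rule has_field_derivative_transform_within[of "\<lambda>_. 0" _ s UNIV "\<bar>s\<bar> - (R + 1)"],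
        use False in simp_all)
    then have "pd 1 T s = 0"
      using smooth_real_deriv[OF T, of s] DERIV_unique by blast
    then show ?thesis using M2(1) by simp
  qed (use M2 in auto)
  ultimately show thesis
    using that[OF T, of "max M1 M2"] T_id M1(1) by (auto simp: le_max_iff_disj)
qed

lemma smooth_bounded_deriv_lipschitz:
  fixes g :: "real \<Rightarrow> real"
  assumes "smooth g" "\<And>s. \<bar>pd 1 g s\<bar> \<le> M"
  shows "\<bar>g s - g t\<bar> \<le> M * \<bar>s - t\<bar>"
  using field_differentiable_bound[of UNIV g "pd 1 g" M t s] smooth_real_deriv[OF assms(1)] assms(2)
  by (auto simp: abs_minus_commute)

subsection \<open>Test functions and weak derivatives\<close>

lemma test_functionsI:
  assumes "smooth \<phi>" "compact K" "K \<subseteq> \<Omega>" "\<And>x. x \<notin> K \<Longrightarrow> \<phi> x = 0"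
  shows "\<phi> \<in> test_functions \<Omega>"
proof -
  have "closure {x. \<phi> x \<noteq> 0} \<subseteq> K"
    using assms(2,4) by (intro closure_minimal compact_imp_closed) auto
  then show ?thesis
    using assms closed_Int_compact[of "closure {x. \<phi> x \<noteq> 0}" K] unfolding test_functions_def
    by (auto simp: Int_absorb2)
qed

lemma pd_eq_0:
  assumes "compact K" "\<And>x. x \<notin> K \<Longrightarrow> \<phi> x = 0" "x \<notin> K"
  shows "pd v \<phi> x = 0"
proof -
  have "(\<phi> has_derivative (\<lambda>_. 0)) (at x)"
    by (rule has_derivative_transform_within_open[of "\<lambda>_. 0" _ _ _ "- K"])
       (use assms in \<open>auto simp: compact_imp_closed open_Compl\<close>)
  then show ?thesis by (rule pd_eqI)
qed

lemma test_functionsE: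
  assumes "\<phi> \<in> test_functions \<Omega>"
  obtains K where "smooth \<phi>" "compact K" "K \<subseteq> \<Omega>" "\<And>x. x \<notin> K \<Longrightarrow> \<phi> x = 0"
    "\<And>v x. x \<notin> K \<Longrightarrow> pd v \<phi> x = 0"
proof -
  define K where "K = closure {x. \<phi> x \<noteq> 0}"
  have K: "smooth \<phi>" "compact K" "K \<subseteq> \<Omega>" using assms by (auto simp: test_functions_def K_def)
  have z: "\<phi> x = 0" if "x \<notin> K" for x
    using that closure_subset[of "{x. \<phi> x \<noteq> 0}"] by (auto simp: K_def)
  have "pd v \<phi> x = 0" if "x \<notin> K" for v x
    by (rule pd_eq_0[OF K(2) _ that]) (rule z)
  with that[OF K z] show thesis by blast
qed

lemma test_functions_pd:
  assumes "\<phi> \<in> test_functions \<Omega>" "v \<in> Basis"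
  shows "pd v \<phi> \<in> test_functions \<Omega>"
proof -
  obtain K where "smooth \<phi>" "compact K" "K \<subseteq> \<Omega>" "\<And>x. x \<notin> K \<Longrightarrow> pd v \<phi> x = 0"
    using test_functionsE[OF assms(1)] by metis
  then show ?thesis
    by (intro test_functionsI[of _ K] smooth_pd assms(2)) simp_all
qed

lemma test_functions_partial_derivs:
  "\<phi> \<in> test_functions \<Omega> \<Longrightarrow> set vs \<subseteq> Basis \<Longrightarrow> partial_derivs vs \<phi> \<in> test_functions \<Omega>"
  by (induction vs) (simp_all add: test_functions_pd)

lemma test_functions_mult:
  assumes "\<phi> \<in> test_functions \<Omega>" "smooth w"
  shows "(\<lambda>x. \<phi> x * w x) \<in> test_functions \<Omega>"
proof -
  obtain K where "smooth \<phi>" "compact K" "K \<subseteq> \<Omega>" "\<And>x. x \<notin> K \<Longrightarrow> \<phi> x = 0"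
    using test_functionsE[OF assms(1)] by metis
  then show ?thesis
    by (intro test_functionsI[of _ K] smooth_mult assms(2)) simp_all
qed

lemma test_functions_compose:
  fixes T :: "real \<Rightarrow> real"
  assumes "\<phi> \<in> test_functions \<Omega>" "smooth T" "T 0 = 0"
  shows "(\<lambda>x. T (\<phi> x)) \<in> test_functions \<Omega>"
proof -
  obtain K where "smooth \<phi>" "compact K" "K \<subseteq> \<Omega>" "\<And>x. x \<notin> K \<Longrightarrow> \<phi> x = 0"
    using test_functionsE[OF assms(1)] by metis
  then show ?thesis
    by (intro test_functionsI[of _ K] smooth_compose[OF assms(2)]) (simp_all add: assms(3))
qed

lemma compact_support_bounded:
  fixes f :: "'a::euclidean_space \<Rightarrow> real"
  assumes "continuous_on UNIV f" "compact K" "\<And>x. x \<notin> K \<Longrightarrow> f x = 0"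
  obtains B where "B \<ge> 0" "\<And>x. \<bar>f x\<bar> \<le> B"
proof -
  have "compact (f ` K)"
    by (intro compact_continuous_image continuous_on_subset[OF assms(1)] assms(2)) auto
  then obtain B where B: "\<forall>y\<in>f ` K. norm y \<le> B"
    using compact_imp_bounded bounded_iff by metis
  have "\<bar>f x\<bar> \<le> max B 0" for x
    using B assms(3)[of x] by (cases "x \<in> K") (auto simp: le_max_iff_disj)
  then show thesis using that[of "max B 0"] by auto
qed

lemma test_function_bounded:
  assumes "\<phi> \<in> test_functions \<Omega>"
  obtains B where "B \<ge> 0" "\<And>x. \<bar>\<phi> x\<bar> \<le> B"
proof -
  obtain K where "smooth \<phi>" "compact K" "\<And>x. x \<notin> K \<Longrightarrow> \<phi> x = 0"
    using test_functionsE[OF assms] by metis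
  then show thesis using that smooth_continuous_on compact_support_bounded by metis
qed

lemma compact_support_integrable:
  fixes f :: "'a::euclidean_space \<Rightarrow> real"
  assumes "continuous_on UNIV f" "compact K" "\<And>x. x \<notin> K \<Longrightarrow> f x = 0"
  shows "integrable lborel f"
proof -
  have "integrable lborel (\<lambda>x. indicator K x *\<^sub>R f x)"
    by (intro borel_integrable_compact assms(2) continuous_on_subset[OF assms(1)]) auto
  moreover have "(\<lambda>x. indicator K x *\<^sub>R f x) = f" using assms(3) by (auto simp: indicator_def fun_eq_iff)
  ultimately show ?thesis by simp
qed

lemma smooth_borel_measurable: "smooth f \<Longrightarrow> f \<in> borel_measurable borel"
  by (intro borel_measurable_continuous_onI smooth_continuous_on)

section \<open>Integration by parts for smooth functions\<close>

lemma smooth_line_deriv: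
  assumes "smooth \<psi>"
  shows "((\<lambda>t. \<psi> (x + t *\<^sub>R v)) has_real_derivative pd v \<psi> (x + t *\<^sub>R v)) (at t)"
proof -
  have "((\<lambda>t. \<psi> (x + t *\<^sub>R v)) has_derivative (\<lambda>s. frechet_derivative \<psi> (at (x + t *\<^sub>R v)) (s *\<^sub>R v))) (at t)"
    by (intro has_derivative_compose[of "\<lambda>t. x + t *\<^sub>R v" _ t UNIV \<psi>] smooth_has_derivative assms)
       (auto intro!: derivative_eq_intros)
  moreover have "frechet_derivative \<psi> (at (x + t *\<^sub>R v)) (s *\<^sub>R v) = pd v \<psi> (x + t *\<^sub>R v) * s" for s
    using linear_cmul[OF linear_frechet_derivative[OF smooth_differentiable[OF assms]], of "x + t *\<^sub>R v" s v]
    by simp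
  ultimately show ?thesis by (simp add: has_field_derivative_def)
qed

lemma smooth_line_bound:
  assumes "smooth \<psi>" "\<And>x. \<bar>pd v \<psi> x\<bar> \<le> B"
  shows "\<bar>\<psi> (x + t *\<^sub>R v) - \<psi> x\<bar> \<le> B * \<bar>t\<bar>"
  using field_differentiable_bound[of UNIV "\<lambda>t. \<psi> (x + t *\<^sub>R v)" "\<lambda>t. pd v \<psi> (x + t *\<^sub>R v)" B t 0]
    smooth_line_deriv[OF assms(1)] assms(2) by auto

text \<open>The integrals of the difference quotients of \<open>\<psi>\<close> vanish by translation invariance.\<close>

lemma integral_pd_zero:
  fixes \<psi> :: "'a::euclidean_space \<Rightarrow> real"
  assumes "smooth \<psi>" "compact K" "\<And>x. x \<notin> K \<Longrightarrow> \<psi> x = 0" "v \<in> Basis"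
  shows "(LINT x|lborel. pd v \<psi> x) = 0"
proof -
  obtain B where B: "B \<ge> 0" "\<And>x. \<bar>pd v \<psi> x\<bar> \<le> B"
    by (rule compact_support_bounded[OF smooth_pd_continuous_on[OF assms(1,4)] assms(2)])
       (use pd_eq_0[OF assms(2)] assms(3) in auto)
  obtain R where R: "K \<subseteq> cball 0 R"
    using compact_imp_bounded[OF assms(2)] by (auto simp: bounded_iff subset_iff)
  define h where "h n = 1 / real (Suc n)" for n
  have h: "h n > 0" "h n \<le> 1" for n by (auto simp: h_def)
  have h0: "h \<longlonglongrightarrow> 0" unfolding h_def using LIMSEQ_Suc[OF lim_1_over_n] by simp
  define D where "D n x = (\<psi> (x + h n *\<^sub>R v) - \<psi> x) / h n" for n x
  have int: "integrable lborel \<psi>"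
    by (rule compact_support_integrable[OF smooth_continuous_on assms(2,3)]) (use assms(1) in auto)
  have tr: "integrable lborel (\<lambda>x. \<psi> (x + c)) \<and> (LINT x|lborel. \<psi> (x + c)) = (LINT x|lborel. \<psi> x)" for c
  proof -
    have "integrable (distr lborel borel ((+) c)) \<psi>"
      using int by (simp add: lborel_distr_plus)
    moreover have "integral\<^sup>L (distr lborel borel ((+) c)) \<psi> = (LINT x|lborel. \<psi> x)"
      by (simp add: lborel_distr_plus)
    ultimately show ?thesis
      using smooth_borel_measurable[OF assms(1)]
      by (simp add: integrable_distr_eq integral_distr add.commute)
  qed
  have zero: "(LINT x|lborel. D n x) = 0" for n
    using tr[of "h n *\<^sub>R v"] int by (simp add: D_def)
  have meas: "D n \<in> borel_measurable lborel" for n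
    using tr[of "h n *\<^sub>R v"] int unfolding D_def by (auto dest!: borel_measurable_integrable)
  have lim: "(\<lambda>n. D n x) \<longlonglongrightarrow> pd v \<psi> x" for x
  proof -
    have "((\<lambda>t. (\<psi> (x + t *\<^sub>R v) - \<psi> x) / t) \<longlongrightarrow> pd v \<psi> x) (at 0)"
      using smooth_line_deriv[OF assms(1), of x v 0] by (simp add: DERIV_def)
    moreover have "filterlim h (at 0) sequentially"
      using h0 h(1) by (auto simp: filterlim_at less_imp_neq[symmetric] intro!: always_eventually)
    ultimately show ?thesis unfolding D_def by (rule filterlim_compose)
  qed
  \<comment> \<open>One dominating function for all n: the quotient is at most \<open>B\<close> by
    the mean value theorem, and a shift of length at most 1 cannot bring a point beyond radius R + 1
    into \<open>K\<close>.\<close>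
  have bound: "norm (D n x) \<le> indicator (cball 0 (R + 1)) x *\<^sub>R B" for n x
  proof (cases "x \<in> cball 0 (R + 1)")
    case True
    then show ?thesis
      using smooth_line_bound[OF assms(1) B(2), of x "h n"] h(1)[of n]
      by (auto simp: D_def field_simps)
  next
    case False
    have "norm x - norm (h n *\<^sub>R v) \<le> norm (x + h n *\<^sub>R v)"
      by (metis norm_diff_ineq)
    moreover have "norm (h n *\<^sub>R v) \<le> 1" using h[of n] assms(4) by simp
    moreover have "norm y \<le> R" if "y \<in> K" for y using R that by auto
    ultimately have "x + h n *\<^sub>R v \<notin> K" "x \<notin> K" using False by fastforce+
    then show ?thesis using assms(3) B(1) by (simp add: D_def indicator_def)
  qed
  have "integrable lborel (\<lambda>x. indicator (cball 0 (R + 1)) x *\<^sub>R B :: real)"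
    by (intro borel_integrable_compact) auto
  moreover have "pd v \<psi> \<in> borel_measurable lborel"
    using smooth_borel_measurable[OF smooth_pd[OF assms(1,4)]] by simp
  ultimately have "(\<lambda>n. LINT x|lborel. D n x) \<longlonglongrightarrow> (LINT x|lborel. pd v \<psi> x)"
    by (intro integral_dominated_convergence[of _ _ _ "\<lambda>x. indicator (cball 0 (R + 1)) x *\<^sub>R B"])
       (use meas lim bound in auto)
  then show ?thesis using zero by (simp add: LIMSEQ_const_iff)
qed

text \<open>Each coordinate of a vector is at most its norm, so a common bound B of the partial
  derivatives bounds the operator norm by the dimension times B. The convex set allows local use, on
  balls around a chart centre or an expansion point.\<close>

lemma lipschitz_from_pd:
  fixes \<psi> :: "'a::euclidean_space \<Rightarrow> real"
  assumes "convex S" "\<And>x. x \<in> S \<Longrightarrow> \<psi> differentiable (at x)"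
    "\<And>x b. x \<in> S \<Longrightarrow> b \<in> Basis \<Longrightarrow> \<bar>pd b \<psi> x\<bar> \<le> B" "x \<in> S" "y \<in> S"
  shows "\<bar>\<psi> x - \<psi> y\<bar> \<le> real DIM('a) * B * norm (x - y)"
proof -
  have B: "B \<ge> 0" using assms(3)[OF assms(4)] nonempty_Basis by fastforce
  have "norm (\<psi> x - \<psi> y) \<le> real DIM('a) * B * norm (x - y)"
  proof (rule differentiable_bound[OF assms(1)])
    show "(\<psi> has_derivative frechet_derivative \<psi> (at z)) (at z within S)" if "z \<in> S" for z
      using frechet_has_derivative[OF assms(2)[OF that]] has_derivative_at_withinI by blast
    show "onorm (frechet_derivative \<psi> (at z)) \<le> real DIM('a) * B" if z: "z \<in> S" for z
    proof (rule onorm_bound)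
      fix h :: 'a
      interpret linear "frechet_derivative \<psi> (at z)"
        by (rule linear_frechet_derivative[OF assms(2)[OF z]])
      have "frechet_derivative \<psi> (at z) h = (\<Sum>b\<in>Basis. (h \<bullet> b) * pd b \<psi> z)"
        by (subst (1) euclidean_representation[of h, symmetric]) (simp add: sum scale)
      also have "\<bar>\<dots>\<bar> \<le> (\<Sum>b\<in>(Basis::'a set). norm h * B)"
        using assms(3)[OF z] Basis_le_norm
        by (intro order.trans[OF sum_abs] sum_mono) (auto simp: abs_mult intro!: mult_mono)
      finally show "norm (frechet_derivative \<psi> (at z) h) \<le> real DIM('a) * B * norm h"
        by (simp add: algebra_simps)
    qed (use B in auto)
  qed (use assms in auto)
  then show ?thesis by simp
qed

lemma integrable_lebesgue_on:
  "S \<in> sets lebesgue \<Longrightarrow> integrable (lebesgue_on S) f \<longleftrightarrow> integrable lebesgue (\<lambda>x. indicator S x * f x :: real)"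
  by (simp add: integrable_restrict_space)

lemma integral_lebesgue_on:
  "S \<in> sets lebesgue \<Longrightarrow> (LINT x|lebesgue_on S. f x) = (LINT x|lebesgue. indicator S x * f x :: real)"
  by (simp add: integral_restrict_space)

text \<open>The function spaces are stated over Lebesgue measurable sets, while translation
  invariance and integrability on compact sets are used for \<open>lborel\<close>. For Borel
  functions vanishing off the set the two points of view agree.\<close>

lemma lebesgue_on_lborel:
  fixes f :: "'a::euclidean_space \<Rightarrow> real"
  assumes "S \<in> sets lebesgue" "f \<in> borel_measurable borel" "\<And>x. x \<notin> S \<Longrightarrow> f x = 0"
  shows "integrable (lebesgue_on S) f \<longleftrightarrow> integrable lborel f"
    "(LINT x|lebesgue_on S. f x) = (LINT x|lborel. f x)"
proof -
  have "(\<lambda>x. indicator S x * f x) = f" using assms(3) by (auto simp: indicator_def fun_eq_iff)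
  then show "integrable (lebesgue_on S) f \<longleftrightarrow> integrable lborel f"
    "(LINT x|lebesgue_on S. f x) = (LINT x|lborel. f x)"
    using assms(1,2) by (simp_all add: integrable_lebesgue_on integral_lebesgue_on integrable_completion integral_completion)
qed

text \<open>The multiplier is merely Borel, since indicators of boxes are inserted as well as test
  functions.\<close>

lemma locally_integrable_times:
  fixes f :: "'a::euclidean_space \<Rightarrow> real"
  assumes "open \<Omega>" "locally_integrable \<Omega> f" "\<phi> \<in> borel_measurable borel" "\<And>x. \<bar>\<phi> x\<bar> \<le> B"
    "compact K" "K \<subseteq> \<Omega>" "\<And>x. x \<notin> K \<Longrightarrow> \<phi> x = 0"
  shows "integrable (lebesgue_on \<Omega>) (\<lambda>x. f x * \<phi> x)"
proof -
  have K: "K \<in> sets lebesgue" using assms(5) by (simp add: compact_imp_closed)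
  have "integrable lebesgue (\<lambda>x. indicator K x * f x)"
    using assms(2,5,6) unfolding locally_integrable_def by (simp flip: integrable_lebesgue_on[OF K])
  then have "integrable lebesgue (\<lambda>x. \<phi> x * (indicator K x * f x))"
  proof (rule Bochner_Integration.integrable_bound[OF integrable_mult_right[of B]])
    show "(\<lambda>x. \<phi> x * (indicator K x * f x)) \<in> borel_measurable lebesgue"
      by (rule borel_measurable_times[OF measurable_completion borel_measurable_integrable])
         (use \<open>integrable lebesgue (\<lambda>x. indicator K x * f x)\<close> assms(3) in auto)
    show "AE x in lebesgue. norm (\<phi> x * (indicator K x * f x)) \<le> norm (B * (indicator K x * f x))"
      using assms(4) order_trans[OF assms(4) abs_ge_self]
      by (intro AE_I2) (auto simp: abs_mult intro!: mult_right_mono)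
  qed
  moreover have "(\<lambda>x. \<phi> x * (indicator K x * f x)) = (\<lambda>x. indicator \<Omega> x * (f x * \<phi> x))"
    using assms(6,7) by (auto simp: indicator_def fun_eq_iff)
  ultimately show ?thesis using assms(1) by (simp add: integrable_lebesgue_on)
qed

lemma locally_integrable_test:
  assumes "open \<Omega>" "locally_integrable \<Omega> f" "\<phi> \<in> test_functions \<Omega>"
  shows "integrable (lebesgue_on \<Omega>) (\<lambda>x. f x * \<phi> x)"
proof -
  obtain K where K: "smooth \<phi>" "compact K" "K \<subseteq> \<Omega>" "\<And>x. x \<notin> K \<Longrightarrow> \<phi> x = 0"
    using test_functionsE[OF assms(3)] by metis
  obtain B where "\<And>x. \<bar>\<phi> x\<bar> \<le> B" using test_function_bounded[OF assms(3)] by metis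
  then show ?thesis
    using locally_integrable_times[OF assms(1,2) smooth_borel_measurable[OF K(1)]] K by blast
qed

lemma continuous_locally_integrable:
  fixes f :: "'a::euclidean_space \<Rightarrow> real"
  assumes "continuous_on UNIV f"
  shows "locally_integrable \<Omega> f"
  unfolding locally_integrable_def
proof (intro allI impI)
  fix S assume S: "compact S \<and> S \<subseteq> \<Omega>"
  then have "integrable lborel (\<lambda>x. indicator S x *\<^sub>R f x)"
    by (intro borel_integrable_compact continuous_on_subset[OF assms]) auto
  moreover have "(\<lambda>x. indicator S x * f x) \<in> borel_measurable borel"
    using S borel_measurable_continuous_onI[OF assms]
    by (intro borel_measurable_times borel_measurable_indicator) (auto simp: compact_imp_closed)
  ultimately show "integrable (lebesgue_on S) f"
    using S by (subst integrable_lebesgue_on) (auto simp: compact_imp_closed integrable_completion)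
qed

text \<open>The product of w with a test function has compact support, so its partial derivative
  integrates to 0; expanding by the product rule gives the defining identity.\<close>

lemma smooth_has_weak_deriv:
  fixes w :: "'a::euclidean_space \<Rightarrow> real"
  assumes "open \<Omega>" "smooth w" "v \<in> Basis"
  shows "has_weak_deriv \<Omega> [v] w (pd v w)"
  unfolding has_weak_deriv_def
proof (intro conjI ballI)
  show "locally_integrable \<Omega> w" "locally_integrable \<Omega> (pd v w)"
    using assms by (auto intro!: continuous_locally_integrable smooth_continuous_on smooth_pd)
  fix \<phi> assume phi: "\<phi> \<in> test_functions \<Omega>"
  then obtain K where K: "smooth \<phi>" "compact K" "K \<subseteq> \<Omega>" "\<And>x. x \<notin> K \<Longrightarrow> \<phi> x = 0"
    "\<And>x. x \<notin> K \<Longrightarrow> pd v \<phi> x = 0"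
    using test_functionsE[OF phi] by metis
  have sm: "smooth (\<lambda>x. w x * pd v \<phi> x)" "smooth (\<lambda>x. pd v w x * \<phi> x)" "smooth (\<lambda>x. w x * \<phi> x)"
    using assms K(1) by (auto intro!: smooth_mult smooth_pd)
  have int: "integrable lborel (\<lambda>x. w x * pd v \<phi> x)" "integrable lborel (\<lambda>x. pd v w x * \<phi> x)"
    by (rule compact_support_integrable[OF smooth_continuous_on[OF sm(1)] K(2)], use K in simp,
        rule compact_support_integrable[OF smooth_continuous_on[OF sm(2)] K(2)], use K in simp)
  have "0 = (LINT x|lborel. pd v (\<lambda>x. w x * \<phi> x) x)"
    by (rule integral_pd_zero[OF sm(3) K(2) _ assms(3), symmetric]) (use K in simp)
  also have "\<dots> = (LINT x|lborel. w x * pd v \<phi> x) + (LINT x|lborel. pd v w x * \<phi> x)"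
    using int by (simp add: pd_mult[OF assms(2) K(1)])
  also have "(LINT x|lborel. w x * pd v \<phi> x) = L2_inner \<Omega> w (pd v \<phi>)"
    unfolding L2_inner_def
    by (rule lebesgue_on_lborel(2)[symmetric]) (use assms(1) K smooth_borel_measurable[OF sm(1)] in auto)
  also have "(LINT x|lborel. pd v w x * \<phi> x) = L2_inner \<Omega> (pd v w) \<phi>"
    unfolding L2_inner_def
    by (rule lebesgue_on_lborel(2)[symmetric]) (use assms(1) K smooth_borel_measurable[OF sm(2)] in auto)
  finally show "L2_inner \<Omega> w (partial_derivs [v] \<phi>) = (- 1) ^ length [v] * L2_inner \<Omega> (pd v w) \<phi>"
    by simp
qed

lemma has_weak_deriv_diff:
  assumes "open \<Omega>" "set vs \<subseteq> Basis" "has_weak_deriv \<Omega> vs f g" "has_weak_deriv \<Omega> vs f' g'"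
  shows "has_weak_deriv \<Omega> vs (\<lambda>x. f x - f' x) (\<lambda>x. g x - g' x)"
proof -
  have loc: "locally_integrable \<Omega> f" "locally_integrable \<Omega> f'" "locally_integrable \<Omega> g" "locally_integrable \<Omega> g'"
    using assms(3,4) by (auto simp: has_weak_deriv_def)
  have "L2_inner \<Omega> (\<lambda>x. h x - h' x) \<phi> = L2_inner \<Omega> h \<phi> - L2_inner \<Omega> h' \<phi>"
    if "locally_integrable \<Omega> h" "locally_integrable \<Omega> h'" "\<phi> \<in> test_functions \<Omega>" for h h' \<phi>
    using locally_integrable_test[OF assms(1) _ that(3)] that(1,2)
    by (simp add: L2_inner_def left_diff_distrib)
  then show ?thesis
    using assms loc test_functions_partial_derivs[OF _ assms(2)]
    by (auto simp: has_weak_deriv_def locally_integrable_def right_diff_distrib)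
qed

section \<open>Fundamental lemma of the calculus of variations\<close>

text \<open>A Dynkin system argument: open boxes form an intersection-stable generator of the Borel
  sets, and integrability passes the vanishing on to complements and countable disjoint unions. The
  assumption on the whole space is what complements use.\<close>

lemma set_lebesgue_integral_zero_extend:
  fixes g :: "'a::euclidean_space \<Rightarrow> real"
  assumes g: "integrable lborel g" "\<And>c d. (LINT x:box c d|lborel. g x) = 0" "(LINT x|lborel. g x) = 0"
    and A: "A \<in> sets borel"
  shows "(LINT x:A|lborel. g x) = 0"
proof -
  let ?G = "range (\<lambda>(a, b). box a b :: 'a set)"
  have "Int_stable ?G" "?G \<subseteq> Pow UNIV" "A \<in> sigma_sets UNIV ?G"
    using A by (auto simp: Int_stable_def box_Int_box borel_eq_box)
  then show ?thesis
  proof (induction A rule: sigma_sets_induct_disjoint)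
    case (basic A) then show ?case using g(2) by auto
  next
    case empty then show ?case by (simp add: set_lebesgue_integral_def)
  next
    case (compl A)
    then have A: "A \<in> sets lborel" by (simp add: borel_eq_box)
    have eq: "indicator (UNIV - A) x *\<^sub>R g x = g x - indicator A x *\<^sub>R g x" for x
      by (simp add: indicator_def)
    have "(LINT x:UNIV - A|lborel. g x) = (LINT x|lborel. g x) - (LINT x:A|lborel. g x)"
      unfolding set_lebesgue_integral_def eq
      by (rule Bochner_Integration.integral_diff[OF g(1) integrable_mult_indicator[OF A g(1)]])
    then show ?case unfolding compl.IH g(3) by simp
  next
    case (union F)
    then have F: "F i \<in> sets lborel" for i by (auto simp: borel_eq_box)
    have "(LINT x:(\<Union>i. F i)|lborel. g x) = (\<Sum>i. LINT x:F i|lborel. g x)"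
      using union(1) F g(1) integrable_mult_indicator[of "\<Union>i. F i" lborel g]
      by (intro lebesgue_integral_countable_add) (auto simp: disjoint_family_on_def set_integrable_def)
    then show ?case unfolding union.IH by simp
  qed
qed

definition box_bump :: "'a::euclidean_space \<Rightarrow> 'a \<Rightarrow> 'a \<Rightarrow> real" where
  "box_bump c d x = (\<Prod>b\<in>Basis. exp_bump (x \<bullet> b - c \<bullet> b) * exp_bump (d \<bullet> b - x \<bullet> b))"

lemma smooth_box_bump: "smooth (box_bump c d)"
  unfolding box_bump_def
  by (intro smooth_prod smooth_mult smooth_compose[OF smooth_exp_bump] smooth_diff smooth_const smooth_inner) auto

lemma box_bump_pos: "x \<in> box c d \<Longrightarrow> box_bump c d x > 0"
  unfolding box_bump_def by (intro prod_pos) (auto simp: mem_box intro!: mult_pos_pos exp_bump_pos)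

lemma box_bump_zero:
  assumes "x \<notin> box c d" shows "box_bump c d x = 0"
proof -
  obtain b where "b \<in> Basis" "x \<bullet> b \<le> c \<bullet> b \<or> d \<bullet> b \<le> x \<bullet> b"
    using assms by (auto simp: mem_box not_less)
  then show ?thesis unfolding box_bump_def
    by (intro prod_zero) (auto intro!: bexI[of _ b] simp: exp_bump_nonpos)
qed

lemma box_bump_nonneg: "box_bump c d x \<ge> 0"
  unfolding box_bump_def by (intro prod_nonneg mult_nonneg_nonneg exp_bump_nonneg)

text \<open>The indicator of a box is the limit of \<open>\<psi> / (\<psi> + 1 / n)\<close>.\<close>

lemma integral_box_zero:
  fixes f :: "'a::euclidean_space \<Rightarrow> real"
  assumes "open \<Omega>" "locally_integrable \<Omega> f" "\<And>\<phi>. \<phi> \<in> test_functions \<Omega> \<Longrightarrow> L2_inner \<Omega> f \<phi> = 0"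
    "cbox a b \<subseteq> \<Omega>"
  shows "(LINT x|lebesgue. indicator (box a b \<inter> box c d) x * f x) = 0"
    and "integrable lebesgue (\<lambda>x. indicator (box a b) x * f x)"
proof -
  \<comment> \<open>The factor for the fixed box keeps the support in \<open>cbox a b\<close>, hence
    in \<Omega>, while the second box is arbitrary. The product is positive precisely on the
    intersection.\<close>
  define \<psi> where "\<psi> x = box_bump a b x * box_bump c d x" for x
  have sm: "smooth \<psi>" unfolding \<psi>_def by (intro smooth_mult smooth_box_bump)
  have nn: "\<psi> x \<ge> 0" for x by (simp add: \<psi>_def box_bump_nonneg)
  define \<phi> where "\<phi> n x = \<psi> x / (\<psi> x + 1 / real (Suc n))" for n x
  have pos: "\<psi> x + 1 / real (Suc n) > 0" for n x using nn[of x] by (simp add: add_nonneg_pos)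
  have test: "\<phi> n \<in> test_functions \<Omega>" for n
  proof (rule test_functionsI[OF _ compact_cbox assms(4)])
    show "smooth (\<phi> n)" unfolding \<phi>_def
      by (intro smooth_divide smooth_add sm smooth_const) (use pos in \<open>metis less_irrefl\<close>)
    show "\<phi> n x = 0" if "x \<notin> cbox a b" for x
      using box_bump_zero[of x a b] that box_subset_cbox[of a b] by (auto simp: \<phi>_def \<psi>_def)
  qed
  have \<Omega>: "\<Omega> \<in> sets lebesgue" using assms(1) by simp
  have dom: "integrable (lebesgue_on \<Omega>) (\<lambda>x. f x * indicator (cbox a b) x)"
    by (rule locally_integrable_times[OF assms(1,2), of _ 1 "cbox a b"])
       (use assms(4) in \<open>auto simp: indicator_def\<close>)
  have ind: "integrable (lebesgue_on \<Omega>) (\<lambda>x. f x * indicator (box a b \<inter> box c d) x)" for c d :: 'a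
    by (rule locally_integrable_times[OF assms(1,2), of _ 1 "cbox a b"])
       (use assms(4) box_subset_cbox[of a b] in \<open>auto simp: indicator_def\<close>)
  have "(\<lambda>n. LINT x|lebesgue_on \<Omega>. f x * \<phi> n x) \<longlonglongrightarrow> (LINT x|lebesgue_on \<Omega>. f x * indicator (box a b \<inter> box c d) x)"
  proof (rule integral_dominated_convergence[where w = "\<lambda>x. \<bar>f x * indicator (cbox a b) x\<bar>"])
    show "(\<lambda>x. f x * \<phi> n x) \<in> borel_measurable (lebesgue_on \<Omega>)" for n
      using locally_integrable_test[OF assms(1,2) test] by auto
    show "AE x in lebesgue_on \<Omega>. (\<lambda>n. f x * \<phi> n x) \<longlonglongrightarrow> f x * indicator (box a b \<inter> box c d) x"
    proof (intro AE_I2 tendsto_intros)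
      fix x
      show "(\<lambda>n. \<phi> n x) \<longlonglongrightarrow> indicator (box a b \<inter> box c d) x"
      proof (cases "x \<in> box a b \<inter> box c d")
        case True
        then have "\<psi> x > 0" by (simp add: \<psi>_def box_bump_pos)
        moreover have "(\<lambda>n. 1 / real (Suc n)) \<longlonglongrightarrow> 0" using LIMSEQ_Suc[OF lim_1_over_n] by simp
        ultimately have "(\<lambda>n. \<phi> n x) \<longlonglongrightarrow> \<psi> x / (\<psi> x + 0)"
          unfolding \<phi>_def by (intro tendsto_intros) auto
        then show ?thesis using True \<open>\<psi> x > 0\<close> by simp
      next
        case False
        then have "\<phi> n x = 0" for n by (auto simp: \<phi>_def \<psi>_def box_bump_zero)
        then show ?thesis using False by simp
      qed
    qed
    show "AE x in lebesgue_on \<Omega>. norm (f x * \<phi> n x) \<le> \<bar>f x * indicator (cbox a b) x\<bar>" for n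
    proof (rule AE_I2)
      fix x
      have "\<bar>\<phi> n x\<bar> \<le> indicator (cbox a b) x"
      proof (cases "x \<in> cbox a b")
        case True
        then show ?thesis using nn[of x] pos[of x n] by (simp add: \<phi>_def field_simps)
      next
        case False
        then show ?thesis
          using box_bump_zero[of x a b] box_subset_cbox[of a b] by (auto simp: \<phi>_def \<psi>_def)
      qed
      then show "norm (f x * \<phi> n x) \<le> \<bar>f x * indicator (cbox a b) x\<bar>"
        by (simp add: abs_mult mult_left_mono)
    qed
  qed (use dom ind in auto)
  moreover have "(LINT x|lebesgue_on \<Omega>. f x * \<phi> n x) = 0" for n
    using assms(3)[OF test] by (simp add: L2_inner_def)
  ultimately have "(LINT x|lebesgue_on \<Omega>. f x * indicator (box a b \<inter> box c d) x) = 0"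
    by (simp add: LIMSEQ_const_iff)
  moreover have eq: "indicator \<Omega> x * (f x * indicator (box a b \<inter> U) x) = indicator (box a b \<inter> U) x * f x" for x U
    using assms(4) box_subset_cbox[of a b] by (auto simp: indicator_def)
  ultimately show "(LINT x|lebesgue. indicator (box a b \<inter> box c d) x * f x) = 0"
    by (simp add: integral_lebesgue_on[OF \<Omega>])
  show "integrable lebesgue (\<lambda>x. indicator (box a b) x * f x)"
    using ind[of a b] unfolding integrable_lebesgue_on[OF \<Omega>] eq by (simp only: Int_absorb)
qed

text \<open>Locally integrable functions become integrable after cutting to a box whose closure lies
  in \<Omega>. There all integrals over sub-boxes vanish, hence all integrals over Borel sets.
  Countably many closed boxes exhaust the open set.\<close>

lemma fundamental_lemma_variations:
  fixes f :: "'a::euclidean_space \<Rightarrow> real"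
  assumes "open \<Omega>" "locally_integrable \<Omega> f" "\<And>\<phi>. \<phi> \<in> test_functions \<Omega> \<Longrightarrow> L2_inner \<Omega> f \<phi> = 0"
  shows "AE x in lebesgue_on \<Omega>. f x = 0"
proof -
  have box: "AE x in lebesgue. x \<in> cbox a b \<longrightarrow> f x = 0" if ab: "cbox a b \<subseteq> \<Omega>" for a b
  proof -
    define g where "g x = indicator (box a b) x * f x" for x
    have g: "integrable lebesgue g"
      using integral_box_zero(2)[OF assms ab] by (simp add: g_def[abs_def])
    have "g \<in> borel_measurable lebesgue" using g by (rule borel_measurable_integrable)
    \<comment> \<open>A Borel representative is taken because the extension from boxes to measurable
      sets runs over Borel sets.\<close>
    then obtain g' where g': "g' \<in> borel_measurable lborel" "AE x in lborel. g x = g' x"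
      using completion_ex_borel_measurable_real by blast
    then have ae: "AE x in lebesgue. g x = g' x" by (simp add: AE_completion_iff)
    have g'm: "g' \<in> borel_measurable lebesgue" by (rule measurable_completion[OF g'(1)])
    have "integrable lebesgue g'"
      by (rule integrable_cong_AE_imp[OF g g'm ae])
    then have int: "integrable lborel g'" using g'(1) by (simp add: integrable_completion)
    have z: "(LINT x:U|lborel. g' x) = (LINT x|lebesgue. indicator U x * g x)" if "U \<in> sets borel" for U
    proof -
      have "(LINT x:U|lborel. g' x) = (LINT x|lebesgue. indicator U x * g' x)"
        unfolding set_lebesgue_integral_def using g'(1) that by (subst integral_completion) auto
      also have "\<dots> = (LINT x|lebesgue. indicator U x * g x)"
        using ae borel_measurable_integrable[OF g] g'm sets_completionI_sets[of U lborel] that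
        by (intro integral_cong_AE borel_measurable_times borel_measurable_indicator) auto
      finally show ?thesis .
    qed
    have ii: "indicator U x * g x = indicator (box a b \<inter> U) x * f x" for U x
      by (auto simp: g_def indicator_def)
    have b: "(LINT x:box c d|lborel. g' x) = 0" for c d
      using integral_box_zero(1)[OF assms ab, of c d] by (simp add: z ii)
    have "(LINT x|lborel. g' x) = (LINT x:UNIV|lborel. g' x)" by (simp add: set_lebesgue_integral_def)
    also have "\<dots> = 0"
      using integral_box_zero(1)[OF assms ab, of a b] by (simp add: z g_def[abs_def])
    finally have "AE x in lborel. g' x = 0"
      using set_lebesgue_integral_zero_extend[OF int b] by (intro density_unique_real int) auto
    then have 1: "AE x in lebesgue. g x = 0" using g'(2) by (auto simp: AE_completion_iff)
    \<comment> \<open>The cut was made with the open box but the cover uses closed ones; the faces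
      are negligible.\<close>
    have "cbox a b - box a b \<in> null_sets lebesgue"
      using negligible_frontier_interval negligible_iff_null_sets by blast
    then have "AE x in lebesgue. x \<notin> cbox a b - box a b" by (rule AE_not_in)
    with 1 show ?thesis by eventually_elim (auto simp: g_def indicator_def)
  qed
  obtain \<D> where D: "countable \<D>" "\<D> \<subseteq> Pow \<Omega>" "\<And>X. X \<in> \<D> \<Longrightarrow> \<exists>a b. X = cbox a b" "\<Union>\<D> = \<Omega>"
    using open_countable_Union_open_cbox[OF assms(1)] by metis
  have "AE x in lebesgue. \<forall>X\<in>\<D>. x \<in> X \<longrightarrow> f x = 0"
    using D box by (subst AE_ball_countable) (metis Pow_iff subsetD)+
  then have "AE x in lebesgue. x \<in> \<Omega> \<longrightarrow> f x = 0"
    using D(4) by (auto elim!: eventually_mono)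
  then show ?thesis using assms(1) by (subst AE_restrict_space_iff) auto
qed

text \<open>g - h is a weak derivative of the zero function, so it pairs to 0 with every test
  function.\<close>

lemma has_weak_deriv_unique:
  assumes "open \<Omega>" "set vs \<subseteq> Basis" "has_weak_deriv \<Omega> vs f g" "has_weak_deriv \<Omega> vs f h"
  shows "AE x in lebesgue_on \<Omega>. g x = h x"
proof -
  have "has_weak_deriv \<Omega> vs (\<lambda>x. f x - f x) (\<lambda>x. g x - h x)"
    using has_weak_deriv_diff[OF assms] .
  then have "AE x in lebesgue_on \<Omega>. g x - h x = 0"
    by (intro fundamental_lemma_variations[OF assms(1)]) (auto simp: has_weak_deriv_def L2_inner_def)
  then show ?thesis by simp
qed

lemma weak_deriv_works: "has_weak_deriv \<Omega> vs f g \<Longrightarrow> has_weak_deriv \<Omega> vs f (weak_deriv \<Omega> vs f)"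
  unfolding weak_deriv_def by (rule someI[of "has_weak_deriv \<Omega> vs f"])

lemma weak_deriv_eq:
  assumes "open \<Omega>" "set vs \<subseteq> Basis" "has_weak_deriv \<Omega> vs f g"
  shows "AE x in lebesgue_on \<Omega>. weak_deriv \<Omega> vs f x = g x"
  by (rule has_weak_deriv_unique[OF assms(1,2) weak_deriv_works[OF assms(3)] assms(3)])

lemma has_weak_deriv_Nil: "has_weak_deriv \<Omega> [] f f \<longleftrightarrow> locally_integrable \<Omega> f"
  by (auto simp: has_weak_deriv_def)

subsection \<open>The spaces \<open>L2\<close> and \<open>sobolev\<close>\<close>

lemma L2D:
  assumes "f \<in> L2 \<Omega>"
  shows "f \<in> borel_measurable (lebesgue_on \<Omega>)" "integrable (lebesgue_on \<Omega>) (\<lambda>x. f x * f x)"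
  using assms by (auto simp: L2_def power2_eq_square)

lemma L2_bound:
  assumes "f \<in> borel_measurable (lebesgue_on \<Omega>)" "g \<in> L2 \<Omega>" "AE x in lebesgue_on \<Omega>. \<bar>f x\<bar> \<le> \<bar>g x\<bar>"
  shows "f \<in> L2 \<Omega>" "L2_norm \<Omega> f \<le> L2_norm \<Omega> g"
proof -
  have le: "AE x in lebesgue_on \<Omega>. f x * f x \<le> g x * g x"
    using assms(3) by eventually_elim (metis abs_le_square_iff power2_eq_square)
  have "integrable (lebesgue_on \<Omega>) (\<lambda>x. f x * f x)"
    using le assms(1) by (intro Bochner_Integration.integrable_bound[OF L2D(2)[OF assms(2)]]) auto
  then show "f \<in> L2 \<Omega>" using assms(1) by (simp add: L2_def power2_eq_square)
  show "L2_norm \<Omega> f \<le> L2_norm \<Omega> g"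
    unfolding L2_norm_def L2_inner_def
    using le \<open>integrable (lebesgue_on \<Omega>) (\<lambda>x. f x * f x)\<close> L2D(2)[OF assms(2)]
    by (intro real_sqrt_le_mono integral_mono_AE) auto
qed

lemma L2_scale:
  assumes "f \<in> L2 \<Omega>"
  shows "(\<lambda>x. c * f x) \<in> L2 \<Omega>" "L2_norm \<Omega> (\<lambda>x. c * f x) = \<bar>c\<bar> * L2_norm \<Omega> f"
proof -
  have eq: "c * f x * (c * f x) = c\<^sup>2 * (f x * f x)" for x by (simp add: power2_eq_square)
  show "(\<lambda>x. c * f x) \<in> L2 \<Omega>"
    using L2D[OF assms] by (simp add: L2_def power2_eq_square eq[unfolded power2_eq_square])
  show "L2_norm \<Omega> (\<lambda>x. c * f x) = \<bar>c\<bar> * L2_norm \<Omega> f"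
    unfolding L2_norm_def L2_inner_def eq by (simp add: real_sqrt_mult)
qed

lemma L2_mult_integrable:
  assumes "f \<in> L2 \<Omega>" "g \<in> L2 \<Omega>"
  shows "integrable (lebesgue_on \<Omega>) (\<lambda>x. f x * g x)"
proof (rule Bochner_Integration.integrable_bound)
  show "integrable (lebesgue_on \<Omega>) (\<lambda>x. f x * f x + g x * g x)"
    by (intro Bochner_Integration.integrable_add L2D assms)
  show "AE x in lebesgue_on \<Omega>. norm (f x * g x) \<le> norm (f x * f x + g x * g x)"
  proof (rule AE_I2)
    fix x
    have "0 \<le> (\<bar>f x\<bar> - \<bar>g x\<bar>)\<^sup>2" by simp
    then have "2 * \<bar>f x * g x\<bar> \<le> f x * f x + g x * g x"
      by (simp add: power2_eq_square algebra_simps abs_mult)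
    then show "norm (f x * g x) \<le> norm (f x * f x + g x * g x)" by simp
  qed
qed (intro borel_measurable_times L2D assms)

lemma L2_add:
  assumes "f \<in> L2 \<Omega>" "g \<in> L2 \<Omega>"
  shows "(\<lambda>x. f x + g x) \<in> L2 \<Omega>"
proof -
  have "integrable (lebesgue_on \<Omega>) (\<lambda>x. f x * f x + 2 * (f x * g x) + g x * g x)"
    by (intro Bochner_Integration.integrable_add integrable_mult_right L2_mult_integrable assms)
  then have "integrable (lebesgue_on \<Omega>) (\<lambda>x. (f x + g x)\<^sup>2)"
    by (rule Bochner_Integration.integrable_cong[THEN iffD1, rotated 2])
       (auto simp: power2_eq_square algebra_simps)
  then show ?thesis
    unfolding L2_def using L2D(1)[OF assms(1)] L2D(1)[OF assms(2)] by simp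
qed

lemma L2_diff: "f \<in> L2 \<Omega> \<Longrightarrow> g \<in> L2 \<Omega> \<Longrightarrow> (\<lambda>x. f x - g x) \<in> L2 \<Omega>"
  using L2_add[of f \<Omega> "\<lambda>x. -1 * g x"] L2_scale(1)[of g \<Omega> "-1"] by simp

lemma L2_norm_nonneg: "L2_norm \<Omega> f \<ge> 0"
  by (simp add: L2_norm_def L2_inner_def)

lemma L2_norm_sq: "(L2_norm \<Omega> f)\<^sup>2 = (LINT x|lebesgue_on \<Omega>. f x * f x)"
  by (simp add: L2_norm_def L2_inner_def)

text \<open>The squared norm of f - t g is a nonnegative quadratic in t; its minimiser t = B / C
  gives the inequality when C is nonzero.\<close>

lemma L2_Cauchy_Schwarz:
  assumes "f \<in> L2 \<Omega>" "g \<in> L2 \<Omega>"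
  shows "\<bar>L2_inner \<Omega> f g\<bar> \<le> L2_norm \<Omega> f * L2_norm \<Omega> g"
proof -
  define A where "A = (LINT x|lebesgue_on \<Omega>. f x * f x)"
  define B where "B = L2_inner \<Omega> f g"
  define C where "C = (LINT x|lebesgue_on \<Omega>. g x * g x)"
  have quad: "0 \<le> A - 2 * t * B + t\<^sup>2 * C" for t
  proof -
    have "0 \<le> (LINT x|lebesgue_on \<Omega>. (f x - t * g x)\<^sup>2)" by simp
    also have "(\<lambda>x. (f x - t * g x)\<^sup>2) = (\<lambda>x. f x * f x - 2 * t * (f x * g x) + t\<^sup>2 * (g x * g x))"
      by (auto simp: power2_eq_square algebra_simps)
    also have "(LINT x|lebesgue_on \<Omega>. f x * f x - 2 * t * (f x * g x) + t\<^sup>2 * (g x * g x)) = A - 2 * t * B + t\<^sup>2 * C"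
      using L2D(2)[OF assms(1)] L2D(2)[OF assms(2)] L2_mult_integrable[OF assms]
      by (simp add: A_def B_def C_def L2_inner_def)
    finally show ?thesis .
  qed
  have "C \<ge> 0" by (simp add: C_def)
  have "B\<^sup>2 \<le> A * C"
  proof (cases "C = 0")
    case True
    have "B = 0"
    proof (rule ccontr)
      assume "B \<noteq> 0"
      \<comment> \<open>For C = 0 the quadratic is affine in t, and this t gives it the value
        -1.\<close>
      then show False using quad[of "(A + 1) / (2 * B)"] True by simp
    qed
    then show ?thesis using True by simp
  next
    case False
    then have "0 \<le> A - B\<^sup>2 / C" using quad[of "B / C"] by (simp add: power2_eq_square)
    then show ?thesis using False \<open>C \<ge> 0\<close> by (simp add: field_simps)
  qed
  then have "sqrt (B\<^sup>2) \<le> sqrt (A * C)" by (rule real_sqrt_le_mono)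
  then show ?thesis by (simp add: real_sqrt_mult A_def B_def C_def L2_norm_def L2_inner_def)
qed

lemma L2_norm_triangle:
  assumes "f \<in> L2 \<Omega>" "g \<in> L2 \<Omega>"
  shows "L2_norm \<Omega> (\<lambda>x. f x + g x) \<le> L2_norm \<Omega> f + L2_norm \<Omega> g"
proof (rule power2_le_imp_le)
  have "(L2_norm \<Omega> (\<lambda>x. f x + g x))\<^sup>2 = (LINT x|lebesgue_on \<Omega>. f x * f x + 2 * (f x * g x) + g x * g x)"
    unfolding L2_norm_sq by (intro Bochner_Integration.integral_cong) (auto simp: algebra_simps)
  also have "\<dots> = (L2_norm \<Omega> f)\<^sup>2 + 2 * L2_inner \<Omega> f g + (L2_norm \<Omega> g)\<^sup>2"
    using L2D(2)[OF assms(1)] L2D(2)[OF assms(2)] L2_mult_integrable[OF assms]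
    by (simp add: L2_norm_sq L2_inner_def)
  also have "\<dots> \<le> (L2_norm \<Omega> f)\<^sup>2 + 2 * (L2_norm \<Omega> f * L2_norm \<Omega> g) + (L2_norm \<Omega> g)\<^sup>2"
    using L2_Cauchy_Schwarz[OF assms] by simp
  also have "\<dots> = (L2_norm \<Omega> f + L2_norm \<Omega> g)\<^sup>2" by (simp add: power2_eq_square algebra_simps)
  finally show "(L2_norm \<Omega> (\<lambda>x. f x + g x))\<^sup>2 \<le> (L2_norm \<Omega> f + L2_norm \<Omega> g)\<^sup>2" .
qed (simp add: L2_norm_nonneg)

lemma L2_norm_diff_triangle:
  assumes "f \<in> L2 \<Omega>" "g \<in> L2 \<Omega>"
  shows "L2_norm \<Omega> (\<lambda>x. f x - g x) \<le> L2_norm \<Omega> f + L2_norm \<Omega> g"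
  using L2_norm_triangle[OF assms(1) L2_scale(1)[OF assms(2), of "-1"]] L2_scale(2)[OF assms(2), of "-1"] by simp

text \<open>Measurability of g comes from completeness of Lebesgue measure. This is what makes
  arbitrary choices of weak derivatives harmless.\<close>

lemma L2_cong_AE:
  assumes "\<Omega> \<in> sets lebesgue" "f \<in> L2 \<Omega>" "AE x in lebesgue_on \<Omega>. f x = g x"
  shows "g \<in> L2 \<Omega>" "L2_norm \<Omega> g = L2_norm \<Omega> f"
proof -
  have m: "g \<in> borel_measurable (lebesgue_on \<Omega>)"
  proof (rule borel_measurable_if_D, rule borel_measurable_AE)
    show "(\<lambda>x. if x \<in> \<Omega> then f x else 0) \<in> borel_measurable lebesgue"
      using L2D(1)[OF assms(2)] assms(1) by (rule borel_measurable_if_I)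
    show "AE x in lebesgue. (if x \<in> \<Omega> then f x else 0) = (if x \<in> \<Omega> then g x else 0)"
      using assms(1,3) by (subst (asm) AE_restrict_space_iff) (auto elim: eventually_mono)
  qed
  show "g \<in> L2 \<Omega>" using assms(3) by (intro L2_bound(1)[OF m assms(2)]) (auto elim: eventually_mono)
  then show "L2_norm \<Omega> g = L2_norm \<Omega> f"
    using assms(3) L2D(1)[OF assms(2)] m
    by (intro antisym L2_bound(2)) (auto elim: eventually_mono simp: assms(2))
qed

lemma L2_times_bounded:
  assumes "f \<in> L2 \<Omega>" "h \<in> borel_measurable (lebesgue_on \<Omega>)" "AE x in lebesgue_on \<Omega>. \<bar>h x\<bar> \<le> B" "B \<ge> 0"
  shows "(\<lambda>x. h x * f x) \<in> L2 \<Omega>" "L2_norm \<Omega> (\<lambda>x. h x * f x) \<le> B * L2_norm \<Omega> f"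
proof -
  have "AE x in lebesgue_on \<Omega>. \<bar>h x * f x\<bar> \<le> \<bar>B * f x\<bar>"
    using assms(3) by eventually_elim (use assms(4) in \<open>auto simp: abs_mult intro!: mult_right_mono\<close>)
  then show "(\<lambda>x. h x * f x) \<in> L2 \<Omega>" "L2_norm \<Omega> (\<lambda>x. h x * f x) \<le> B * L2_norm \<Omega> f"
    using L2_bound[of "\<lambda>x. h x * f x" \<Omega> "\<lambda>x. B * f x"] L2D(1)[OF assms(1)] assms(2,4) L2_scale[OF assms(1), of B]
    by auto
qed

lemma L2_const:
  assumes "bounded \<Omega>" "open \<Omega>"
  shows "(\<lambda>x. c) \<in> L2 \<Omega>" "L2_norm \<Omega> (\<lambda>x. c) = \<bar>c\<bar> * sqrt (measure lebesgue \<Omega>)"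
proof -
  have "\<Omega> \<in> lmeasurable" using assms by (simp add: lmeasurable_open)
  then show "(\<lambda>x. c) \<in> L2 \<Omega>"
    by (auto simp: L2_def fmeasurable_def integrable_lebesgue_on intro!: finite_measure.integrable_const
        finite_measureI simp: emeasure_restrict_space)
  show "L2_norm \<Omega> (\<lambda>x. c) = \<bar>c\<bar> * sqrt (measure lebesgue \<Omega>)"
    using assms by (simp add: L2_norm_def L2_inner_def real_sqrt_mult measure_restrict_space)
qed

lemma L2_bounded:
  assumes "bounded \<Omega>" "open \<Omega>" "f \<in> borel_measurable (lebesgue_on \<Omega>)" "AE x in lebesgue_on \<Omega>. \<bar>f x\<bar> \<le> B" "B \<ge> 0"
  shows "f \<in> L2 \<Omega>" "L2_norm \<Omega> f \<le> B * sqrt (measure lebesgue \<Omega>)"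
proof -
  have "AE x in lebesgue_on \<Omega>. \<bar>f x\<bar> \<le> \<bar>B\<bar>" using assms(4,5) by simp
  from L2_bound[OF assms(3) L2_const(1)[OF assms(1,2)] this] L2_const(2)[OF assms(1,2), of B] assms(5)
  show "f \<in> L2 \<Omega>" "L2_norm \<Omega> f \<le> B * sqrt (measure lebesgue \<Omega>)" by auto
qed

lemma borel_measurable_lebesgue_on:
  fixes f :: "'a::euclidean_space \<Rightarrow> real"
  shows "f \<in> borel_measurable borel \<Longrightarrow> f \<in> borel_measurable (lebesgue_on S)"
  by (rule measurable_restrict_space1, rule measurable_completion) simp

lemma continuous_L2:
  fixes f :: "'a::euclidean_space \<Rightarrow> real"
  assumes "bounded \<Omega>" "open \<Omega>" "continuous_on UNIV f"
  shows "f \<in> L2 \<Omega>"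
proof -
  have "compact (f ` closure \<Omega>)"
    using assms by (intro compact_continuous_image continuous_on_subset[OF assms(3)]) (auto simp: compact_eq_bounded_closed)
  then obtain B where B: "\<forall>y\<in>f ` closure \<Omega>. norm y \<le> B"
    using compact_imp_bounded bounded_iff by metis
  show ?thesis
  proof (rule L2_bounded[OF assms(1,2)])
    show "f \<in> borel_measurable (lebesgue_on \<Omega>)"
      by (intro borel_measurable_lebesgue_on borel_measurable_continuous_onI assms)
    show "AE x in lebesgue_on \<Omega>. \<bar>f x\<bar> \<le> max B 0"
      using B closure_subset[of \<Omega>] by (intro AE_I2) (auto simp: le_max_iff_disj)
  qed auto
qed

text \<open>If F fails to be integrable its integral is 0 by convention, and the right side is
  nonnegative because G dominates an absolute value. So an a.e. bound by an integrable function
  suffices.\<close>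

lemma integral_abs_le:
  fixes F G :: "'a \<Rightarrow> real"
  assumes "integrable M G" "AE x in M. \<bar>F x\<bar> \<le> G x"
  shows "\<bar>LINT x|M. F x\<bar> \<le> (LINT x|M. G x)"
proof (cases "integrable M F")
  case True
  have "\<bar>LINT x|M. F x\<bar> \<le> (LINT x|M. \<bar>F x\<bar>)" by (rule integral_abs_bound)
  also have "\<dots> \<le> (LINT x|M. G x)" using True assms by (intro integral_mono_AE) auto
  finally show ?thesis .
next
  case False
  have "AE x in M. 0 \<le> G x" using assms(2) by eventually_elim auto
  then show ?thesis using False by (simp add: not_integrable_integral_eq integral_nonneg_AE)
qed

lemma finite_basis_words: "finite (basis_words m)"
  by (simp add: basis_words_def finite_lists_length_eq)

lemma basis_words_simps: "basis_words 0 = {[]}" "b \<in> Basis \<Longrightarrow> [b] \<in> basis_words 1"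
  by (auto simp: basis_words_def)

lemma sobolev_norm_nonneg: "sobolev_norm \<Omega> s f \<ge> 0"
  unfolding sobolev_norm_def by (intro real_sqrt_ge_zero add_nonneg_nonneg) (auto intro!: sum_nonneg)

lemma L2_norm_weak_deriv_le:
  assumes "m \<le> nat \<lfloor>s\<rfloor>" "vs \<in> basis_words m"
  shows "L2_norm \<Omega> (weak_deriv \<Omega> vs f) \<le> sobolev_norm \<Omega> s f"
proof -
  have "(L2_norm \<Omega> (weak_deriv \<Omega> vs f))\<^sup>2 \<le> (\<Sum>vs\<in>basis_words m. (L2_norm \<Omega> (weak_deriv \<Omega> vs f))\<^sup>2)"
    using assms(2) finite_basis_words by (intro member_le_sum) auto
  also have "\<dots> \<le> (\<Sum>m\<le>nat \<lfloor>s\<rfloor>. \<Sum>vs\<in>basis_words m. (L2_norm \<Omega> (weak_deriv \<Omega> vs f))\<^sup>2)"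
    using assms(1) by (intro member_le_sum[of m _ "\<lambda>m. \<Sum>vs\<in>basis_words m. (L2_norm \<Omega> (weak_deriv \<Omega> vs f))\<^sup>2"])
      (auto intro!: sum_nonneg)
  also have "\<dots> \<le> (\<Sum>m\<le>nat \<lfloor>s\<rfloor>. \<Sum>vs\<in>basis_words m. (L2_norm \<Omega> (weak_deriv \<Omega> vs f))\<^sup>2) +
     (if frac s = 0 then 0
      else \<Sum>vs\<in>basis_words (nat \<lfloor>s\<rfloor>). enn2real (slobodeckij_sq \<Omega> (frac s) (weak_deriv \<Omega> vs f)))"
    by (auto intro!: sum_nonneg)
  finally show ?thesis unfolding sobolev_norm_def by (rule real_le_rsqrt)
qed

text \<open>\<open>weak_deriv\<close> is an arbitrary choice; it is in \<open>L2\<close> because it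
  agrees a.e. with the witness provided by \<open>sobolev\<close>.\<close>

lemma sobolev_weak_deriv:
  assumes "open \<Omega>" "f \<in> sobolev \<Omega> s" "m \<le> nat \<lfloor>s\<rfloor>" "vs \<in> basis_words m"
  shows "has_weak_deriv \<Omega> vs f (weak_deriv \<Omega> vs f)" "weak_deriv \<Omega> vs f \<in> L2 \<Omega>"
proof -
  obtain g where g: "g \<in> L2 \<Omega>" "has_weak_deriv \<Omega> vs f g"
    using assms(2-4) unfolding sobolev_def by blast
  show "has_weak_deriv \<Omega> vs f (weak_deriv \<Omega> vs f)" using g(2) by (rule weak_deriv_works)
  have "set vs \<subseteq> Basis" using assms(4) by (simp add: basis_words_def)
  then have "AE x in lebesgue_on \<Omega>. g x = weak_deriv \<Omega> vs f x"
    using weak_deriv_eq[OF assms(1) _ g(2)] by (auto elim: eventually_mono)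
  then show "weak_deriv \<Omega> vs f \<in> L2 \<Omega>" using L2_cong_AE(1)[OF _ g(1)] assms(1) by auto
qed

lemma weak_deriv_diff:
  assumes "open \<Omega>" "set vs \<subseteq> Basis" "has_weak_deriv \<Omega> vs f g" "has_weak_deriv \<Omega> vs f' g'"
  shows "AE x in lebesgue_on \<Omega>. weak_deriv \<Omega> vs (\<lambda>x. f x - f' x) x = g x - g' x"
  by (rule weak_deriv_eq[OF assms(1,2) has_weak_deriv_diff[OF assms]])

lemma weak_deriv_Nil:
  assumes "open \<Omega>" "locally_integrable \<Omega> f"
  shows "AE x in lebesgue_on \<Omega>. weak_deriv \<Omega> [] f x = f x"
  using weak_deriv_eq[OF assms(1), of "[]" f f] assms(2) by (simp add: has_weak_deriv_Nil)

lemma sobolev_locally_integrable: "f \<in> sobolev \<Omega> s \<Longrightarrow> locally_integrable \<Omega> f"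
  unfolding sobolev_def by (auto simp: basis_words_simps has_weak_deriv_def dest: spec[of _ 0])

lemma locally_integrable_diff:
  "locally_integrable \<Omega> f \<Longrightarrow> locally_integrable \<Omega> g \<Longrightarrow> locally_integrable \<Omega> (\<lambda>x. f x - g x)"
  by (auto simp: locally_integrable_def)

text \<open>The term of order 0 in \<open>sobolev_norm\<close> is the norm of the chosen
  \<open>weak_deriv \<Omega> [] f\<close>, which equals f only a.e.\<close>

lemma L2_norm_le_sobolev_norm:
  assumes "open \<Omega>" "f \<in> L2 \<Omega>" "locally_integrable \<Omega> f"
  shows "L2_norm \<Omega> f \<le> sobolev_norm \<Omega> s f"
proof -
  have "AE x in lebesgue_on \<Omega>. f x = weak_deriv \<Omega> [] f x"
    using weak_deriv_Nil[OF assms(1,3)] by (auto elim: eventually_mono)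
  from L2_cong_AE(2)[OF _ assms(2) this]
  have "L2_norm \<Omega> (weak_deriv \<Omega> [] f) = L2_norm \<Omega> f"
    using assms(1) by simp
  then show ?thesis using L2_norm_weak_deriv_le[of 0 s "[]" \<Omega> f] by (simp add: basis_words_simps)
qed

lemma sobolevL2: "f \<in> sobolev \<Omega> s \<Longrightarrow> f \<in> L2 \<Omega>"
  by (simp add: sobolev_def)

subsection \<open>The equation tested with \<open>\<phi> / u(q\<^sup>\<dagger>)\<close>\<close>

text \<open>The pointwise equation is multiplied by \<psi>, and the sign in the definition of the
  weak derivative cancels the minus in front of the divergence.\<close>

lemma solves_bvp_weak_form:
  fixes \<Omega> :: "'a::euclidean_space set"
  assumes "open \<Omega>" "solves_bvp \<Omega> a f g q u" "\<psi> \<in> test_functions \<Omega>"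
  shows "integrable (lebesgue_on \<Omega>) (\<lambda>x. (f x - q x * u x) * \<psi> x)"
    "\<And>b. b \<in> Basis \<Longrightarrow> integrable (lebesgue_on \<Omega>) (\<lambda>x. a x * weak_deriv \<Omega> [b] u x * pd b \<psi> x)"
    "(\<Sum>b\<in>Basis. LINT x|lebesgue_on \<Omega>. a x * weak_deriv \<Omega> [b] u x * pd b \<psi> x)
       = (LINT x|lebesgue_on \<Omega>. (f x - q x * u x) * \<psi> x)"
    "(\<lambda>x. (f x - q x * u x) * \<psi> x) \<in> borel_measurable (lebesgue_on \<Omega>)"
proof -
  obtain p where p: "\<And>i. i \<in> Basis \<Longrightarrow> has_weak_deriv \<Omega> [i] (\<lambda>x. a x * weak_deriv \<Omega> [i] u x) (p i)"
    and eq: "AE x in lebesgue_on \<Omega>. - (\<Sum>i\<in>Basis. p i x) + q x * u x = f x"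
    using assms(2) unfolding solves_bvp_def by blast
  have eq': "AE x in lebesgue_on \<Omega>. - (\<Sum>i\<in>Basis. p i x * \<psi> x) = (f x - q x * u x) * \<psi> x"
    using eq
  proof eventually_elim
    case (elim x)
    then have "f x - q x * u x = - (\<Sum>i\<in>Basis. p i x)" by simp
    then show ?case by (simp add: sum_distrib_right)
  qed
  have int: "integrable (lebesgue_on \<Omega>) (\<lambda>x. p b x * \<psi> x)" if "b \<in> Basis" for b
    using p[OF that] locally_integrable_test[OF assms(1) _ assms(3)] by (simp add: has_weak_deriv_def)
  show a: "integrable (lebesgue_on \<Omega>) (\<lambda>x. a x * weak_deriv \<Omega> [b] u x * pd b \<psi> x)" if "b \<in> Basis" for b
    using p[OF that] locally_integrable_test[OF assms(1) _ test_functions_pd[OF assms(3) that]]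
    by (simp add: has_weak_deriv_def)
  have sumint: "integrable (lebesgue_on \<Omega>) (\<lambda>x. - (\<Sum>i\<in>Basis. p i x * \<psi> x))"
    by (intro Bochner_Integration.integrable_minus Bochner_Integration.integrable_sum int)
  have o: "\<Omega> \<in> sets lebesgue" using assms(1) by simp
  \<comment> \<open>Measurability is transported through the a.e. equation from the sum of the
    \<open>p i\<close>, again by completeness.\<close>
  show m: "(\<lambda>x. (f x - q x * u x) * \<psi> x) \<in> borel_measurable (lebesgue_on \<Omega>)"
  proof (rule borel_measurable_if_D, rule borel_measurable_AE)
    show "(\<lambda>x. if x \<in> \<Omega> then - (\<Sum>i\<in>Basis. p i x * \<psi> x) else 0) \<in> borel_measurable lebesgue"
      by (rule borel_measurable_if_I[OF borel_measurable_integrable[OF sumint] o])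
    have "AE x in lebesgue. x \<in> \<Omega> \<longrightarrow> - (\<Sum>i\<in>Basis. p i x * \<psi> x) = (f x - q x * u x) * \<psi> x"
      using eq' o by (subst (asm) AE_restrict_space_iff) auto
    then show "AE x in lebesgue. (if x \<in> \<Omega> then - (\<Sum>i\<in>Basis. p i x * \<psi> x) else 0) =
        (if x \<in> \<Omega> then (f x - q x * u x) * \<psi> x else 0)"
      by eventually_elim auto
  qed
  show "integrable (lebesgue_on \<Omega>) (\<lambda>x. (f x - q x * u x) * \<psi> x)"
    by (rule integrable_cong_AE_imp[OF sumint m eq'])
  have "(LINT x|lebesgue_on \<Omega>. (f x - q x * u x) * \<psi> x) = (LINT x|lebesgue_on \<Omega>. - (\<Sum>i\<in>Basis. p i x * \<psi> x))"
    by (rule integral_cong_AE[OF m borel_measurable_integrable[OF sumint]])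
       (use eq' in eventually_elim, simp)
  also have "\<dots> = - (\<Sum>i\<in>Basis. LINT x|lebesgue_on \<Omega>. p i x * \<psi> x)"
    using int by (subst Bochner_Integration.integral_minus, subst Bochner_Integration.integral_sum) auto
  also have "\<dots> = (\<Sum>b\<in>Basis. LINT x|lebesgue_on \<Omega>. a x * weak_deriv \<Omega> [b] u x * pd b \<psi> x)"
    using p assms(3) by (auto simp: has_weak_deriv_def L2_inner_def sum_negf[symmetric] intro!: sum.cong)
  finally show "(\<Sum>b\<in>Basis. LINT x|lebesgue_on \<Omega>. a x * weak_deriv \<Omega> [b] u x * pd b \<psi> x)
       = (LINT x|lebesgue_on \<Omega>. (f x - q x * u x) * \<psi> x)" by simp
qed

section \<open>Comparing two solutions\<close>

text \<open>\<open>W1_inf\<close> bounds some weak derivative of order 0; by uniqueness it is a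
  itself a.e.\<close>

lemma W1_inf_bounded:
  assumes "open \<Omega>" "a \<in> W1_inf \<Omega>"
  obtains A where "A \<ge> 0" "AE x in lebesgue_on \<Omega>. \<bar>a x\<bar> \<le> A"
proof -
  obtain h M where h: "has_weak_deriv \<Omega> [] a h" "AE x in lebesgue_on \<Omega>. \<bar>h x\<bar> \<le> M"
    using assms(2) unfolding W1_inf_def by (auto simp: basis_words_simps dest!: spec[of _ 0])
  have "has_weak_deriv \<Omega> [] a a" using h(1) by (simp add: has_weak_deriv_def)
  from has_weak_deriv_unique[OF assms(1) _ h(1) this]
  have "AE x in lebesgue_on \<Omega>. h x = a x" by simp
  with h(2) have "AE x in lebesgue_on \<Omega>. \<bar>a x\<bar> \<le> max M 0" by eventually_elim auto
  then show thesis using that[of "max M 0"] by simp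
qed

lemma admissible_setD:
  assumes "q \<in> admissible_set \<Omega> qlo qhi" "0 < qlo"
  shows "q \<in> L2 \<Omega>" "q \<in> borel_measurable (lebesgue_on \<Omega>)" "AE x in lebesgue_on \<Omega>. 0 \<le> q x \<and> q x \<le> qhi"
  using assms L2D(1) by (auto simp: admissible_set_def elim: eventually_mono)

lemma sobolev_norm_difference:
  fixes \<Omega> :: "'a::euclidean_space set"
  assumes "open \<Omega>" "u \<in> sobolev \<Omega> s" "v \<in> sobolev \<Omega> s" "1 \<le> s" "b \<in> Basis"
  shows "L2_norm \<Omega> (\<lambda>x. weak_deriv \<Omega> [b] u x - weak_deriv \<Omega> [b] v x) \<le> sobolev_norm \<Omega> 1 (\<lambda>x. u x - v x)"
    "L2_norm \<Omega> (\<lambda>x. u x - v x) \<le> sobolev_norm \<Omega> 1 (\<lambda>x. u x - v x)"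
    "weak_deriv \<Omega> [b] u \<in> L2 \<Omega>" "weak_deriv \<Omega> [b] v \<in> L2 \<Omega>"
proof -
  have s: "1 \<le> nat \<lfloor>s\<rfloor>" using assms(4) by linarith
  note du = sobolev_weak_deriv[OF assms(1,2) s basis_words_simps(2)[OF assms(5)]]
  note dv = sobolev_weak_deriv[OF assms(1,3) s basis_words_simps(2)[OF assms(5)]]
  show "weak_deriv \<Omega> [b] u \<in> L2 \<Omega>" "weak_deriv \<Omega> [b] v \<in> L2 \<Omega>" using du dv by auto
  have ae: "AE x in lebesgue_on \<Omega>. weak_deriv \<Omega> [b] u x - weak_deriv \<Omega> [b] v x = weak_deriv \<Omega> [b] (\<lambda>x. u x - v x) x"
    using weak_deriv_diff[OF assms(1) _ du(1) dv(1)] assms(5) by (auto elim: eventually_mono)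
  have "L2_norm \<Omega> (weak_deriv \<Omega> [b] (\<lambda>x. u x - v x)) = L2_norm \<Omega> (\<lambda>x. weak_deriv \<Omega> [b] u x - weak_deriv \<Omega> [b] v x)"
    by (rule L2_cong_AE(2)[OF _ L2_diff[OF du(2) dv(2)] ae]) (use assms(1) in simp)
  then show "L2_norm \<Omega> (\<lambda>x. weak_deriv \<Omega> [b] u x - weak_deriv \<Omega> [b] v x) \<le> sobolev_norm \<Omega> 1 (\<lambda>x. u x - v x)"
    using L2_norm_weak_deriv_le[of 1 1 "[b]" \<Omega> "\<lambda>x. u x - v x"] basis_words_simps(2)[OF assms(5)] by simp
  show "L2_norm \<Omega> (\<lambda>x. u x - v x) \<le> sobolev_norm \<Omega> 1 (\<lambda>x. u x - v x)"
    by (intro L2_norm_le_sobolev_norm assms(1) L2_diff locally_integrable_diff)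
       (use assms(2,3) sobolevL2 sobolev_locally_integrable in auto)
qed

text \<open>Subtracting the two weak forms leaves r v - q u = (r - q) v - q (u - v) on the right.
  The first part isolates the difference of the coefficients; everything else is linear in u - v and
  is estimated by Cauchy-Schwarz.\<close>

lemma difference_test_bound:
  fixes \<Omega> :: "'a::euclidean_space set"
  assumes dom: "open \<Omega>" and A: "AE x in lebesgue_on \<Omega>. \<bar>a x\<bar> \<le> A" "A \<ge> 0"
    and q: "q \<in> borel_measurable (lebesgue_on \<Omega>)" "AE x in lebesgue_on \<Omega>. \<bar>q x\<bar> \<le> Q" "Q \<ge> 0"
    and sol: "solves_bvp \<Omega> a f g q u" "solves_bvp \<Omega> a f g r v" and psi: "\<psi> \<in> test_functions \<Omega>"
    and psi2: "\<psi> \<in> L2 \<Omega>" "\<And>b. b \<in> Basis \<Longrightarrow> pd b \<psi> \<in> L2 \<Omega>"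
    and r: "r \<in> borel_measurable (lebesgue_on \<Omega>)" "AE x in lebesgue_on \<Omega>. \<bar>r x\<bar> \<le> Q"
  shows "\<bar>LINT x|lebesgue_on \<Omega>. (r x - q x) * v x * \<psi> x\<bar>
    \<le> (A * (\<Sum>b\<in>Basis. L2_norm \<Omega> (pd b \<psi>)) + Q * L2_norm \<Omega> \<psi>) * sobolev_norm \<Omega> 1 (\<lambda>x. u x - v x)"
proof -
  let ?M = "lebesgue_on \<Omega>" and ?N = "sobolev_norm \<Omega> 1 (\<lambda>x. u x - v x)"
  note wu = solves_bvp_weak_form[OF dom sol(1) psi] and wv = solves_bvp_weak_form[OF dom sol(2) psi]
  have sob: "u \<in> sobolev \<Omega> 2" "v \<in> sobolev \<Omega> 2" using sol by (auto simp: solves_bvp_def)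
  have L: "u \<in> L2 \<Omega>" "v \<in> L2 \<Omega>" using sob sobolevL2 by auto
  have w: "(\<lambda>x. u x - v x) \<in> L2 \<Omega>" using L by (rule L2_diff)
  have qw: "(\<lambda>x. q x * (u x - v x)) \<in> L2 \<Omega>" "L2_norm \<Omega> (\<lambda>x. q x * (u x - v x)) \<le> Q * L2_norm \<Omega> (\<lambda>x. u x - v x)"
    using L2_times_bounded[OF w q] by auto
  have "AE x in ?M. \<bar>r x - q x\<bar> \<le> 2 * Q" using q(2) r(2) by eventually_elim auto
  then have rv: "(\<lambda>x. (r x - q x) * v x) \<in> L2 \<Omega>"
    using L2_times_bounded(1)[OF L(2), of "\<lambda>x. r x - q x" "2 * Q"] q r by auto
  note i1 = L2_mult_integrable[OF rv psi2(1)] and i2 = L2_mult_integrable[OF qw(1) psi2(1)]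
  let ?D = "\<lambda>b x. a x * (weak_deriv \<Omega> [b] u x - weak_deriv \<Omega> [b] v x) * pd b \<psi> x"
  have D: "(LINT x|?M. ?D b x) = (LINT x|?M. a x * weak_deriv \<Omega> [b] u x * pd b \<psi> x)
      - (LINT x|?M. a x * weak_deriv \<Omega> [b] v x * pd b \<psi> x)" if "b \<in> Basis" for b
    unfolding Bochner_Integration.integral_diff[OF wu(2)[OF that] wv(2)[OF that], symmetric]
    by (simp add: algebra_simps)
  have "(LINT x|?M. (r x - q x) * v x * \<psi> x) - (LINT x|?M. q x * (u x - v x) * \<psi> x)
      = (LINT x|?M. (f x - q x * u x) * \<psi> x - (f x - r x * v x) * \<psi> x)"
    unfolding Bochner_Integration.integral_diff[OF i1 i2, symmetric]
    by (simp add: algebra_simps)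
  also have "\<dots> = (\<Sum>b\<in>Basis. LINT x|?M. ?D b x)"
    using D by (simp add: Bochner_Integration.integral_diff[OF wu(1) wv(1)] wu(3)[symmetric] wv(3)[symmetric] sum_subtractf)
  finally have eq: "(LINT x|?M. (r x - q x) * v x * \<psi> x)
      = (\<Sum>b\<in>Basis. LINT x|?M. ?D b x) + L2_inner \<Omega> (\<lambda>x. q x * (u x - v x)) \<psi>"
    by (simp add: L2_inner_def)
  have 1: "\<bar>LINT x|?M. ?D b x\<bar> \<le> A * L2_norm \<Omega> (pd b \<psi>) * ?N" if b: "b \<in> Basis" for b
  proof -
    note sd = sobolev_norm_difference[OF dom sob _ b]
    let ?d = "\<lambda>x. weak_deriv \<Omega> [b] u x - weak_deriv \<Omega> [b] v x"
    have d: "?d \<in> L2 \<Omega>" using sd by (intro L2_diff) auto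
    have da: "(\<lambda>x. \<bar>?d x\<bar>) \<in> L2 \<Omega>" "L2_norm \<Omega> (\<lambda>x. \<bar>?d x\<bar>) \<le> L2_norm \<Omega> ?d"
      using L2_bound[OF _ d, of "\<lambda>x. \<bar>?d x\<bar>"] L2D(1)[OF d] by auto
    have pa: "(\<lambda>x. \<bar>pd b \<psi> x\<bar>) \<in> L2 \<Omega>" "L2_norm \<Omega> (\<lambda>x. \<bar>pd b \<psi> x\<bar>) \<le> L2_norm \<Omega> (pd b \<psi>)"
      using L2_bound[OF _ psi2(2)[OF b], of "\<lambda>x. \<bar>pd b \<psi> x\<bar>"] L2D(1)[OF psi2(2)[OF b]] by auto
    have "\<bar>LINT x|?M. ?D b x\<bar> \<le> (LINT x|?M. A * (\<bar>?d x\<bar> * \<bar>pd b \<psi> x\<bar>))"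
    proof (rule integral_abs_le)
      show "integrable ?M (\<lambda>x. A * (\<bar>?d x\<bar> * \<bar>pd b \<psi> x\<bar>))"
        by (intro integrable_mult_right L2_mult_integrable da pa)
      show "AE x in ?M. \<bar>?D b x\<bar> \<le> A * (\<bar>?d x\<bar> * \<bar>pd b \<psi> x\<bar>)"
        using A(1) by eventually_elim (auto simp: abs_mult mult.assoc intro!: mult_right_mono)
    qed
    also have "\<dots> = A * L2_inner \<Omega> (\<lambda>x. \<bar>?d x\<bar>) (\<lambda>x. \<bar>pd b \<psi> x\<bar>)" by (simp add: L2_inner_def)
    also have "\<dots> \<le> A * (L2_norm \<Omega> (\<lambda>x. \<bar>?d x\<bar>) * L2_norm \<Omega> (\<lambda>x. \<bar>pd b \<psi> x\<bar>))"
      using L2_Cauchy_Schwarz[OF da(1) pa(1)] A(2) by (intro mult_left_mono) auto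
    also have "\<dots> \<le> A * (?N * L2_norm \<Omega> (pd b \<psi>))"
      using A(2) da(2) pa(2) sd(1) L2_norm_nonneg order_trans
      by (intro mult_left_mono mult_mono) (auto simp: sobolev_norm_nonneg intro: order_trans)
    finally show ?thesis by (simp add: mult_ac)
  qed
  have b0: "(SOME b. b \<in> Basis) \<in> (Basis :: 'a set)" by (rule SOME_Basis)
  have 2: "\<bar>L2_inner \<Omega> (\<lambda>x. q x * (u x - v x)) \<psi>\<bar> \<le> Q * L2_norm \<Omega> \<psi> * ?N"
  proof -
    have "\<bar>L2_inner \<Omega> (\<lambda>x. q x * (u x - v x)) \<psi>\<bar> \<le> L2_norm \<Omega> (\<lambda>x. q x * (u x - v x)) * L2_norm \<Omega> \<psi>"
      by (rule L2_Cauchy_Schwarz[OF qw(1) psi2(1)])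
    also have "\<dots> \<le> Q * ?N * L2_norm \<Omega> \<psi>"
      using qw(2) sobolev_norm_difference(2)[OF dom sob _ b0] q(3)
      by (intro mult_right_mono L2_norm_nonneg order_trans[OF qw(2)] mult_left_mono) auto
    finally show ?thesis by (simp add: mult_ac)
  qed
  have "\<bar>LINT x|?M. (r x - q x) * v x * \<psi> x\<bar> \<le> (\<Sum>b\<in>Basis. \<bar>LINT x|?M. ?D b x\<bar>) + Q * L2_norm \<Omega> \<psi> * ?N"
    unfolding eq using 2 by (intro order_trans[OF abs_triangle_ineq] add_mono sum_abs) auto
  also have "\<dots> \<le> (\<Sum>b\<in>Basis. A * L2_norm \<Omega> (pd b \<psi>) * ?N) + Q * L2_norm \<Omega> \<psi> * ?N"
    using 1 by (intro add_right_mono sum_mono) auto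
  also have "\<dots> = (A * (\<Sum>b\<in>Basis. L2_norm \<Omega> (pd b \<psi>)) + Q * L2_norm \<Omega> \<psi>) * ?N"
    by (simp add: sum_distrib_left sum_distrib_right algebra_simps)
  finally show ?thesis .
qed

lemma smooth_sobolev_1:
  assumes "bounded \<Omega>" "open \<Omega>" "smooth w"
  shows "w \<in> sobolev \<Omega> 1"
proof -
  have "\<exists>g\<in>L2 \<Omega>. has_weak_deriv \<Omega> vs w g" if "m \<le> 1" "vs \<in> basis_words m" for m vs
  proof (cases vs)
    case Nil
    then show ?thesis
      using continuous_L2[OF assms(1,2) smooth_continuous_on[OF assms(3)]]
        continuous_locally_integrable[OF smooth_continuous_on[OF assms(3)], of \<Omega>] has_weak_deriv_Nil[of \<Omega> w]
      by blast
  next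
    case (Cons b l)
    then have "vs = [b]" "b \<in> Basis" using that by (auto simp: basis_words_def)
    then show ?thesis
      using smooth_has_weak_deriv[OF assms(2,3)] continuous_L2[OF assms(1,2) smooth_pd_continuous_on[OF assms(3)]]
      by auto
  qed
  then show ?thesis
    using continuous_L2[OF assms(1,2) smooth_continuous_on[OF assms(3)]] by (simp add: sobolev_def)
qed

text \<open>Classical partial derivatives of w are weak ones, so along an approximating sequence
  they stay bounded in L2 by those of the limit plus the error.\<close>

lemma smooth_approx_norms:
  assumes "bounded \<Omega>" "open \<Omega>" "smooth w" "v \<in> sobolev \<Omega> 1" "b \<in> Basis"
  shows "L2_norm \<Omega> (pd b w) \<le> L2_norm \<Omega> (weak_deriv \<Omega> [b] v) + sobolev_norm \<Omega> 1 (\<lambda>x. w x - v x)"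
    "L2_norm \<Omega> (\<lambda>x. w x - v x) \<le> sobolev_norm \<Omega> 1 (\<lambda>x. w x - v x)"
proof -
  let ?d = "\<lambda>x. weak_deriv \<Omega> [b] w x - weak_deriv \<Omega> [b] v x"
  note sd = sobolev_norm_difference[OF assms(2) smooth_sobolev_1[OF assms(1-3)] assms(4) order_refl assms(5)]
  show "L2_norm \<Omega> (\<lambda>x. w x - v x) \<le> sobolev_norm \<Omega> 1 (\<lambda>x. w x - v x)" by (rule sd(2))
  have ae: "AE x in lebesgue_on \<Omega>. weak_deriv \<Omega> [b] v x + ?d x = pd b w x"
    using weak_deriv_eq[OF assms(2) _ smooth_has_weak_deriv[OF assms(2,3,5)]] assms(5)
    by (auto elim: eventually_mono)
  have "L2_norm \<Omega> (pd b w) = L2_norm \<Omega> (\<lambda>x. weak_deriv \<Omega> [b] v x + ?d x)"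
    by (rule L2_cong_AE(2)[OF _ _ ae]) (use assms(2) sd in \<open>auto intro!: L2_add L2_diff\<close>)
  also have "\<dots> \<le> L2_norm \<Omega> (weak_deriv \<Omega> [b] v) + L2_norm \<Omega> ?d"
    using sd by (intro L2_norm_triangle L2_diff)
  finally show "L2_norm \<Omega> (pd b w) \<le> L2_norm \<Omega> (weak_deriv \<Omega> [b] v) + sobolev_norm \<Omega> 1 (\<lambda>x. w x - v x)"
    using sd(1) by linarith
qed

text \<open>With v = \<open>u qd\<close>, \<open>difference_test_bound\<close> is applied to \<phi>
  G(w n). As w n tends to v, the product v G(w n) tends to v G(v) = 1, so the left side turns into
  the pairing of \<phi> with qd - q. All constants depend only on v and the data, not on q or
  \<phi>.\<close>

lemma core_estimate:
  fixes \<Omega> :: "'a::euclidean_space set"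
  assumes dom: "bounded \<Omega>" "open \<Omega>" and a: "a \<in> W1_inf \<Omega>"
    and bounds: "0 < qlo" "qlo \<le> qhi"
    and u: "\<And>q. q \<in> admissible_set \<Omega> qlo qhi \<Longrightarrow> solves_bvp \<Omega> a f g q (u q)"
    and qd: "qd \<in> admissible_set \<Omega> qlo qhi"
    and c0: "c0 > 0" "AE x in lebesgue_on \<Omega>. c0 \<le> \<bar>u qd x\<bar>"
  obtains C where "C \<ge> 0"
    "\<And>q \<phi> M. q \<in> admissible_set \<Omega> qlo qhi \<Longrightarrow> \<phi> \<in> test_functions \<Omega> \<Longrightarrow> (\<And>x. \<bar>\<phi> x\<bar> \<le> M) \<Longrightarrow>
      \<bar>L2_inner \<Omega> \<phi> (\<lambda>x. qd x - q x)\<bar>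
        \<le> C * (M + (\<Sum>b\<in>Basis. L2_norm \<Omega> (pd b \<phi>))) * sobolev_norm \<Omega> 1 (\<lambda>x. u q x - u qd x)"
proof -
  let ?M = "lebesgue_on \<Omega>"
  define v where "v = u qd"
  have Q: "qhi \<ge> 0" using bounds by simp
  obtain A where A: "A \<ge> 0" "AE x in ?M. \<bar>a x\<bar> \<le> A" using W1_inf_bounded[OF dom(2) a] .
  obtain G Gm where G: "smooth G" "Gm \<ge> 0" "\<And>s. \<bar>G s\<bar> \<le> Gm" "\<And>s. \<bar>pd 1 G s\<bar> \<le> Gm"
    "\<And>s. \<bar>s\<bar> \<ge> c0 \<Longrightarrow> s * G s = 1"
    using smooth_reciprocal[OF c0(1)] by metis
  have solv: "solves_bvp \<Omega> a f g qd v" unfolding v_def by (rule u[OF qd])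
  then have "has_trace \<Omega> v g" by (simp add: solves_bvp_def)
  then obtain w where v: "v \<in> sobolev \<Omega> 1" and w: "\<And>n. smooth (w n)"
    and w0: "(\<lambda>n. sobolev_norm \<Omega> 1 (\<lambda>x. w n x - v x)) \<longlonglongrightarrow> 0"
    unfolding has_trace_def by blast
  define \<delta> where "\<delta> n = sobolev_norm \<Omega> 1 (\<lambda>x. w n x - v x)" for n
  define V where "V = (\<Sum>b\<in>Basis. L2_norm \<Omega> (weak_deriv \<Omega> [b] v))"
  define S where "S = sqrt (measure lebesgue \<Omega>)"
  have V: "V \<ge> 0" and S: "S \<ge> 0" by (auto simp: V_def S_def L2_norm_nonneg intro!: sum_nonneg)
  \<comment> \<open>The summands belong, in order, to the gradient falling on
    \<open>G (w n)\<close>, the gradient falling on \<phi>, and the term of order 0 in the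
    equation.\<close>
  define C where "C = A * Gm * V + A * Gm + qhi * Gm * S"
  have "C \<ge> 0" using A(1) G(2) Q V S by (simp add: C_def)
  moreover have "\<bar>L2_inner \<Omega> \<phi> (\<lambda>x. qd x - q x)\<bar>
        \<le> C * (M + (\<Sum>b\<in>Basis. L2_norm \<Omega> (pd b \<phi>))) * sobolev_norm \<Omega> 1 (\<lambda>x. u q x - u qd x)"
    if q: "q \<in> admissible_set \<Omega> qlo qhi" and phi: "\<phi> \<in> test_functions \<Omega>" and M: "\<And>x. \<bar>\<phi> x\<bar> \<le> M" for q \<phi> M
  proof -
    let ?N = "sobolev_norm \<Omega> 1 (\<lambda>x. u q x - v x)"
    have M0: "M \<ge> 0" using M[of undefined] by simp
    note qD = admissible_setD[OF q bounds(1)] and qdD = admissible_setD[OF qd bounds(1)]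
    have qb: "AE x in ?M. \<bar>q x\<bar> \<le> qhi" "AE x in ?M. \<bar>qd x\<bar> \<le> qhi"
      using qD(3) qdD(3) by (auto elim: eventually_mono)
    have smphi: "smooth \<phi>" using phi by (rule test_functionsE)
    define \<psi> where "\<psi> n x = \<phi> x * G (w n x)" for n x
    have smG: "smooth (\<lambda>x. G (w n x))" for n by (rule smooth_compose[OF G(1) w])
    have test: "\<psi> n \<in> test_functions \<Omega>" for n
      unfolding \<psi>_def by (rule test_functions_mult[OF phi smG])
    have sm: "smooth (\<psi> n)" for n using test by (rule test_functionsE)
    have L: "h \<in> L2 \<Omega>" if "smooth h" for h
      using continuous_L2[OF dom smooth_continuous_on[OF that]] .
    define P where "P = (\<Sum>b\<in>Basis. L2_norm \<Omega> (pd b \<phi>))"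
    have P: "P \<ge> 0" by (auto simp: P_def L2_norm_nonneg intro!: sum_nonneg)
    have meas: "h \<in> borel_measurable ?M" if "smooth h" for h
      using L2D(1)[OF L[OF that]] .
    have pdpsi: "L2_norm \<Omega> (pd b (\<psi> n)) \<le> M * Gm * (L2_norm \<Omega> (weak_deriv \<Omega> [b] v) + \<delta> n) + Gm * L2_norm \<Omega> (pd b \<phi>)"
      if b: "b \<in> Basis" for b n
    proof -
      have eq: "pd b (\<psi> n) = (\<lambda>x. \<phi> x * pd 1 G (w n x) * pd b (w n) x + G (w n x) * pd b \<phi> x)"
        unfolding \<psi>_def by (simp add: pd_mult[OF smphi smG] pd_compose[OF G(1) w] mult_ac)
      have m1: "smooth (\<lambda>x. \<phi> x * pd 1 G (w n x))"
        by (intro smooth_mult smphi smooth_compose[OF smooth_pd[OF G(1)] w]) simp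
      have "\<bar>\<phi> x * pd 1 G (w n x)\<bar> \<le> M * Gm" for x
        unfolding abs_mult using M G(4) M0 by (intro mult_mono) auto
      then have "L2_norm \<Omega> (\<lambda>x. \<phi> x * pd 1 G (w n x) * pd b (w n) x) \<le> M * Gm * L2_norm \<Omega> (pd b (w n))"
        using M0 G(2) by (intro L2_times_bounded(2) L[OF smooth_pd] w meas[OF m1] b) auto
      moreover have "L2_norm \<Omega> (\<lambda>x. G (w n x) * pd b \<phi> x) \<le> Gm * L2_norm \<Omega> (pd b \<phi>)"
        using G by (intro L2_times_bounded(2) L[OF smooth_pd] smphi meas[OF smG] b) auto
      moreover have "L2_norm \<Omega> (pd b (\<psi> n)) \<le> L2_norm \<Omega> (\<lambda>x. \<phi> x * pd 1 G (w n x) * pd b (w n) x)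
          + L2_norm \<Omega> (\<lambda>x. G (w n x) * pd b \<phi> x)"
        unfolding eq by (intro L2_norm_triangle L smooth_mult m1 smooth_pd w b smG smphi)
      moreover have "M * Gm * L2_norm \<Omega> (pd b (w n)) \<le> M * Gm * (L2_norm \<Omega> (weak_deriv \<Omega> [b] v) + \<delta> n)"
        using smooth_approx_norms(1)[OF dom w v b, of n] M0 G(2) unfolding \<delta>_def by (intro mult_left_mono) auto
      ultimately show ?thesis by linarith
    qed
    have psiM: "\<bar>\<psi> n x\<bar> \<le> M * Gm" for n x
      unfolding \<psi>_def abs_mult using M G(3) M0 by (intro mult_mono) auto
    have psi_norm: "L2_norm \<Omega> (\<psi> n) \<le> M * Gm * S" for n
      unfolding S_def using psiM M0 G(2) by (intro L2_bounded(2) dom meas sm) auto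
    have bound: "\<bar>LINT x|?M. (qd x - q x) * v x * \<psi> n x\<bar>
        \<le> (A * (M * Gm * (V + real DIM('a) * \<delta> n) + Gm * P) + qhi * (M * Gm * S)) * ?N" for n
    proof -
      have "(\<Sum>b\<in>Basis. L2_norm \<Omega> (pd b (\<psi> n))) \<le>
        (\<Sum>b\<in>Basis. M * Gm * (L2_norm \<Omega> (weak_deriv \<Omega> [b] v) + \<delta> n) + Gm * L2_norm \<Omega> (pd b \<phi>))"
        by (intro sum_mono pdpsi)
      also have "\<dots> = M * Gm * (V + real DIM('a) * \<delta> n) + Gm * P"
        by (simp add: sum.distrib V_def P_def sum_distrib_left[symmetric])
      finally have le: "(\<Sum>b\<in>Basis. L2_norm \<Omega> (pd b (\<psi> n))) \<le> M * Gm * (V + real DIM('a) * \<delta> n) + Gm * P" .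
      have "\<bar>LINT x|?M. (qd x - q x) * v x * \<psi> n x\<bar>
        \<le> (A * (\<Sum>b\<in>Basis. L2_norm \<Omega> (pd b (\<psi> n))) + qhi * L2_norm \<Omega> (\<psi> n)) * ?N"
        by (rule difference_test_bound[OF dom(2) A(2,1) qD(2) qb(1) Q u[OF q] solv test L[OF sm] _ qdD(2) qb(2)])
           (intro L smooth_pd sm)
      also have "\<dots> \<le> (A * (M * Gm * (V + real DIM('a) * \<delta> n) + Gm * P) + qhi * (M * Gm * S)) * ?N"
        using le psi_norm[of n] A(1) Q by (intro mult_right_mono add_mono mult_left_mono sobolev_norm_nonneg)
      finally show ?thesis .
    qed
    have vL: "v \<in> L2 \<Omega>" using v by (rule sobolevL2)
    \<comment> \<open>The Lipschitz bound of \<open>G\<close> turns the error of the quotient into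
      |v| |w n - v|, and Cauchy-Schwarz then uses only the L2 convergence of w n.\<close>
    have conv: "\<bar>(LINT x|?M. (qd x - q x) * v x * \<psi> n x) - L2_inner \<Omega> \<phi> (\<lambda>x. qd x - q x)\<bar>
        \<le> 2 * qhi * M * Gm * (L2_norm \<Omega> v * \<delta> n)" for n
    proof -
      have qq: "(\<lambda>x. qd x - q x) \<in> L2 \<Omega>" using qD qdD by (intro L2_diff)
      have wv: "(\<lambda>x. w n x - v x) \<in> L2 \<Omega>" by (intro L2_diff L w vL)
      have qv: "(\<lambda>x. (qd x - q x) * v x) \<in> L2 \<Omega>"
      proof (rule L2_times_bounded(1)[OF vL L2D(1)[OF qq]])
        show "AE x in ?M. \<bar>qd x - q x\<bar> \<le> 2 * qhi" using qb by eventually_elim auto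
      qed (use Q in simp)
      have ab: "(\<lambda>x. \<bar>h x\<bar>) \<in> L2 \<Omega>" "L2_norm \<Omega> (\<lambda>x. \<bar>h x\<bar>) \<le> L2_norm \<Omega> h" if "h \<in> L2 \<Omega>" for h
        using L2_bound[OF _ that, of "\<lambda>x. \<bar>h x\<bar>"] L2D(1)[OF that] by auto
      have "(LINT x|?M. (qd x - q x) * v x * \<psi> n x) - L2_inner \<Omega> \<phi> (\<lambda>x. qd x - q x)
          = (LINT x|?M. (qd x - q x) * v x * \<psi> n x - \<phi> x * (qd x - q x))"
        unfolding L2_inner_def
        by (rule Bochner_Integration.integral_diff[symmetric]) (intro L2_mult_integrable qv L sm smphi qq)+
      also have "\<bar>\<dots>\<bar> \<le> (LINT x|?M. 2 * qhi * M * Gm * (\<bar>v x\<bar> * \<bar>w n x - v x\<bar>))"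
      proof (rule integral_abs_le)
        show "integrable ?M (\<lambda>x. 2 * qhi * M * Gm * (\<bar>v x\<bar> * \<bar>w n x - v x\<bar>))"
          by (intro integrable_mult_right L2_mult_integrable ab vL wv)
        show "AE x in ?M. \<bar>(qd x - q x) * v x * \<psi> n x - \<phi> x * (qd x - q x)\<bar> \<le> 2 * qhi * M * Gm * (\<bar>v x\<bar> * \<bar>w n x - v x\<bar>)"
          using qb c0(2)
        proof eventually_elim
          case (elim x)
          have "v x * G (v x) = 1" using elim(3) by (intro G(5)) (simp add: v_def)
          then have "(qd x - q x) * v x * \<psi> n x - \<phi> x * (qd x - q x) = (qd x - q x) * v x * \<psi> n x - \<phi> x * (qd x - q x) * (v x * G (v x))"
            by simp
          also have "\<dots> = ((qd x - q x) * \<phi> x) * (v x * (G (w n x) - G (v x)))"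
            by (simp add: \<psi>_def algebra_simps)
          also have "\<bar>\<dots>\<bar> = (\<bar>qd x - q x\<bar> * \<bar>\<phi> x\<bar>) * (\<bar>v x\<bar> * \<bar>G (w n x) - G (v x)\<bar>)" by (simp add: abs_mult)
          also have "\<dots> \<le> ((2 * qhi) * M) * (\<bar>v x\<bar> * (Gm * \<bar>w n x - v x\<bar>))"
            using elim M[of x] Q M0 G(2) smooth_bounded_deriv_lipschitz[OF G(1,4)]
            by (intro mult_mono mult_left_mono) auto
          finally show ?case by (simp add: mult_ac)
        qed
      qed
      also have "\<dots> = 2 * qhi * M * Gm * L2_inner \<Omega> (\<lambda>x. \<bar>v x\<bar>) (\<lambda>x. \<bar>w n x - v x\<bar>)" by (simp add: L2_inner_def)
      also have "\<dots> \<le> 2 * qhi * M * Gm * (L2_norm \<Omega> (\<lambda>x. \<bar>v x\<bar>) * L2_norm \<Omega> (\<lambda>x. \<bar>w n x - v x\<bar>))"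
        using L2_Cauchy_Schwarz[OF ab(1)[OF vL] ab(1)[OF wv]] Q M0 G(2) by (intro mult_left_mono) auto
      also have "\<dots> \<le> 2 * qhi * M * Gm * (L2_norm \<Omega> v * \<delta> n)"
        using ab(2)[OF vL] ab(2)[OF wv] smooth_approx_norms(2)[OF dom w v SOME_Basis, of n] Q M0 G(2)
        unfolding \<delta>_def by (intro mult_left_mono mult_mono L2_norm_nonneg) auto
      finally show ?thesis .
    qed
    let ?R = "\<lambda>n. (A * (M * Gm * (V + real DIM('a) * \<delta> n) + Gm * P) + qhi * (M * Gm * S)) * ?N
          + 2 * qhi * M * Gm * (L2_norm \<Omega> v * \<delta> n)"
    have "\<bar>L2_inner \<Omega> \<phi> (\<lambda>x. qd x - q x)\<bar> \<le> ?R n" for n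
      using bound[of n] conv[of n] by linarith
    moreover have "?R \<longlonglongrightarrow> (A * (M * Gm * (V + real DIM('a) * 0) + Gm * P) + qhi * (M * Gm * S)) * ?N
          + 2 * qhi * M * Gm * (L2_norm \<Omega> v * 0)"
      using w0 unfolding \<delta>_def[symmetric] by (intro tendsto_intros)
    ultimately have "\<bar>L2_inner \<Omega> \<phi> (\<lambda>x. qd x - q x)\<bar> \<le> (A * (M * Gm * (V + real DIM('a) * 0) + Gm * P) + qhi * (M * Gm * S)) * ?N
          + 2 * qhi * M * Gm * (L2_norm \<Omega> v * 0)"
      by (intro LIMSEQ_le_const) auto
    also have "\<dots> = (A * Gm * V * M + A * Gm * P + qhi * Gm * S * M) * ?N" by (simp add: algebra_simps)
    also have "\<dots> \<le> (C * (M + P)) * ?N"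
    proof (intro mult_right_mono sobolev_norm_nonneg)
      \<comment> \<open>Multiplying out produces additional mixed terms; being nonnegative, they may
        be added to reach the product form.\<close>
      have "C * (M + P) = (A * Gm * V * M + A * Gm * P + qhi * Gm * S * M) + (A * Gm * V * P + A * Gm * M + qhi * Gm * S * P)"
        by (simp add: C_def algebra_simps)
      moreover have "A * Gm * V * P + A * Gm * M + qhi * Gm * S * P \<ge> 0"
        using A(1) G(2) V S P M0 Q by simp
      ultimately show "A * Gm * V * M + A * Gm * P + qhi * Gm * S * M \<le> C * (M + P)" by linarith
    qed
    finally show ?thesis by (simp add: P_def v_def)
  qed
  ultimately show thesis by (rule that)
qed

subsection \<open>From approximation rates to the variational source condition\<close>

text \<open>A quantitative form of interpolation between L2 and the space of order one:
  approximation error against gradient growth at every small scale, with the extra demand of one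
  supremum bound M for all scales. For \<kappa> = 1 the gradients stay bounded.\<close>

definition approx_rate :: "'a::euclidean_space set \<Rightarrow> ('a \<Rightarrow> real) \<Rightarrow> real \<Rightarrow> bool" where
  "approx_rate \<Omega> p \<kappa> \<longleftrightarrow> (\<exists>M C \<epsilon>0. 0 < \<epsilon>0 \<and> 0 \<le> C \<and> (\<forall>\<epsilon>. 0 < \<epsilon> \<and> \<epsilon> < \<epsilon>0 \<longrightarrow>
     (\<exists>\<phi>\<in>test_functions \<Omega>. (\<forall>x. \<bar>\<phi> x\<bar> \<le> M) \<and> L2_norm \<Omega> (\<lambda>x. p x - \<phi> x) \<le> C * \<epsilon> powr \<kappa> \<and>
        (\<Sum>b\<in>Basis. L2_norm \<Omega> (pd b \<phi>)) \<le> C * \<epsilon> powr (\<kappa> - 1))))"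

text \<open>The parameter \<open>\<epsilon>\<close> balances the two error terms when \<open>\<epsilon>\<^sup>1\<^sup>+\<^sup>\<kappa> = \<parallel>u(q) - u(q\<^sup>\<dagger>)\<parallel>\<close>; large values of
  the right-hand norm are harmless because \<open>K\<close> is bounded in \<open>L\<^sup>2\<close>.\<close>

lemma vsc_from_approx_rate:
  fixes \<Omega> :: "'a::euclidean_space set"
  assumes dom: "bounded \<Omega>" "open \<Omega>" and a: "a \<in> W1_inf \<Omega>"
    and bounds: "0 < qlo" "qlo \<le> qhi"
    and u: "\<And>q. q \<in> admissible_set \<Omega> qlo qhi \<Longrightarrow> solves_bvp \<Omega> a f g q (u q)"
    and qd: "qd \<in> admissible_set \<Omega> qlo qhi"
    and qs: "qs \<in> admissible_set \<Omega> qlo qhi"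
    and c0: "c0 > 0" "AE x in lebesgue_on \<Omega>. c0 \<le> \<bar>u qd x\<bar>"
    and kappa: "0 < \<kappa>" "\<kappa> \<le> 1" and rate: "approx_rate \<Omega> (\<lambda>x. qd x - qs x) \<kappa>"
    and alpha: "0 < \<alpha>" "\<alpha> \<le> 2 * \<kappa> / (1 + \<kappa>)"
  shows "variational_source_condition \<Omega> (admissible_set \<Omega> qlo qhi) u qd qs \<alpha>"
proof -
  let ?p = "\<lambda>x. qd x - qs x"
  obtain C where C: "C \<ge> 0" "\<And>q \<phi> M. q \<in> admissible_set \<Omega> qlo qhi \<Longrightarrow> \<phi> \<in> test_functions \<Omega> \<Longrightarrow> (\<And>x. \<bar>\<phi> x\<bar> \<le> M) \<Longrightarrow>
      \<bar>L2_inner \<Omega> \<phi> (\<lambda>x. qd x - q x)\<bar>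
        \<le> C * (M + (\<Sum>b\<in>Basis. L2_norm \<Omega> (pd b \<phi>))) * sobolev_norm \<Omega> 1 (\<lambda>x. u q x - u qd x)"
    using core_estimate[OF dom a bounds u qd c0] by blast
  obtain M A \<epsilon>0 where e0: "0 < \<epsilon>0" and A: "0 \<le> A"
    and app: "\<And>\<epsilon>. 0 < \<epsilon> \<Longrightarrow> \<epsilon> < \<epsilon>0 \<Longrightarrow>
     \<exists>\<phi>\<in>test_functions \<Omega>. (\<forall>x. \<bar>\<phi> x\<bar> \<le> M) \<and> L2_norm \<Omega> (\<lambda>x. ?p x - \<phi> x) \<le> A * \<epsilon> powr \<kappa> \<and>
        (\<Sum>b\<in>Basis. L2_norm \<Omega> (pd b \<phi>)) \<le> A * \<epsilon> powr (\<kappa> - 1)"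
    using rate unfolding approx_rate_def by blast
  have M: "M \<ge> 0" using app[of "\<epsilon>0 / 2"] e0 by (auto intro: order_trans[OF abs_ge_zero])
  have Q: "qhi \<ge> 0" using bounds by simp
  define \<epsilon>1 where "\<epsilon>1 = min \<epsilon>0 1"
  have e1: "0 < \<epsilon>1" "\<epsilon>1 \<le> \<epsilon>0" "\<epsilon>1 \<le> 1" using e0 by (auto simp: \<epsilon>1_def)
  \<comment> \<open>Below this threshold the balancing scale N^(1/(1+\<kappa>)) is smaller than
    \<epsilon>1, hence admissible. Since \<epsilon>1 \<le> 1 also N \<le> 1, so lowering an exponent
    only enlarges the power.\<close>
  define N0 where "N0 = \<epsilon>1 powr (1 + \<kappa>)"
  have N0: "0 < N0" "N0 \<le> 1" using e1 kappa by (auto simp: N0_def powr_le1)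
  define S where "S = sqrt (measure lebesgue \<Omega>)"
  define B0 where "B0 = L2_norm \<Omega> ?p * (2 * qhi * S)"
  have B0: "B0 \<ge> 0" using Q by (simp add: B0_def S_def L2_norm_nonneg)
  define \<beta> where "\<beta> = 2 * \<kappa> / (1 + \<kappa>)"
  have beta: "\<beta> \<le> 1" "\<alpha> \<le> \<beta>" using kappa alpha by (auto simp: \<beta>_def field_simps)
  \<comment> \<open>The first three summands serve the balanced case, the quotient serves large N,
    and 1 secures positivity.\<close>
  define D where "D = A\<^sup>2 + C * A + C * M + B0 / N0 powr \<alpha> + 1"
  have D: "D > 0" using A C(1) M B0 by (simp add: D_def add_nonneg_pos)
  note pL = L2_diff[OF admissible_setD(1)[OF qd bounds(1)] admissible_setD(1)[OF qs bounds(1)]]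
  have "L2_inner \<Omega> ?p (\<lambda>x. qd x - q x)
          \<le> 1/4 * (L2_norm \<Omega> (\<lambda>x. q x - qd x))\<^sup>2 + D * sobolev_norm \<Omega> 1 (\<lambda>x. u q x - u qd x) powr \<alpha>"
    if q: "q \<in> admissible_set \<Omega> qlo qhi" for q
  proof -
    define N where "N = sobolev_norm \<Omega> 1 (\<lambda>x. u q x - u qd x)"
    define e where "e = L2_norm \<Omega> (\<lambda>x. q x - qd x)"
    note qD = admissible_setD[OF q bounds(1)] and qdD = admissible_setD[OF qd bounds(1)]
    have N: "N \<ge> 0" by (simp add: N_def sobolev_norm_nonneg)
    have dL: "(\<lambda>x. qd x - q x) \<in> L2 \<Omega>" using qD qdD by (intro L2_diff)
    have e: "L2_norm \<Omega> (\<lambda>x. qd x - q x) = e" unfolding e_def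
      using L2_scale(2)[OF dL, of "-1"] by simp
    have main: "L2_inner \<Omega> ?p (\<lambda>x. qd x - q x) \<le> 1/4 * e\<^sup>2 + (A\<^sup>2 * \<epsilon> powr (2 * \<kappa>) + C * (M + A * \<epsilon> powr (\<kappa> - 1)) * N)"
      if eps: "0 < \<epsilon>" "\<epsilon> < \<epsilon>0" for \<epsilon>
    proof -
      obtain \<phi> where phi: "\<phi> \<in> test_functions \<Omega>" "\<And>x. \<bar>\<phi> x\<bar> \<le> M" "L2_norm \<Omega> (\<lambda>x. ?p x - \<phi> x) \<le> A * \<epsilon> powr \<kappa>"
        "(\<Sum>b\<in>Basis. L2_norm \<Omega> (pd b \<phi>)) \<le> A * \<epsilon> powr (\<kappa> - 1)"
        using app[OF eps] by blast
      have "smooth \<phi>" using phi(1) by (rule test_functionsE)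
      then have phiL: "\<phi> \<in> L2 \<Omega>" using continuous_L2[OF dom] smooth_continuous_on by blast
      have "L2_inner \<Omega> ?p (\<lambda>x. qd x - q x) = L2_inner \<Omega> (\<lambda>x. ?p x - \<phi> x) (\<lambda>x. qd x - q x) + L2_inner \<Omega> \<phi> (\<lambda>x. qd x - q x)"
        unfolding L2_inner_def
          Bochner_Integration.integral_add[OF L2_mult_integrable[OF L2_diff[OF pL phiL] dL] L2_mult_integrable[OF phiL dL], symmetric]
        by (simp add: algebra_simps)
      also have "\<dots> \<le> A * \<epsilon> powr \<kappa> * e + C * (M + A * \<epsilon> powr (\<kappa> - 1)) * N"
      proof (rule add_mono)
        have "L2_inner \<Omega> (\<lambda>x. ?p x - \<phi> x) (\<lambda>x. qd x - q x) \<le> L2_norm \<Omega> (\<lambda>x. ?p x - \<phi> x) * e"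
          using L2_Cauchy_Schwarz[OF L2_diff[OF pL phiL] dL] e by simp
        also have "\<dots> \<le> A * \<epsilon> powr \<kappa> * e" using phi(3) by (intro mult_right_mono) (auto simp: e_def L2_norm_nonneg)
        finally show "L2_inner \<Omega> (\<lambda>x. ?p x - \<phi> x) (\<lambda>x. qd x - q x) \<le> A * \<epsilon> powr \<kappa> * e" .
        have "L2_inner \<Omega> \<phi> (\<lambda>x. qd x - q x) \<le> C * (M + (\<Sum>b\<in>Basis. L2_norm \<Omega> (pd b \<phi>))) * N"
          using C(2)[OF q phi(1,2)] unfolding N_def by linarith
        also have "\<dots> \<le> C * (M + A * \<epsilon> powr (\<kappa> - 1)) * N"
          using phi(4) C(1) N by (intro mult_right_mono mult_left_mono) auto
        finally show "L2_inner \<Omega> \<phi> (\<lambda>x. qd x - q x) \<le> C * (M + A * \<epsilon> powr (\<kappa> - 1)) * N" .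
      qed
      \<comment> \<open>Young's inequality, weighted so that the quadratic term carries exactly the
        coefficient 1/4 of the source condition.\<close>
      also have "A * \<epsilon> powr \<kappa> * e \<le> 1/4 * e\<^sup>2 + A\<^sup>2 * \<epsilon> powr (2 * \<kappa>)"
      proof -
        have "0 \<le> (e / 2 - A * \<epsilon> powr \<kappa>)\<^sup>2" by simp
        also have "\<dots> = 1/4 * e\<^sup>2 + A\<^sup>2 * (\<epsilon> powr \<kappa> * \<epsilon> powr \<kappa>) - A * \<epsilon> powr \<kappa> * e"
          by (simp add: power2_eq_square algebra_simps)
        also have "\<epsilon> powr \<kappa> * \<epsilon> powr \<kappa> = \<epsilon> powr (2 * \<kappa>)" by (simp flip: powr_add)
        finally show ?thesis by simp
      qed
      finally show ?thesis by simp
    qed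
    have "L2_inner \<Omega> ?p (\<lambda>x. qd x - q x) \<le> 1/4 * e\<^sup>2 + D * N powr \<alpha>"
    proof (cases "N \<ge> N0")
      case True
      have "AE x in lebesgue_on \<Omega>. \<bar>qd x - q x\<bar> \<le> 2 * qhi"
        using qD(3) qdD(3) by eventually_elim auto
      then have "L2_norm \<Omega> (\<lambda>x. qd x - q x) \<le> 2 * qhi * S"
        unfolding S_def using Q by (intro L2_bounded(2) dom L2D(1)[OF dL]) auto
      then have "L2_inner \<Omega> ?p (\<lambda>x. qd x - q x) \<le> B0"
        using L2_Cauchy_Schwarz[OF pL dL] mult_left_mono[OF _ L2_norm_nonneg, of "L2_norm \<Omega> (\<lambda>x. qd x - q x)" "2 * qhi * S" \<Omega> ?p]
        unfolding B0_def by linarith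
      also have "\<dots> = B0 / N0 powr \<alpha> * N0 powr \<alpha>" using N0 by simp
      also have "\<dots> \<le> D * N powr \<alpha>"
        using True N0 alpha B0 A C(1) M by (intro mult_mono powr_mono2) (auto simp: D_def)
      finally show ?thesis by (simp add: add_increasing)
    next
      case False
      show ?thesis
      proof (cases "N = 0")
        \<comment> \<open>Here N powr \<alpha> is 0 and the balancing scale would be 0, which is not
          admissible. Instead the scale tends to 0 along \<open>h\<close>; the gradient term has
          dropped out with the factor N.\<close>
        case True
        define h where "h n = \<epsilon>1 / real (Suc (Suc n))" for n
        have h: "0 < h n" "h n < \<epsilon>0" for n
        proof -
          show "0 < h n" using e1 by (simp add: h_def)
          have "h n < \<epsilon>1" using e1(1) by (simp add: h_def field_simps add_pos_nonneg)
          then show "h n < \<epsilon>0" using e1 by simp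
        qed
        have "(\<lambda>n. \<epsilon>1 * (1 / real (Suc (Suc n)))) \<longlonglongrightarrow> \<epsilon>1 * 0"
          by (intro tendsto_intros) (use LIMSEQ_Suc[OF LIMSEQ_Suc[OF lim_1_over_n]] in simp)
        then have h0: "h \<longlonglongrightarrow> 0" by (simp add: h_def[abs_def])
        have "(\<lambda>n. h n powr (2 * \<kappa>)) \<longlonglongrightarrow> 0"
          by (rule tendsto_zero_powrI[OF h0 tendsto_const])
             (use kappa less_imp_le[OF h(1)] in \<open>auto intro!: always_eventually\<close>)
        then have "(\<lambda>n. 1/4 * e\<^sup>2 + A\<^sup>2 * h n powr (2 * \<kappa>)) \<longlonglongrightarrow> 1/4 * e\<^sup>2 + A\<^sup>2 * 0"
          by (intro tendsto_intros)
        moreover have "L2_inner \<Omega> ?p (\<lambda>x. qd x - q x) \<le> 1/4 * e\<^sup>2 + A\<^sup>2 * h n powr (2 * \<kappa>)" for n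
          using main[OF h, of n] True by simp
        ultimately have "L2_inner \<Omega> ?p (\<lambda>x. qd x - q x) \<le> 1/4 * e\<^sup>2 + A\<^sup>2 * 0"
          by (intro LIMSEQ_le_const) auto
        then show ?thesis using True by simp
      next
        case nz: False
        then have Np: "N > 0" using N by simp
        have N1: "N \<le> 1" using False N0 by simp
        define \<epsilon> where "\<epsilon> = N powr (1 / (1 + \<kappa>))"
        have "\<epsilon> < N0 powr (1 / (1 + \<kappa>))" unfolding \<epsilon>_def
          using False Np kappa by (intro powr_less_mono2) auto
        also have "\<dots> = \<epsilon>1" using e1 kappa by (simp add: N0_def powr_powr)
        finally have eps: "0 < \<epsilon>" "\<epsilon> < \<epsilon>0" using e1 Np by (auto simp: \<epsilon>_def)
        have p1: "\<epsilon> powr (2 * \<kappa>) = N powr \<beta>" by (simp add: \<epsilon>_def powr_powr \<beta>_def)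
        have "\<epsilon> powr (\<kappa> - 1) * N = N powr ((\<kappa> - 1) / (1 + \<kappa>)) * N powr 1"
          using Np by (simp add: \<epsilon>_def powr_powr)
        also have "\<dots> = N powr ((\<kappa> - 1) / (1 + \<kappa>) + 1)" by (simp only: powr_add)
        also have "(\<kappa> - 1) / (1 + \<kappa>) + 1 = \<beta>" using kappa by (simp add: \<beta>_def field_simps)
        finally have p2: "\<epsilon> powr (\<kappa> - 1) * N = N powr \<beta>" .
        \<comment> \<open>The supremum term contributes order N, which is absorbed because \<kappa>
          \<le> 1 gives \<beta> \<le> 1.\<close>
        have p3: "N \<le> N powr \<beta>" using powr_mono'[of \<beta> 1 N] Np N1 beta by simp
        have p4: "N powr \<beta> \<le> N powr \<alpha>" using powr_mono'[of \<alpha> \<beta> N] Np N1 beta by simp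
        have "A\<^sup>2 * \<epsilon> powr (2 * \<kappa>) + C * (M + A * \<epsilon> powr (\<kappa> - 1)) * N
            = A\<^sup>2 * N powr \<beta> + C * M * N + C * A * (\<epsilon> powr (\<kappa> - 1) * N)"
          unfolding p1 by (simp add: algebra_simps)
        also have "\<dots> \<le> A\<^sup>2 * N powr \<beta> + C * M * N powr \<beta> + C * A * N powr \<beta>"
          using p2 p3 C(1) M A by (intro add_mono mult_left_mono) auto
        also have "\<dots> = (A\<^sup>2 + C * A + C * M) * N powr \<beta>" by (simp add: algebra_simps)
        also have "\<dots> \<le> D * N powr \<alpha>"
          using p4 A C(1) M B0 by (intro mult_mono) (auto simp: D_def)
        finally show ?thesis using main[OF eps] by simp
      qed
    qed
    then show ?thesis by (simp add: N_def e_def)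
  qed
  then show ?thesis unfolding variational_source_condition_def using D by blast
qed

lemma sobolev_norm_1_le:
  assumes "1 \<le> s"
  shows "sobolev_norm \<Omega> 1 f \<le> sobolev_norm \<Omega> s f"
proof -
  have "1 \<le> nat \<lfloor>s\<rfloor>" using assms by linarith
  then have "(\<Sum>m\<le>1. \<Sum>vs\<in>basis_words m. (L2_norm \<Omega> (weak_deriv \<Omega> vs f))\<^sup>2)
      \<le> (\<Sum>m\<le>nat \<lfloor>s\<rfloor>. \<Sum>vs\<in>basis_words m. (L2_norm \<Omega> (weak_deriv \<Omega> vs f))\<^sup>2)"
    by (intro sum_mono2) (auto intro!: sum_nonneg)
  moreover have "0 \<le> (if frac s = 0 then 0
      else \<Sum>vs\<in>basis_words (nat \<lfloor>s\<rfloor>). enn2real (slobodeckij_sq \<Omega> (frac s) (weak_deriv \<Omega> vs f)))"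
    by (auto intro!: sum_nonneg)
  ultimately show ?thesis unfolding sobolev_norm_def
    by (intro real_sqrt_le_mono) (simp add: frac_def)
qed

lemma sobolev_1_superset:
  assumes "1 \<le> s" "f \<in> sobolev \<Omega> s"
  shows "f \<in> sobolev \<Omega> 1"
proof -
  have s: "1 \<le> nat \<lfloor>s\<rfloor>" using assms(1) by linarith
  have "\<exists>g\<in>L2 \<Omega>. has_weak_deriv \<Omega> vs f g" if "m \<le> 1" "vs \<in> basis_words m" for m vs
    using assms(2) that s order_trans[OF that(1) s] unfolding sobolev_def by blast
  then show ?thesis using assms(2) by (simp add: sobolev_def)
qed

text \<open>Since T(p) = p a.e., composing the approximants with T enlarges their L2 error at most
  by the Lipschitz constant and their gradients by a bounded factor. Convergence in the order-one
  norm bounds the gradients uniformly, which is the power \<epsilon>^0.\<close>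

lemma approx_rate_1:
  fixes \<Omega> :: "'a::euclidean_space set"
  assumes dom: "bounded \<Omega>" "open \<Omega>" and s: "1 \<le> s" and p: "p \<in> sobolev0 \<Omega> s"
    and R: "AE x in lebesgue_on \<Omega>. \<bar>p x\<bar> \<le> R" "R > 0"
  shows "approx_rate \<Omega> p 1"
proof -
  obtain T M where T: "smooth T" "M \<ge> 0" "\<And>s. \<bar>T s\<bar> \<le> M" "\<And>s. \<bar>pd 1 T s\<bar> \<le> M" "\<And>s. \<bar>s\<bar> \<le> R \<Longrightarrow> T s = s"
    using smooth_truncation[OF R(2)] by metis
  have T0: "T 0 = 0" using T(5)[of 0] R(2) by simp
  obtain \<phi> where ps: "p \<in> sobolev \<Omega> s" and phi: "\<And>n. \<phi> n \<in> test_functions \<Omega>"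
    and lim: "(\<lambda>n. sobolev_norm \<Omega> s (\<lambda>x. \<phi> n x - p x)) \<longlonglongrightarrow> 0"
    using p unfolding sobolev0_def by blast
  have p1: "p \<in> sobolev \<Omega> 1" by (rule sobolev_1_superset[OF s ps])
  have pL: "p \<in> L2 \<Omega>" using p1 by (rule sobolevL2)
  \<comment> \<open>The 1 bounds the order-one error of the approximant, which is chosen smaller
    than \<epsilon> < 1.\<close>
  define V where "V = (\<Sum>b\<in>Basis. M * (L2_norm \<Omega> (weak_deriv \<Omega> [b] p) + 1))"
  define C where "C = max M V"
  have main: "\<exists>\<psi>\<in>test_functions \<Omega>. (\<forall>x. \<bar>\<psi> x\<bar> \<le> M) \<and> L2_norm \<Omega> (\<lambda>x. p x - \<psi> x) \<le> C * \<epsilon> powr 1 \<and>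
        (\<Sum>b\<in>Basis. L2_norm \<Omega> (pd b \<psi>)) \<le> C * \<epsilon> powr (1 - 1)" if eps: "0 < \<epsilon>" "\<epsilon> < 1" for \<epsilon>
  proof -
    obtain n where "sobolev_norm \<Omega> s (\<lambda>x. \<phi> n x - p x) < \<epsilon>"
      using order_tendstoD(2)[OF lim eps(1)] by (auto simp: eventually_sequentially)
    then have n: "sobolev_norm \<Omega> 1 (\<lambda>x. \<phi> n x - p x) < \<epsilon>"
      using sobolev_norm_1_le[OF s] order_le_less_trans by blast
    have sm: "smooth (\<phi> n)" using phi[of n] by (rule test_functionsE)
    have L: "h \<in> L2 \<Omega>" if "smooth h" for h
      using continuous_L2[OF dom smooth_continuous_on[OF that]] .
    let ?\<psi> = "\<lambda>x. T (\<phi> n x)"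
    have smT: "smooth ?\<psi>" by (rule smooth_compose[OF T(1) sm])
    have 0: "?\<psi> \<in> test_functions \<Omega>" by (rule test_functions_compose[OF phi T(1) T0])
    have dp: "(\<lambda>x. \<phi> n x - p x) \<in> L2 \<Omega>" by (intro L2_diff L sm pL)
    have "L2_norm \<Omega> (\<lambda>x. p x - ?\<psi> x) \<le> L2_norm \<Omega> (\<lambda>x. M * (\<phi> n x - p x))"
    proof (rule L2_bound(2)[OF _ L2_scale(1)[OF dp]])
      show "(\<lambda>x. p x - ?\<psi> x) \<in> borel_measurable (lebesgue_on \<Omega>)"
        by (rule L2D(1)[OF L2_diff[OF pL L[OF smT]]])
      show "AE x in lebesgue_on \<Omega>. \<bar>p x - ?\<psi> x\<bar> \<le> \<bar>M * (\<phi> n x - p x)\<bar>"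
        using R(1)
      proof eventually_elim
        case (elim x)
        have "\<bar>T (p x) - ?\<psi> x\<bar> \<le> M * \<bar>p x - \<phi> n x\<bar>" by (rule smooth_bounded_deriv_lipschitz[OF T(1,4)])
        then show ?case using T(5)[OF elim] T(2) by (simp add: abs_mult abs_minus_commute)
      qed
    qed
    also have "\<dots> = M * L2_norm \<Omega> (\<lambda>x. \<phi> n x - p x)" using L2_scale(2)[OF dp] T(2) by simp
    also have "\<dots> \<le> C * \<epsilon>"
      using smooth_approx_norms(2)[OF dom sm p1 SOME_Basis] n T(2)
      by (intro mult_mono) (auto simp: C_def L2_norm_nonneg)
    finally have 1: "L2_norm \<Omega> (\<lambda>x. p x - ?\<psi> x) \<le> C * \<epsilon> powr 1" using eps by simp
    have "(\<Sum>b\<in>Basis. L2_norm \<Omega> (pd b ?\<psi>)) \<le> V" unfolding V_def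
    proof (rule sum_mono)
      fix b :: 'a assume b: "b \<in> Basis"
      have "pd b ?\<psi> = (\<lambda>x. pd 1 T (\<phi> n x) * pd b (\<phi> n) x)" by (simp add: pd_compose[OF T(1) sm])
      moreover have "smooth (\<lambda>x. pd 1 T (\<phi> n x))" by (rule smooth_compose[OF smooth_pd[OF T(1)] sm]) simp
      ultimately have "L2_norm \<Omega> (pd b ?\<psi>) \<le> M * L2_norm \<Omega> (pd b (\<phi> n))"
        using L2_times_bounded(2)[OF L[OF smooth_pd[OF sm b]] L2D(1)[OF L]] T(2,4) by simp
      also have "\<dots> \<le> M * (L2_norm \<Omega> (weak_deriv \<Omega> [b] p) + 1)"
        using smooth_approx_norms(1)[OF dom sm p1 b] n eps T(2) by (intro mult_left_mono) auto
      finally show "L2_norm \<Omega> (pd b ?\<psi>) \<le> M * (L2_norm \<Omega> (weak_deriv \<Omega> [b] p) + 1)" .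
    qed
    then have 2: "(\<Sum>b\<in>Basis. L2_norm \<Omega> (pd b ?\<psi>)) \<le> C * \<epsilon> powr (1 - 1)" using eps by (simp add: C_def)
    show ?thesis
    proof (intro bexI[OF _ 0] conjI allI)
      show "\<bar>?\<psi> x\<bar> \<le> M" for x by (rule T(3))
    qed (rule 1, rule 2)
  qed
  have "C \<ge> 0" using T(2) by (simp add: C_def)
  then show ?thesis unfolding approx_rate_def
    by (intro exI[of _ M] exI[of _ C] exI[of _ "1::real"] conjI allI impI main) simp_all
qed

subsection \<open>Boundary layers\<close>

text \<open>Retains what the layer estimates use of a boundary chart: s is a signed height over the
  graph, moving at unit speed along e everywhere, Lipschitz on a ball and deciding membership in
  \<Omega> there. Global continuity of s makes its level regions open, hence measurable.\<close>

definition lip_chart ::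
    "'a::euclidean_space set \<Rightarrow> 'a \<Rightarrow> real \<Rightarrow> real \<Rightarrow> 'a \<Rightarrow> ('a \<Rightarrow> real) \<Rightarrow> bool" where
  "lip_chart \<Omega> x0 \<rho> L e s \<longleftrightarrow> 0 < \<rho> \<and> 1 \<le> L \<and> norm e = 1 \<and> continuous_on UNIV s \<and>
     (\<forall>x t. s (x + t *\<^sub>R e) = s x + t) \<and>
     (\<forall>x\<in>ball x0 \<rho>. \<forall>y\<in>ball x0 \<rho>. \<bar>s x - s y\<bar> \<le> L * norm (x - y)) \<and>
     (\<forall>x\<in>ball x0 \<rho>. x \<in> \<Omega> \<longleftrightarrow> 0 < s x)"

lemma norm_hproj_le: "norm e = 1 \<Longrightarrow> norm (hproj e x) \<le> 2 * norm x"
  using norm_triangle_ineq4[of x "(x \<bullet> e) *\<^sub>R e"] Cauchy_Schwarz_ineq2[of x e]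
  by (simp add: hproj_def)

lemma hproj_diff: "hproj e x - hproj e y = hproj e (x - y)"
  by (simp add: hproj_def algebra_simps inner_diff_left)

text \<open>The height x \<bullet> e - \<gamma>(hproj e x) works: the partial derivatives of
  \<gamma> are continuous, hence bounded on a compact ball that contains the projections of the
  chart ball.\<close>

lemma lip_chart_exists:
  fixes \<Omega> :: "'a::euclidean_space set"
  assumes "C2_chart \<Omega> x0 e r h \<gamma>"
  shows "\<exists>\<rho> L s. lip_chart \<Omega> x0 \<rho> L e s"
proof -
  have e: "norm e = 1" and rh: "r > 0" "h > 0" and g: "C_k 2 \<gamma>"
    and cyl: "\<And>x. x \<in> cylinder x0 e r h \<Longrightarrow> x \<in> \<Omega> \<longleftrightarrow> \<gamma> (hproj e x) < x \<bullet> e"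
    using assms by (auto simp: C2_chart_def)
  have ee: "e \<bullet> e = 1" using e by (simp add: norm_eq_sqrt_inner)
  have g1: "C_k (Suc 0) \<gamma>" using C_k_SucD[of "Suc 0" \<gamma>] g by (simp add: numeral_2_eq_2)
  have g0: "continuous_on UNIV \<gamma>" using C_k_SucD[OF g1] by simp
  define s where "s x = x \<bullet> e - \<gamma> (hproj e x)" for x
  \<comment> \<open>Half of r offsets the factor 2 in \<open>norm_hproj_le\<close>, so that the ball
    lies in the cylinder.\<close>
  define \<rho> where "\<rho> = min (r / 2) h"
  have rho: "0 < \<rho>" "2 * \<rho> \<le> r" "\<rho> \<le> h" using rh by (auto simp: \<rho>_def)
  let ?S = "cball (hproj e x0) (2 * \<rho>)"
  have "\<exists>B. \<forall>b\<in>Basis. \<forall>x\<in>?S. \<bar>pd b \<gamma> x\<bar> \<le> B"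
  proof -
    have "\<exists>B. \<forall>x\<in>?S. \<bar>pd b \<gamma> x\<bar> \<le> B" if "b \<in> Basis" for b
    proof -
      have "compact (pd b \<gamma> ` ?S)"
        using g1 that by (intro compact_continuous_image) (auto intro: continuous_on_subset)
      then obtain B where "\<forall>y\<in>pd b \<gamma> ` ?S. norm y \<le> B"
        using compact_imp_bounded bounded_iff by metis
      then show ?thesis by auto
    qed
    then obtain B where B: "\<And>b x. b \<in> Basis \<Longrightarrow> x \<in> ?S \<Longrightarrow> \<bar>pd b \<gamma> x\<bar> \<le> B b" by metis
    show ?thesis
    proof (intro exI[of _ "Max (B ` Basis)"] ballI)
      fix b x assume "b \<in> (Basis::'a set)" "x \<in> ?S"
      then show "\<bar>pd b \<gamma> x\<bar> \<le> Max (B ` Basis)"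
        by (intro order_trans[OF B] Max_ge) auto
    qed
  qed
  then obtain B where B: "\<And>b x. b \<in> Basis \<Longrightarrow> x \<in> ?S \<Longrightarrow> \<bar>pd b \<gamma> x\<bar> \<le> B" by blast
  have B0: "B \<ge> 0" using B[OF SOME_Basis, of "hproj e x0"] rho by force
  \<comment> \<open>1 for the linear part x \<bullet> e, the rest for \<gamma>; the factor 2 is
    again that of \<open>norm_hproj_le\<close>.\<close>
  define L where "L = 1 + real DIM('a) * B * 2"
  have S: "hproj e x \<in> ?S" if "x \<in> ball x0 \<rho>" for x
    using norm_hproj_le[OF e, of "x0 - x"] that by (auto simp: dist_norm hproj_diff)
  have lip: "\<bar>s x - s y\<bar> \<le> L * norm (x - y)" if "x \<in> ball x0 \<rho>" "y \<in> ball x0 \<rho>" for x y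
  proof -
    have "\<bar>\<gamma> (hproj e x) - \<gamma> (hproj e y)\<bar> \<le> real DIM('a) * B * norm (hproj e x - hproj e y)"
      by (rule lipschitz_from_pd[of ?S]) (use B g1 S that in auto)
    also have "\<dots> \<le> real DIM('a) * B * (2 * norm (x - y))"
      using B0 norm_hproj_le[OF e] by (intro mult_left_mono) (auto simp: hproj_diff)
    moreover have "\<bar>x \<bullet> e - y \<bullet> e\<bar> \<le> norm (x - y)"
      using Cauchy_Schwarz_ineq2[of "x - y" e] e by (simp add: inner_diff_left)
    ultimately show ?thesis by (simp add: s_def L_def algebra_simps)
  qed
  have cont: "continuous_on UNIV s"
  proof -
    have "continuous_on UNIV (\<gamma> \<circ> hproj e)"
      unfolding hproj_def by (intro continuous_on_compose continuous_intros continuous_on_subset[OF g0]) auto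
    then show ?thesis unfolding s_def by (auto simp: comp_def intro!: continuous_intros)
  qed
  have shift: "s (x + t *\<^sub>R e) = s x + t" for x t
    by (simp add: s_def hproj_def inner_add_left ee algebra_simps)
  have dom: "x \<in> \<Omega> \<longleftrightarrow> 0 < s x" if "x \<in> ball x0 \<rho>" for x
  proof -
    have "norm (x - x0) < \<rho>" using that by (simp add: dist_norm norm_minus_commute)
    then have "x \<in> cylinder x0 e r h"
      using norm_hproj_le[OF e, of "x - x0"] Cauchy_Schwarz_ineq2[of "x - x0" e] e rho
      by (auto simp: cylinder_def)
    then show ?thesis using cyl by (simp add: s_def)
  qed
  have "lip_chart \<Omega> x0 \<rho> L e s"
    unfolding lip_chart_def using rho(1) e cont shift lip dom B0 by (auto simp: L_def)
  then show ?thesis by blast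
qed

section \<open>Distance layers and their volume\<close>

definition layer :: "'a::euclidean_space set \<Rightarrow> real \<Rightarrow> 'a set" where
  "layer \<Omega> t = {x \<in> \<Omega>. infdist x (- \<Omega>) < t}"

lemma open_layer: "open \<Omega> \<Longrightarrow> open (layer \<Omega> t)"
proof -
  assume "open \<Omega>"
  moreover have "open {x. infdist x (- \<Omega>) < t}"
    by (intro open_Collect_less continuous_intros)
  moreover have "layer \<Omega> t = \<Omega> \<inter> {x. infdist x (- \<Omega>) < t}" by (auto simp: layer_def)
  ultimately show ?thesis by auto
qed

text \<open>The segment from x to a nearest point of the complement meets the frontier no farther
  away, and frontier points of an open set lie outside it.\<close>

lemma layer_boundary_point:
  assumes "open \<Omega>" "bounded \<Omega>" "x \<in> layer \<Omega> t"
  obtains y where "y \<notin> \<Omega>" "y \<in> frontier \<Omega>" "dist x y < t"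
proof -
  \<comment> \<open>The distance to an empty set is 0 by convention, so an empty complement has to
    be excluded; boundedness does it.\<close>
  have ne: "- \<Omega> \<noteq> {}"
  proof
    assume "- \<Omega> = {}"
    then have "\<Omega> = UNIV" by auto
    then show False using assms(2) by (simp add: not_bounded_UNIV)
  qed
  obtain z where z: "z \<in> - \<Omega>" "infdist x (- \<Omega>) = dist x z"
    using infdist_attains_inf[of "- \<Omega>" x] ne assms(1) by auto
  have "closed_segment x z \<inter> frontier \<Omega> \<noteq> {}"
    using assms(3) z(1) by (intro connected_Int_frontier) (auto simp: layer_def)
  then obtain y where y: "y \<in> closed_segment x z" "y \<in> frontier \<Omega>" by auto
  have "dist x y \<le> dist x z"
    using y(1) segment_bound(1)[of y x z] by (simp add: dist_norm norm_minus_commute)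
  then have "dist x y < t" using z(2) assms(3) by (simp add: layer_def)
  moreover have "y \<notin> \<Omega>" using y(2) assms(1) by (simp add: frontier_def interior_open)
  ultimately show thesis using that y(2) by blast
qed

text \<open>A boundary point within distance t has height at most 0, so the Lipschitz bound limits
  the height of x. The half ball and t \<le> \<rho> / 2 keep that boundary point inside the chart
  ball.\<close>

lemma lip_chart_layer:
  assumes ch: "lip_chart \<Omega> x0 \<rho> L e s" and dom: "open \<Omega>" "bounded \<Omega>"
    and x: "x \<in> ball x0 (\<rho> / 2)" "x \<in> layer \<Omega> t" "t \<le> \<rho> / 2"
  shows "0 < s x" "s x < L * t"
proof -
  have L: "1 \<le> L" and rho: "0 < \<rho>" using ch by (auto simp: lip_chart_def)
  obtain y where y: "y \<notin> \<Omega>" "dist x y < t" using layer_boundary_point[OF dom x(2)] .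
  have b: "x \<in> ball x0 \<rho>" "y \<in> ball x0 \<rho>"
    using x y rho dist_triangle[of x0 y x] by auto
  have "x \<in> \<Omega>" using x(2) by (simp add: layer_def)
  then have "0 < s x" "\<not> 0 < s y" using ch b y(1) unfolding lip_chart_def by blast+
  moreover have "\<bar>s x - s y\<bar> \<le> L * norm (x - y)"
    using ch b unfolding lip_chart_def by blast
  moreover have "L * norm (x - y) < L * t" using y(2) L by (simp add: dist_norm)
  ultimately show "0 < s x" "s x < L * t" by linarith+
qed

text \<open>Quarter balls cover the compact frontier; a layer point within a further quarter radius
  of the frontier then falls into a half ball.\<close>

lemma finite_chart_cover:
  fixes \<Omega> :: "'a::euclidean_space set"
  assumes dom: "open \<Omega>" "bounded \<Omega>" "C2_boundary \<Omega>"
  obtains X t0 \<rho> L e s where "finite X" "0 < t0"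
    "\<And>c. c \<in> X \<Longrightarrow> lip_chart \<Omega> c (\<rho> c) (L c) (e c) (s c)"
    "\<And>t. t \<le> t0 \<Longrightarrow> layer \<Omega> t \<subseteq> (\<Union>c\<in>X. ball c (\<rho> c / 2))"
proof -
  have "\<forall>c\<in>frontier \<Omega>. \<exists>\<rho> L e s. lip_chart \<Omega> c \<rho> L e s"
    using dom(3) lip_chart_exists unfolding C2_boundary_def by blast
  then obtain \<rho> L e s where ch: "\<And>c. c \<in> frontier \<Omega> \<Longrightarrow> lip_chart \<Omega> c (\<rho> c) (L c) (e c) (s c)"
    by metis
  have rho: "0 < \<rho> c" if "c \<in> frontier \<Omega>" for c using ch[OF that] by (simp add: lip_chart_def)
  have "compact (frontier \<Omega>)" using dom(2) by (rule compact_frontier_bounded)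
  then obtain X where X: "X \<subseteq> frontier \<Omega>" "finite X" "frontier \<Omega> \<subseteq> (\<Union>c\<in>X. ball c (\<rho> c / 4))"
    by (rule compactE_image[of "frontier \<Omega>" "frontier \<Omega>" "\<lambda>c. ball c (\<rho> c / 4)"])
       (use rho in \<open>auto intro!: bexI\<close>)
  \<comment> \<open>The inserted 1 keeps the minimum meaningful when the cover is empty.\<close>
  define t0 where "t0 = Min (insert 1 ((\<lambda>c. \<rho> c / 4) ` X))"
  have t0: "0 < t0" using X(1,2) rho by (auto simp: t0_def)
  have t0': "t0 \<le> \<rho> c / 4" if "c \<in> X" for c unfolding t0_def using X(2) that by (intro Min_le) auto
  have "layer \<Omega> t \<subseteq> (\<Union>c\<in>X. ball c (\<rho> c / 2))" if "t \<le> t0" for t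
  proof
    fix x assume "x \<in> layer \<Omega> t"
    then obtain y where y: "y \<in> frontier \<Omega>" "dist x y < t"
      using layer_boundary_point[OF dom(1,2)] by metis
    then obtain c where c: "c \<in> X" "dist c y < \<rho> c / 4" using X(3) by auto
    have "dist c x < \<rho> c / 2"
      using dist_triangle2[of c x y] c y(2) t0'[OF c(1)] that by (simp add: dist_commute)
    then show "x \<in> (\<Union>c\<in>X. ball c (\<rho> c / 2))" using c(1) by auto
  qed
  then show thesis using that[OF X(2) t0, of \<rho> L e s] ch X(1) by blast
qed

text \<open>Vertical translates of the layer by multiples of its height are disjoint.\<close>

lemma lip_chart_layer_measure:
  fixes \<Omega> :: "'a::euclidean_space set"
  assumes ch: "lip_chart \<Omega> x0 \<rho> L e s" and t: "0 < t" "t \<le> 1 / 2"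
  shows "emeasure lborel {x \<in> ball x0 (\<rho> / 2). 0 < s x \<and> s x < L * t}
    \<le> ennreal (2 * t * measure lborel (ball x0 (\<rho> / 2 + L)))"
proof -
  have L: "1 \<le> L" and rho: "0 < \<rho>" and e: "norm e = 1" and cont: "continuous_on UNIV s"
    and shift: "\<And>x t. s (x + t *\<^sub>R e) = s x + t"
    using ch by (auto simp: lip_chart_def)
  define X where "X = {x \<in> ball x0 (\<rho> / 2). 0 < s x \<and> s x < L * t}"
  have "X = ball x0 (\<rho> / 2) \<inter> {x. 0 < s x} \<inter> {x. s x < L * t}" by (auto simp: X_def)
  moreover have "open {x. 0 < s x}" "open {x. s x < L * t}"
    by (intro open_Collect_less continuous_intros cont)+
  ultimately have "open X" by auto
  define A where "A k = (\<lambda>x. - ((real k * (L * t)) *\<^sub>R e) + x) -` X" for k :: nat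
  have A_open: "open (A k)" for k
    unfolding A_def by (intro open_vimage \<open>open X\<close> continuous_intros)
  have A: "emeasure lborel (A k) = emeasure lborel X" for k
  proof -
    have "emeasure lborel X = emeasure (distr lborel borel ((+) (- ((real k * (L * t)) *\<^sub>R e)))) X"
      by (simp add: lborel_distr_plus)
    also have "\<dots> = emeasure lborel ((+) (- ((real k * (L * t)) *\<^sub>R e)) -` X)"
      using \<open>open X\<close> by (subst emeasure_distr) auto
    also have "(+) (- ((real k * (L * t)) *\<^sub>R e)) -` X = A k" by (auto simp: A_def)
    finally show ?thesis by simp
  qed
  have sA: "real k * (L * t) < s x \<and> s x < real (Suc k) * (L * t)" if "x \<in> A k" for x k
    using that shift[of x "- (real k * (L * t))"] by (auto simp: A_def X_def algebra_simps)
  \<comment> \<open>With N translates the total displacement N L t is at most L, so all stay in one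
    ball of radius \<rho> / 2 + L. As t \<le> 1/2, rounding down loses at most half: N \<ge> 1 / (2
    t), whence the factor 2 t.\<close>
  define N where "N = nat \<lfloor>1 / t\<rfloor>"
  have N1: "real N \<le> 1 / t" using t by (simp add: N_def)
  have "1 / t - 1 < real N" unfolding N_def using t by linarith
  moreover have "1 / (2 * t) \<le> 1 / t - 1" using t by (simp add: field_simps)
  ultimately have N2: "1 / (2 * t) \<le> real N" by linarith
  have disj: "disjoint_family_on A {..<N}"
    unfolding disjoint_family_on_def
  proof (intro ballI impI)
    fix j k :: nat assume "j \<noteq> k"
    have "False" if jk: "j < k" and "x \<in> A j" "x \<in> A k" for j k x
    proof -
      have "real (Suc j) * (L * t) \<le> real k * (L * t)" using jk L t by (intro mult_right_mono) auto
      then show False using sA[of x j] sA[of x k] that by linarith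
    qed
    then show "A j \<inter> A k = {}" using \<open>j \<noteq> k\<close> by (metis disjoint_iff linorder_neq_iff)
  qed
  have sub: "(\<Union>k<N. A k) \<subseteq> ball x0 (\<rho> / 2 + L)"
  proof
    fix x assume "x \<in> (\<Union>k<N. A k)"
    then obtain k where k: "k < N" "x \<in> A k" by auto
    have "real k * (L * t) \<le> real N * (L * t)" using k(1) L t by (intro mult_right_mono) auto
    also have "\<dots> \<le> 1 / t * (L * t)" using N1 L t by (intro mult_right_mono) auto
    finally have "real k * (L * t) \<le> L" using t by simp
    moreover have "norm (x0 - (- ((real k * (L * t)) *\<^sub>R e) + x)) < \<rho> / 2"
      using k(2) by (simp add: A_def X_def dist_norm)
    moreover have "norm (x0 - x) \<le> norm (x0 - (- ((real k * (L * t)) *\<^sub>R e) + x)) + norm ((real k * (L * t)) *\<^sub>R e)"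
      using norm_triangle_ineq[of "x0 - (- ((real k * (L * t)) *\<^sub>R e) + x)" "- (real k * (L * t)) *\<^sub>R e"] by simp
    moreover have "norm ((real k * (L * t)) *\<^sub>R e) = real k * (L * t)" using e L t by simp
    ultimately show "x \<in> ball x0 (\<rho> / 2 + L)" by (simp add: dist_norm)
  qed
  have "ennreal (real N) * emeasure lborel X = (\<Sum>k<N. emeasure lborel (A k))"
    by (simp add: A ennreal_of_nat_eq_real_of_nat)
  also have "\<dots> = emeasure lborel (\<Union>k<N. A k)"
    using A_open by (intro sum_emeasure disj) (auto intro: borel_open)
  also have "\<dots> \<le> emeasure lborel (ball x0 (\<rho> / 2 + L))" by (intro emeasure_mono sub) auto
  also have "\<dots> = ennreal (measure lborel (ball x0 (\<rho> / 2 + L)))"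
    by (intro emeasure_eq_ennreal_measure) (use emeasure_bounded_finite[of "ball x0 (\<rho> / 2 + L)"] in auto)
  finally have le: "ennreal (real N) * emeasure lborel X \<le> ennreal (measure lborel (ball x0 (\<rho> / 2 + L)))" .
  have "emeasure lborel X = ennreal (2 * t * (1 / (2 * t))) * emeasure lborel X" using t by simp
  also have "\<dots> \<le> ennreal (2 * t * real N) * emeasure lborel X"
    using N2 t by (intro mult_right_mono ennreal_leI mult_left_mono) auto
  also have "\<dots> = ennreal (2 * t) * (ennreal (real N) * emeasure lborel X)"
    using t by (subst ennreal_mult) (auto simp: mult.assoc)
  also have "\<dots> \<le> ennreal (2 * t) * ennreal (measure lborel (ball x0 (\<rho> / 2 + L)))"
    using le by (rule mult_left_mono) simp
  also have "\<dots> = ennreal (2 * t * measure lborel (ball x0 (\<rho> / 2 + L)))"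
    using t by (intro ennreal_mult[symmetric]) auto
  finally show ?thesis unfolding X_def .
qed

lemma layer_measure:
  fixes \<Omega> :: "'a::euclidean_space set"
  assumes dom: "open \<Omega>" "bounded \<Omega>" "C2_boundary \<Omega>"
  obtains C t0 where "0 \<le> C" "0 < t0" "\<And>t. 0 < t \<Longrightarrow> t < t0 \<Longrightarrow> emeasure lborel (layer \<Omega> t) \<le> ennreal (C * t)"
proof -
  obtain X t0 \<rho> L e s where X: "finite X" "0 < t0"
    "\<And>c. c \<in> X \<Longrightarrow> lip_chart \<Omega> c (\<rho> c) (L c) (e c) (s c)"
    "\<And>t. t \<le> t0 \<Longrightarrow> layer \<Omega> t \<subseteq> (\<Union>c\<in>X. ball c (\<rho> c / 2))"
    by (rule finite_chart_cover[OF dom]) (rule that)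
  define V where "V c = 2 * measure lborel (ball c (\<rho> c / 2 + L c))" for c
  \<comment> \<open>1/2 is required by the translation argument, \<rho> c / 2 by
    \<open>lip_chart_layer\<close>.\<close>
  define t1 where "t1 = Min (insert t0 (insert (1/2) ((\<lambda>c. \<rho> c / 2) ` X)))"
  have rho: "0 < \<rho> c" if "c \<in> X" for c using X(3)[OF that] by (simp add: lip_chart_def)
  have t1_le: "t1 \<le> y" if "y \<in> insert t0 (insert (1/2) ((\<lambda>c. \<rho> c / 2) ` X))" for y
    unfolding t1_def using X(1) that by (intro Min_le) auto
  have t1: "0 < t1" using X(1,2) rho by (auto simp: t1_def)
  have t1': "t1 \<le> t0" "t1 \<le> 1 / 2" "\<And>c. c \<in> X \<Longrightarrow> t1 \<le> \<rho> c / 2" by (rule t1_le; simp)+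
  have "emeasure lborel (layer \<Omega> t) \<le> ennreal ((\<Sum>c\<in>X. V c) * t)" if t: "0 < t" "t < t1" for t
  proof -
    let ?Y = "\<lambda>c. {x \<in> ball c (\<rho> c / 2). 0 < s c x \<and> s c x < L c * t}"
    have Ym: "?Y c \<in> sets lborel" if "c \<in> X" for c
    proof -
      have "continuous_on UNIV (s c)" using X(3)[OF that] by (simp add: lip_chart_def)
      then have "open {x. 0 < s c x}" "open {x. s c x < L c * t}"
        by (intro open_Collect_less continuous_intros; assumption)+
      moreover have "?Y c = ball c (\<rho> c / 2) \<inter> {x. 0 < s c x} \<inter> {x. s c x < L c * t}" by auto
      ultimately have "open (?Y c)" by auto
      then show ?thesis by simp
    qed
    have "layer \<Omega> t \<subseteq> (\<Union>c\<in>X. ?Y c)"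
    proof
      fix x assume x: "x \<in> layer \<Omega> t"
      then obtain c where c: "c \<in> X" "x \<in> ball c (\<rho> c / 2)" using X(4)[of t] t t1'(1) by auto
      then have "0 < s c x" "s c x < L c * t"
        using lip_chart_layer[OF X(3)[OF c(1)] dom(1,2) c(2) x] t t1'(3)[OF c(1)] by auto
      then show "x \<in> (\<Union>c\<in>X. ?Y c)" using c by auto
    qed
    then have "emeasure lborel (layer \<Omega> t) \<le> emeasure lborel (\<Union>c\<in>X. ?Y c)"
      using Ym X(1) by (intro emeasure_mono) (auto intro!: sets.finite_UN)
    also have "\<dots> \<le> (\<Sum>c\<in>X. emeasure lborel (?Y c))"
      using X(1) Ym by (intro emeasure_subadditive_finite) auto
    also have "\<dots> \<le> (\<Sum>c\<in>X. ennreal (V c * t))"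
      using lip_chart_layer_measure[OF X(3)] t t1'(2) by (intro sum_mono) (auto simp: V_def mult_ac)
    also have "\<dots> = ennreal ((\<Sum>c\<in>X. V c) * t)"
      using t by (simp add: V_def sum_distrib_right)
    finally show ?thesis .
  qed
  moreover have "0 \<le> (\<Sum>c\<in>X. V c)" by (auto simp: V_def intro!: sum_nonneg)
  ultimately show thesis using that t1 by blast
qed

subsection \<open>A Hardy-type inequality\<close>

text \<open>Kept as an extended nonnegative integral, so that Tonelli and the layer iteration apply
  without finiteness conditions.\<close>

definition layer_energy :: "'a::euclidean_space set \<Rightarrow> ('a \<Rightarrow> real) \<Rightarrow> real \<Rightarrow> ennreal" where
  "layer_energy \<Omega> \<phi> t = (\<integral>\<^sup>+x. ennreal ((\<phi> x)\<^sup>2) * indicator (layer \<Omega> t) x \<partial>lborel)"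

lemma nn_integral_lebesgue_on:
  "S \<in> sets lebesgue \<Longrightarrow> (\<integral>\<^sup>+x. f x \<partial>lebesgue_on S) = (\<integral>\<^sup>+x. f x * indicator S x \<partial>lborel)"
  by (simp add: nn_integral_restrict_space nn_integral_completion)

lemma slobodeckij_sq_lborel:
  fixes \<phi> :: "'a::euclidean_space \<Rightarrow> real"
  assumes "open \<Omega>"
  shows "slobodeckij_sq \<Omega> \<kappa> \<phi> = (\<integral>\<^sup>+x. (\<integral>\<^sup>+y. ennreal ((\<phi> x - \<phi> y)\<^sup>2 / norm (x - y) powr (real DIM('a) + 2 * \<kappa>))
      * indicator \<Omega> y \<partial>lborel) * indicator \<Omega> x \<partial>lborel)"
  using assms by (simp add: slobodeckij_sq_def nn_integral_lebesgue_on)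

text \<open>Trades the singular weight of the seminorm for a power of the distance scale; the powers
  of t and of \<epsilon> with exponent 2 \<kappa> in the later bounds originate here. On the
  diagonal both sides are 0.\<close>

lemma difference_sq_le_kernel:
  fixes \<phi> :: "'a::euclidean_space \<Rightarrow> real"
  assumes "norm (x - y) \<le> R" "0 < \<kappa>" "0 < R"
  shows "(\<phi> x - \<phi> y)\<^sup>2 \<le> R powr (real DIM('a) + 2 * \<kappa>) * ((\<phi> x - \<phi> y)\<^sup>2 / norm (x - y) powr (real DIM('a) + 2 * \<kappa>))"
proof (cases "x = y")
  case False
  then have pos: "norm (x - y) powr (real DIM('a) + 2 * \<kappa>) > 0" by simp
  have "norm (x - y) powr (real DIM('a) + 2 * \<kappa>) \<le> R powr (real DIM('a) + 2 * \<kappa>)"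
    using assms by (intro powr_mono2) auto
  then have "(\<phi> x - \<phi> y)\<^sup>2 * norm (x - y) powr (real DIM('a) + 2 * \<kappa>) \<le> (\<phi> x - \<phi> y)\<^sup>2 * R powr (real DIM('a) + 2 * \<kappa>)"
    by (rule mult_left_mono) simp
  then show ?thesis using pos by (simp add: field_simps)
qed simp

text \<open>A lies in a tube of radius r around a segment of length 2 T through y. Balls of radius 2
  r centred on the axis at integer multiples of r cover it; at most 2 T / r + 3 are used, and 2^DIM
  is the volume ratio of the balls.\<close>

lemma column_measure:
  fixes y e :: "'a::euclidean_space"
  assumes e: "norm e = 1" and r: "0 < r" and T: "0 \<le> T"
    and A: "A \<in> sets lborel" "\<And>x. x \<in> A \<Longrightarrow> \<exists>\<theta>. \<bar>\<theta>\<bar> \<le> T \<and> dist (x - \<theta> *\<^sub>R e) y < r"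
  shows "emeasure lborel A \<le> ennreal ((2 * T / r + 3) * 2 ^ DIM('a)) * emeasure lborel (ball (0::'a) r)"
proof -
  define m where "m = \<lceil>T / r\<rceil>"
  have "0 \<le> T / r" using T r by simp
  then have m: "0 \<le> m" "real_of_int m \<le> T / r + 1" unfolding m_def by linarith+
  have "A \<subseteq> (\<Union>k\<in>{-m..m}. ball (y + (real_of_int k * r) *\<^sub>R e) (2 * r))"
  proof
    fix x assume "x \<in> A"
    then obtain \<theta> where th: "\<bar>\<theta>\<bar> \<le> T" "dist (x - \<theta> *\<^sub>R e) y < r" using A(2) by blast
    define k where "k = \<lfloor>\<theta> / r\<rfloor>"
    have "\<bar>\<theta> / r\<bar> \<le> T / r" using th(1) r by (simp add: abs_divide divide_right_mono)
    then have "- real_of_int m \<le> \<theta> / r" "\<theta> / r \<le> real_of_int m" unfolding m_def by linarith+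
    then have k: "k \<in> {-m..m}" by (auto simp: k_def le_floor_iff floor_le_iff)
    have k2: "real_of_int k \<le> \<theta> / r" "\<theta> / r < real_of_int k + 1" by (auto simp: k_def)
    have "real_of_int k * r \<le> \<theta>" "\<theta> < real_of_int k * r + r"
      using k2 r by (auto simp: field_simps)
    then have "norm ((\<theta> - real_of_int k * r) *\<^sub>R e) \<le> r" using e by simp
    moreover have "norm (x - \<theta> *\<^sub>R e - y) < r" using th(2) by (simp add: dist_norm)
    moreover have "norm (x - (y + (real_of_int k * r) *\<^sub>R e)) \<le> norm (x - \<theta> *\<^sub>R e - y) + norm ((\<theta> - real_of_int k * r) *\<^sub>R e)"
      using norm_triangle_ineq[of "x - \<theta> *\<^sub>R e - y" "(\<theta> - real_of_int k * r) *\<^sub>R e"] by (simp add: algebra_simps)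
    ultimately have "x \<in> ball (y + (real_of_int k * r) *\<^sub>R e) (2 * r)" by (simp add: dist_norm norm_minus_commute)
    then show "x \<in> (\<Union>k\<in>{-m..m}. ball (y + (real_of_int k * r) *\<^sub>R e) (2 * r))" using k by blast
  qed
  then have "emeasure lborel A \<le> emeasure lborel (\<Union>k\<in>{-m..m}. ball (y + (real_of_int k * r) *\<^sub>R e) (2 * r))"
    by (intro emeasure_mono) auto
  also have "\<dots> \<le> (\<Sum>k\<in>{-m..m}. emeasure lborel (ball (y + (real_of_int k * r) *\<^sub>R e) (2 * r)))"
    by (intro emeasure_subadditive_finite) auto
  also have "\<dots> = (\<Sum>k\<in>{-m..m}. ennreal (2 ^ DIM('a)) * emeasure lborel (ball (0::'a) r))"
    using r by (intro sum.cong refl) (simp add: emeasure_ball power_mult_distrib mult_ac flip: ennreal_mult')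
  also have "\<dots> = ennreal (real (nat (2 * m + 1))) * (ennreal (2 ^ DIM('a)) * emeasure lborel (ball (0::'a) r))"
    using m(1) by (simp add: ennreal_of_nat_eq_real_of_nat)
  also have "\<dots> \<le> ennreal (2 * T / r + 3) * (ennreal (2 ^ DIM('a)) * emeasure lborel (ball (0::'a) r))"
    using m by (intro mult_right_mono ennreal_leI) auto
  also have "\<dots> = ennreal ((2 * T / r + 3) * 2 ^ DIM('a)) * emeasure lborel (ball (0::'a) r)"
    using T r by (subst ennreal_mult) (auto simp: mult.assoc)
  finally show ?thesis .
qed

text \<open>A point \<open>x\<close> of the layer of height \<open>t\<close> is compared with the points of a ball of radius \<open>~ t / l\<close> in the
  layer of height \<open>t / l\<close> below or above it. Each point of the thin layer is hit by a column of points \<open>x\<close> of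
  length \<open>~ t\<close>, which costs a factor \<open>~ l\<close> with a constant independent of \<open>l\<close>.\<close>

lemma lip_chart_hardy:
  fixes \<Omega> :: "'a::euclidean_space set"
  assumes ch: "lip_chart \<Omega> x0 \<rho> L e s" and dom: "open \<Omega>" and phi: "continuous_on UNIV \<phi>"
    and l: "1 \<le> l" and t: "0 < t" "L * t \<le> \<rho> / 8" and kappa: "0 < \<kappa>"
  defines "X \<equiv> {x \<in> ball x0 (\<rho> / 2). 0 < s x \<and> s x < L * t}"
  shows "(\<integral>\<^sup>+x. ennreal ((\<phi> x)\<^sup>2) * indicator X x \<partial>lborel)
    \<le> ennreal (22 * L\<^sup>2 * 2 ^ DIM('a) * l) * layer_energy \<Omega> \<phi> (t / l)
      + ennreal (2 * (2 * L) powr (real DIM('a) + 2 * \<kappa>) * (4 * l * L) ^ DIM('a) / unit_ball_vol (real DIM('a)) * t powr (2 * \<kappa>))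
        * slobodeckij_sq \<Omega> \<kappa> \<phi>"
proof -
  have L: "1 \<le> L" and rho: "0 < \<rho>" and e: "norm e = 1" and cont: "continuous_on UNIV s"
    and shift: "\<And>x t. s (x + t *\<^sub>R e) = s x + t"
    and lip: "\<And>x y. x \<in> ball x0 \<rho> \<Longrightarrow> y \<in> ball x0 \<rho> \<Longrightarrow> \<bar>s x - s y\<bar> \<le> L * norm (x - y)"
    and inO: "\<And>x. x \<in> ball x0 \<rho> \<Longrightarrow> x \<in> \<Omega> \<longleftrightarrow> 0 < s x"
    using ch by (auto simp: lip_chart_def)
  \<comment> \<open>\<tau> is the middle height of the thin layer, since t / l = 2 \<tau>. The
    radius r is chosen so that L r = \<tau> / 2: heights on a ball of radius r around a point of
    height \<tau> stay between \<tau> / 2 and 3 \<tau> / 2.\<close>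
  define \<tau> where "\<tau> = t / (2 * l)"
  define r where "r = t / (4 * l * L)"
  have tau: "0 < \<tau>" "\<tau> \<le> t / 2" using t l by (auto simp: \<tau>_def field_simps)
  have r: "0 < r" "L * r = \<tau> / 2" using t l L by (auto simp: r_def \<tau>_def)
  have tL: "t \<le> L * t" using L t by simp
  have "1 * r \<le> L * r" using r(1) L by (intro mult_right_mono) auto
  then have rtau: "r \<le> \<tau> / 2" using r(2) by linarith
  \<comment> \<open>Vertical displacement of x onto the level of height \<tau>.\<close>
  define z where "z x = x - (s x - \<tau>) *\<^sub>R e" for x
  have sm: "s \<in> borel_measurable borel" by (rule borel_measurable_continuous_onI[OF cont])
  have pm: "\<phi> \<in> borel_measurable borel" by (rule borel_measurable_continuous_onI[OF phi])
  have zm: "z \<in> borel_measurable borel" unfolding z_def using sm by measurable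
  have "X = ball x0 (\<rho> / 2) \<inter> {x. 0 < s x} \<inter> {x. s x < L * t}" by (auto simp: X_def)
  moreover have "open {x. 0 < s x}" "open {x. s x < L * t}"
    by (intro open_Collect_less continuous_intros cont)+
  ultimately have "open X" by auto
  then have Xm: "X \<in> sets borel" by simp
  have Om: "\<Omega> \<in> sets borel" using dom by simp
  have sz: "s (z x) = \<tau>" for x
  proof -
    have "z x = x + (- (s x - \<tau>)) *\<^sub>R e" by (simp add: z_def algebra_simps)
    then show ?thesis by (simp add: shift)
  qed
  have geo: "x \<in> \<Omega>" "y \<in> layer \<Omega> (t / l)" "norm (x - y) \<le> 2 * L * t"
    if x: "x \<in> X" and y: "dist (z x) y < r" for x y
  proof -
    have sx: "0 < s x" "s x < L * t" and dx: "dist x0 x < \<rho> / 2" using x by (auto simp: X_def)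
    have "x \<in> ball x0 \<rho>" using dx rho by simp
    then show "x \<in> \<Omega>" using inO sx(1) by blast
    have "dist x (z x) = \<bar>s x - \<tau>\<bar>" using e by (simp add: z_def dist_norm)
    then have dz: "dist x (z x) \<le> L * t" using sx tau tL t by linarith
    have bz: "z x \<in> ball x0 \<rho>" using dist_triangle[of x0 "z x" x] dx dz t(2) rho by simp
    have dy: "dist x y \<le> L * t + r" using dist_triangle[of x y "z x"] dz y by linarith
    then have "norm (x - y) \<le> L * t + L * t" using rtau tau tL unfolding dist_norm by linarith
    then show "norm (x - y) \<le> 2 * L * t" by simp
    have dy0: "dist x0 y < \<rho> / 2 + \<rho> / 8 + \<rho> / 16"
      using dist_triangle[of x0 y x] dx dy t(2) rtau tau tL by linarith
    have yb: "y \<in> ball x0 \<rho>" using dy0 rho by simp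
    have "L * norm (z x - y) < L * r" using y L by (simp add: dist_norm)
    then have "\<bar>\<tau> - s y\<bar> < \<tau> / 2" using lip[OF bz yb] sz[of x] r(2) by simp
    then have sy: "\<tau> / 2 < s y" "s y < 3 / 2 * \<tau>" by linarith+
    have yO: "y \<in> \<Omega>" using inO[OF yb] sy(1) tau(1) by simp
    \<comment> \<open>The foot of y on the graph lies outside \<Omega> at distance
      \<open>s y\<close>; it witnesses that y belongs to the thin layer.\<close>
    define v where "v = y - s y *\<^sub>R e"
    have dv: "dist y v = s y" using sy tau e by (simp add: v_def dist_norm)
    have "dist x0 v < \<rho>"
      using dist_triangle[of x0 v y] dy0 dv sy tau tL t(2) rho by linarith
    then have "v \<in> ball x0 \<rho>" by simp
    moreover have "s v = 0" using shift[of y "- s y"] by (simp add: v_def scaleR_minus_left)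
    ultimately have "v \<in> - \<Omega>" using inO by auto
    then have "infdist y (- \<Omega>) \<le> s y" using infdist_le dv by metis
    also have "\<dots> < t / l" using sy(2) t l by (simp add: \<tau>_def field_simps)
    finally show "y \<in> layer \<Omega> (t / l)" using yO by (simp add: layer_def)
  qed
  \<comment> \<open>The pairing of x with its comparison points y. Integrating over y gives the ball
    volume m for each x in X, integrating over x gives the volume of a column for each y.\<close>
  define W where "W x y = (if x \<in> X \<and> dist (z x) y < r then 1 else 0 :: ennreal)" for x y
  have Wm: "(\<lambda>(x, y). W x y) \<in> borel_measurable (borel \<Otimes>\<^sub>M borel)"
    unfolding W_def using Xm zm by measurable
  have Wm1: "W x \<in> borel_measurable borel" for x unfolding W_def by measurable
  have Wm2: "(\<lambda>x. W x y) \<in> borel_measurable borel" for y unfolding W_def using Xm zm by measurable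
  define m where "m = emeasure lborel (ball (0::'a) r)"
  have m: "m = ennreal (unit_ball_vol (real DIM('a)) * r ^ DIM('a))" unfolding m_def using r by (intro emeasure_ball) auto
  have mpos: "unit_ball_vol (real DIM('a)) * r ^ DIM('a) > 0" using r by (simp add: unit_ball_vol_pos)
  have Wy: "(\<integral>\<^sup>+y. W x y \<partial>lborel) = m * indicator X x" for x
  proof (cases "x \<in> X")
    case True
    then have "(\<integral>\<^sup>+y. W x y \<partial>lborel) = (\<integral>\<^sup>+y. indicator (ball (z x) r) y \<partial>lborel)"
      by (intro nn_integral_cong) (auto simp: W_def indicator_def)
    also have "\<dots> = m" using r by (simp add: m emeasure_ball)
    finally show ?thesis using True by simp
  qed (simp add: W_def)
  let ?k = "\<lambda>x y. ennreal ((\<phi> x - \<phi> y)\<^sup>2 / norm (x - y) powr (real DIM('a) + 2 * \<kappa>)) * indicator \<Omega> y"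
  let ?P = "ennreal (2 * (2 * L * t) powr (real DIM('a) + 2 * \<kappa>))"
  have point: "ennreal ((\<phi> x)\<^sup>2) * W x y \<le> 2 * (ennreal ((\<phi> y)\<^sup>2) * W x y) + ?P * (?k x y * indicator \<Omega> x)" for x y
  proof (cases "x \<in> X \<and> dist (z x) y < r")
    case True
    note g = geo[OF conjunct1[OF True] conjunct2[OF True]]
    have "y \<in> \<Omega>" using g(2) by (simp add: layer_def)
    have "0 \<le> (\<phi> x - 2 * \<phi> y)\<^sup>2" by simp
    then have "(\<phi> x)\<^sup>2 \<le> 2 * (\<phi> y)\<^sup>2 + 2 * (\<phi> x - \<phi> y)\<^sup>2" by (simp add: power2_eq_square algebra_simps)
    also have "(\<phi> x - \<phi> y)\<^sup>2 \<le> (2 * L * t) powr (real DIM('a) + 2 * \<kappa>) * ((\<phi> x - \<phi> y)\<^sup>2 / norm (x - y) powr (real DIM('a) + 2 * \<kappa>))"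
      using g(3) kappa L t by (intro difference_sq_le_kernel) auto
    finally have "(\<phi> x)\<^sup>2 \<le> 2 * (\<phi> y)\<^sup>2 + (2 * (2 * L * t) powr (real DIM('a) + 2 * \<kappa>)) * ((\<phi> x - \<phi> y)\<^sup>2 / norm (x - y) powr (real DIM('a) + 2 * \<kappa>))"
      by simp
    then have "ennreal ((\<phi> x)\<^sup>2) \<le> ennreal (2 * (\<phi> y)\<^sup>2 + (2 * (2 * L * t) powr (real DIM('a) + 2 * \<kappa>)) * ((\<phi> x - \<phi> y)\<^sup>2 / norm (x - y) powr (real DIM('a) + 2 * \<kappa>)))"
      by (rule ennreal_leI)
    also have "\<dots> = ennreal (2 * (\<phi> y)\<^sup>2) + ennreal ((2 * (2 * L * t) powr (real DIM('a) + 2 * \<kappa>)) * ((\<phi> x - \<phi> y)\<^sup>2 / norm (x - y) powr (real DIM('a) + 2 * \<kappa>)))"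
      by (rule ennreal_plus) auto
    also have "ennreal (2 * (\<phi> y)\<^sup>2) = 2 * ennreal ((\<phi> y)\<^sup>2)" by (simp add: ennreal_mult)
    also have "ennreal ((2 * (2 * L * t) powr (real DIM('a) + 2 * \<kappa>)) * ((\<phi> x - \<phi> y)\<^sup>2 / norm (x - y) powr (real DIM('a) + 2 * \<kappa>)))
        = ?P * ennreal ((\<phi> x - \<phi> y)\<^sup>2 / norm (x - y) powr (real DIM('a) + 2 * \<kappa>))" by (rule ennreal_mult) auto
    finally show ?thesis using True g(1) \<open>y \<in> \<Omega>\<close> by (simp add: W_def)
  next
    case False
    then have "W x y = 0" by (auto simp: W_def)
    then show ?thesis by simp
  qed
  have km: "(\<lambda>(x, y). ?k x y) \<in> borel_measurable (borel \<Otimes>\<^sub>M borel)" using pm Om by measurable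
  have km1: "?k x \<in> borel_measurable borel" for x using pm Om by measurable
  have pW: "(\<lambda>(x, y). ennreal ((\<phi> y)\<^sup>2) * W x y) \<in> borel_measurable (borel \<Otimes>\<^sub>M borel)"
    using Wm pm by measurable
  have col: "(\<integral>\<^sup>+x. ennreal ((\<phi> y)\<^sup>2) * W x y \<partial>lborel)
      \<le> ennreal (11 * L\<^sup>2 * 2 ^ DIM('a) * l) * m * (ennreal ((\<phi> y)\<^sup>2) * indicator (layer \<Omega> (t / l)) y)" for y
  proof (cases "y \<in> layer \<Omega> (t / l)")
    case True
    let ?A = "{x \<in> X. dist (z x) y < r}"
    have Am: "?A \<in> sets lborel" using Xm zm by measurable
    have "emeasure lborel ?A \<le> ennreal ((2 * (L * t) / r + 3) * 2 ^ DIM('a)) * m"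
      unfolding m_def
    proof (rule column_measure[OF e r(1) _ Am])
      fix x assume x: "x \<in> ?A"
      then have "0 < s x" "s x < L * t" by (auto simp: X_def)
      then have "\<bar>s x - \<tau>\<bar> \<le> L * t" using tau tL t(1) by linarith
      then show "\<exists>\<theta>. \<bar>\<theta>\<bar> \<le> L * t \<and> dist (x - \<theta> *\<^sub>R e) y < r" using x by (auto simp: z_def)
    qed (use L t in simp)
    also have "\<dots> \<le> ennreal (11 * L\<^sup>2 * 2 ^ DIM('a) * l) * m"
    proof -
      \<comment> \<open>The number of balls covering the column grows only linearly in l; this
        linear cost is what the iteration can compensate for \<kappa> > 1/2.\<close>
      have "2 * (L * t) / r = 8 * (L\<^sup>2 * l)" using t l L by (simp add: r_def power2_eq_square)
      moreover have "1 * 1 \<le> L\<^sup>2 * l" using L l by (intro mult_mono) auto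
      ultimately have "(2 * (L * t) / r + 3) \<le> 11 * (L\<^sup>2 * l)" by linarith
      then have "(2 * (L * t) / r + 3) * 2 ^ DIM('a) \<le> 11 * (L\<^sup>2 * l) * 2 ^ DIM('a)" by (rule mult_right_mono) simp
      also have "\<dots> = 11 * L\<^sup>2 * 2 ^ DIM('a) * l" by (simp add: mult_ac)
      finally show ?thesis by (intro mult_right_mono ennreal_leI) auto
    qed
    finally have A: "emeasure lborel ?A \<le> ennreal (11 * L\<^sup>2 * 2 ^ DIM('a) * l) * m" .
    have "(\<integral>\<^sup>+x. ennreal ((\<phi> y)\<^sup>2) * W x y \<partial>lborel) = (\<integral>\<^sup>+x. ennreal ((\<phi> y)\<^sup>2) * indicator ?A x \<partial>lborel)"
      by (intro nn_integral_cong) (auto simp: W_def indicator_def)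
    also have "\<dots> = ennreal ((\<phi> y)\<^sup>2) * emeasure lborel ?A"
      using Am by (rule nn_integral_cmult_indicator)
    also have "\<dots> \<le> ennreal ((\<phi> y)\<^sup>2) * (ennreal (11 * L\<^sup>2 * 2 ^ DIM('a) * l) * m)"
      using A by (rule mult_left_mono) simp
    finally show ?thesis using True by (simp add: mult_ac)
  next
    case False
    then have "W x y = 0" for x using geo(2)[of x y] by (auto simp: W_def)
    then show ?thesis by simp
  qed
  have lm: "(\<lambda>y. ennreal ((\<phi> y)\<^sup>2) * indicator (layer \<Omega> (t / l)) y) \<in> borel_measurable borel"
  proof -
    have "layer \<Omega> (t / l) \<in> sets borel" using open_layer[OF dom] by simp
    then show ?thesis using pm by measurable
  qed
  have "m * (\<integral>\<^sup>+x. ennreal ((\<phi> x)\<^sup>2) * indicator X x \<partial>lborel) = (\<integral>\<^sup>+x. m * (ennreal ((\<phi> x)\<^sup>2) * indicator X x) \<partial>lborel)"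
    using pm Xm by (intro nn_integral_cmult[symmetric]) auto
  also have "\<dots> = (\<integral>\<^sup>+x. ennreal ((\<phi> x)\<^sup>2) * (\<integral>\<^sup>+y. W x y \<partial>lborel) \<partial>lborel)" by (simp add: Wy mult_ac)
  also have "\<dots> = (\<integral>\<^sup>+x. (\<integral>\<^sup>+y. ennreal ((\<phi> x)\<^sup>2) * W x y \<partial>lborel) \<partial>lborel)"
    using Wm1 by (simp add: nn_integral_cmult)
  also have "\<dots> \<le> (\<integral>\<^sup>+x. (\<integral>\<^sup>+y. 2 * (ennreal ((\<phi> y)\<^sup>2) * W x y) + ?P * (?k x y * indicator \<Omega> x) \<partial>lborel) \<partial>lborel)"
    by (intro nn_integral_mono point)
  also have "\<dots> = (\<integral>\<^sup>+x. 2 * (\<integral>\<^sup>+y. ennreal ((\<phi> y)\<^sup>2) * W x y \<partial>lborel) + ?P * ((\<integral>\<^sup>+y. ?k x y \<partial>lborel) * indicator \<Omega> x) \<partial>lborel)"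
  proof (intro nn_integral_cong)
    fix x :: 'a
    have m1: "(\<lambda>y. ennreal ((\<phi> y)\<^sup>2) * W x y) \<in> borel_measurable lborel" using pm Wm1[of x] by measurable
    have m2: "?k x \<in> borel_measurable lborel" using km1[of x] by simp
    show "(\<integral>\<^sup>+y. 2 * (ennreal ((\<phi> y)\<^sup>2) * W x y) + ?P * (?k x y * indicator \<Omega> x) \<partial>lborel)
      = 2 * (\<integral>\<^sup>+y. ennreal ((\<phi> y)\<^sup>2) * W x y \<partial>lborel) + ?P * ((\<integral>\<^sup>+y. ?k x y \<partial>lborel) * indicator \<Omega> x)"
      using m1 m2 by (subst nn_integral_add) (simp_all add: nn_integral_cmult nn_integral_multc)
  qed
  also have "\<dots> = 2 * (\<integral>\<^sup>+x. (\<integral>\<^sup>+y. ennreal ((\<phi> y)\<^sup>2) * W x y \<partial>lborel) \<partial>lborel) + ?P * slobodeckij_sq \<Omega> \<kappa> \<phi>"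
  proof -
    have m1: "(\<lambda>x. \<integral>\<^sup>+y. ennreal ((\<phi> y)\<^sup>2) * W x y \<partial>lborel) \<in> borel_measurable lborel"
      using pW by (intro lborel.borel_measurable_nn_integral) simp
    have m2: "(\<lambda>x. \<integral>\<^sup>+y. ?k x y \<partial>lborel) \<in> borel_measurable lborel"
      using km by (intro lborel.borel_measurable_nn_integral) simp
    have m3: "(\<lambda>x. (\<integral>\<^sup>+y. ?k x y \<partial>lborel) * indicator \<Omega> x) \<in> borel_measurable lborel"
      using m2 Om by measurable
    show ?thesis unfolding slobodeckij_sq_lborel[OF dom] using m1 m3
      by (subst nn_integral_add) (simp_all add: nn_integral_cmult)
  qed
  finally have E1: "m * (\<integral>\<^sup>+x. ennreal ((\<phi> x)\<^sup>2) * indicator X x \<partial>lborel)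
      \<le> 2 * (\<integral>\<^sup>+x. (\<integral>\<^sup>+y. ennreal ((\<phi> y)\<^sup>2) * W x y \<partial>lborel) \<partial>lborel) + ?P * slobodeckij_sq \<Omega> \<kappa> \<phi>" .
  \<comment> \<open>The order of integration is exchanged so that the column estimate applies for
    each fixed y.\<close>
  have "(\<integral>\<^sup>+x. (\<integral>\<^sup>+y. ennreal ((\<phi> y)\<^sup>2) * W x y \<partial>lborel) \<partial>lborel) = (\<integral>\<^sup>+y. (\<integral>\<^sup>+x. ennreal ((\<phi> y)\<^sup>2) * W x y \<partial>lborel) \<partial>lborel)"
    using lborel_pair.Fubini'[of "\<lambda>x y. ennreal ((\<phi> y)\<^sup>2) * W x y"] pW by simp
  also have "\<dots> \<le> (\<integral>\<^sup>+y. ennreal (11 * L\<^sup>2 * 2 ^ DIM('a) * l) * m * (ennreal ((\<phi> y)\<^sup>2) * indicator (layer \<Omega> (t / l)) y) \<partial>lborel)"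
    by (intro nn_integral_mono col)
  also have "\<dots> = ennreal (11 * L\<^sup>2 * 2 ^ DIM('a) * l) * m * layer_energy \<Omega> \<phi> (t / l)"
    unfolding layer_energy_def using lm by (intro nn_integral_cmult) simp
  finally have E2: "(\<integral>\<^sup>+x. (\<integral>\<^sup>+y. ennreal ((\<phi> y)\<^sup>2) * W x y \<partial>lborel) \<partial>lborel)
      \<le> ennreal (11 * L\<^sup>2 * 2 ^ DIM('a) * l) * m * layer_energy \<Omega> \<phi> (t / l)" .
  have "m * (\<integral>\<^sup>+x. ennreal ((\<phi> x)\<^sup>2) * indicator X x \<partial>lborel)
    \<le> 2 * (ennreal (11 * L\<^sup>2 * 2 ^ DIM('a) * l) * m * layer_energy \<Omega> \<phi> (t / l)) + ?P * slobodeckij_sq \<Omega> \<kappa> \<phi>"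
    by (rule order_trans[OF E1 add_right_mono[OF mult_left_mono[OF E2]]]) simp
  also have "2 * (ennreal (11 * L\<^sup>2 * 2 ^ DIM('a) * l) * m * layer_energy \<Omega> \<phi> (t / l))
      = m * (ennreal (22 * L\<^sup>2 * 2 ^ DIM('a) * l) * layer_energy \<Omega> \<phi> (t / l))"
  proof -
    have "ennreal (22 * L\<^sup>2 * 2 ^ DIM('a) * l) = 2 * ennreal (11 * L\<^sup>2 * 2 ^ DIM('a) * l)"
      using l by (subst ennreal_numeral[symmetric], subst ennreal_mult[symmetric]) auto
    then show ?thesis by (simp add: mult_ac)
  qed
  \<comment> \<open>t^DIM is the volume of the averaging ball up to a constant depending on l and L,
    so taking out m leaves t powr (2 * \<kappa>).\<close>
  also have "?P = m * ennreal (2 * (2 * L) powr (real DIM('a) + 2 * \<kappa>) * (4 * l * L) ^ DIM('a) / unit_ball_vol (real DIM('a)) * t powr (2 * \<kappa>))"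
  proof -
    have "(2 * L * t) powr (real DIM('a) + 2 * \<kappa>) = (2 * L) powr (real DIM('a) + 2 * \<kappa>) * (t powr real DIM('a) * t powr (2 * \<kappa>))"
      using L t by (simp add: powr_mult powr_add)
    moreover have "t powr real DIM('a) = r ^ DIM('a) * (4 * l * L) ^ DIM('a)"
      using t l L by (simp add: powr_realpow r_def power_mult_distrib[symmetric])
    moreover have "unit_ball_vol (real DIM('a)) \<noteq> 0" using mpos by auto
    ultimately have "2 * (2 * L * t) powr (real DIM('a) + 2 * \<kappa>) = (unit_ball_vol (real DIM('a)) * r ^ DIM('a)) *
      (2 * (2 * L) powr (real DIM('a) + 2 * \<kappa>) * (4 * l * L) ^ DIM('a) / unit_ball_vol (real DIM('a)) * t powr (2 * \<kappa>))"
      by (simp add: field_simps)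
    then show ?thesis unfolding m using mpos l L
      by (subst ennreal_mult[symmetric]) (auto simp: less_imp_le unit_ball_vol_pos)
  qed
  finally have "m * (\<integral>\<^sup>+x. ennreal ((\<phi> x)\<^sup>2) * indicator X x \<partial>lborel)
    \<le> m * (ennreal (22 * L\<^sup>2 * 2 ^ DIM('a) * l) * layer_energy \<Omega> \<phi> (t / l)
      + ennreal (2 * (2 * L) powr (real DIM('a) + 2 * \<kappa>) * (4 * l * L) ^ DIM('a) / unit_ball_vol (real DIM('a)) * t powr (2 * \<kappa>))
        * slobodeckij_sq \<Omega> \<kappa> \<phi>)"
    by (simp add: distrib_left mult.assoc)
  moreover have "0 < m" unfolding m using mpos by (rule ennreal_less_zero_iff[THEN iffD2])
  moreover have "m \<noteq> top" unfolding m by simp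
  ultimately show ?thesis by (subst (asm) ennreal_mult_le_mult_iff) auto
qed

section \<open>Iterating the comparison of layers\<close>

text \<open>The compact carrier of \<phi> has positive distance from the complement. This ends the
  iteration; the number \<delta> depends on \<phi> but leaves no trace in the final
  constant.\<close>

lemma test_function_away_from_boundary:
  assumes "open \<Omega>" "bounded \<Omega>" "\<phi> \<in> test_functions \<Omega>"
  obtains \<delta> where "0 < \<delta>" "\<And>t. t \<le> \<delta> \<Longrightarrow> layer_energy \<Omega> \<phi> t = 0"
proof -
  obtain K where K: "compact K" "K \<subseteq> \<Omega>" "\<And>x. x \<notin> K \<Longrightarrow> \<phi> x = 0"
    using test_functionsE[OF assms(3)] by metis
  have ne: "- \<Omega> \<noteq> {}"
  proof
    assume "- \<Omega> = {}"
    then have "\<Omega> = UNIV" by auto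
    then show False using assms(2) by (simp add: not_bounded_UNIV)
  qed
  have "\<exists>\<delta>>0. \<forall>x\<in>K. \<delta> \<le> infdist x (- \<Omega>)"
  proof (cases "K = {}")
    case False
    have "continuous_on K (\<lambda>x. infdist x (- \<Omega>))" by (intro continuous_intros)
    then obtain k where k: "k \<in> K" "\<And>x. x \<in> K \<Longrightarrow> infdist k (- \<Omega>) \<le> infdist x (- \<Omega>)"
      using continuous_attains_inf[OF K(1) False] by blast
    have "infdist k (- \<Omega>) > 0"
      using infdist_pos_not_in_closed[of "- \<Omega>" k] assms(1) ne k(1) K(2) by auto
    then show ?thesis using k by blast
  qed (auto intro: exI[of _ 1])
  then obtain \<delta> where d: "\<delta> > 0" "\<And>x. x \<in> K \<Longrightarrow> \<delta> \<le> infdist x (- \<Omega>)" by blast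
  have "layer_energy \<Omega> \<phi> t = 0" if "t \<le> \<delta>" for t
  proof -
    have z: "ennreal ((\<phi> x)\<^sup>2) * indicator (layer \<Omega> t) x = 0" for x
      using d(2)[of x] K(3)[of x] that by (cases "x \<in> K") (auto simp: layer_def)
    show ?thesis unfolding layer_energy_def z by simp
  qed
  then show thesis using that d(1) by blast
qed

text \<open>Induction on n for heights up to \<delta> l^n. Each step consumes half of the constant 2
  c2 through the contraction and spends the other half on the new seminorm term, so the bound does
  not deteriorate with n and is independent of \<delta>.\<close>

lemma layer_energy_iterate:
  fixes \<Omega> :: "'a::euclidean_space set"
  assumes dom: "open \<Omega>" "bounded \<Omega>" and phi: "\<phi> \<in> test_functions \<Omega>"
    and kappa: "1/2 < \<kappa>" and l: "2 \<le> l" and c: "0 \<le> c1" "0 \<le> c2" "c1 * l powr (1 - 2 * \<kappa>) \<le> 1/2"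
    and step: "\<And>t. 0 < t \<Longrightarrow> t < t0 \<Longrightarrow> layer_energy \<Omega> \<phi> t \<le> ennreal (c1 * l) * layer_energy \<Omega> \<phi> (t / l)
        + ennreal (c2 * t powr (2 * \<kappa>)) * slobodeckij_sq \<Omega> \<kappa> \<phi>"
    and t: "0 < t" "t < t0"
  shows "layer_energy \<Omega> \<phi> t \<le> ennreal (2 * c2 * t powr (2 * \<kappa>)) * slobodeckij_sq \<Omega> \<kappa> \<phi>"
proof -
  let ?S = "slobodeckij_sq \<Omega> \<kappa> \<phi>"
  obtain \<delta> where d: "0 < \<delta>" "\<And>t. t \<le> \<delta> \<Longrightarrow> layer_energy \<Omega> \<phi> t = 0"
    using test_function_away_from_boundary[OF dom phi] by blast
  have main: "0 < t \<Longrightarrow> t < t0 \<Longrightarrow> t \<le> \<delta> * l ^ n \<Longrightarrow>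
      layer_energy \<Omega> \<phi> t \<le> ennreal (2 * c2 * t powr (2 * \<kappa>)) * ?S" for n t
  proof (induction n arbitrary: t)
    case 0
    then show ?case using d(2)[of t] by simp
  next
    case (Suc n)
    have tl: "0 < t / l" "t / l \<le> \<delta> * l ^ n" using Suc.prems l by (auto simp: field_simps)
    have "t / l \<le> t / 1" using Suc.prems l by (intro divide_left_mono) auto
    then have tl2: "t / l < t0" using Suc.prems by simp
    \<comment> \<open>The scaling (t / l) powr (2 * \<kappa>) turns c1 l into c1 l powr (1 - 2 *
      \<kappa>), which is at most 1/2.\<close>
    have real: "c1 * l * (2 * c2 * (t / l) powr (2 * \<kappa>)) \<le> c2 * t powr (2 * \<kappa>)"
    proof -
      have "c1 * l * (2 * c2 * (t / l) powr (2 * \<kappa>)) = (c1 * (l powr 1 / l powr (2 * \<kappa>))) * (2 * c2 * t powr (2 * \<kappa>))"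
        using l Suc.prems by (simp add: powr_divide)
      also have "l powr 1 / l powr (2 * \<kappa>) = l powr (1 - 2 * \<kappa>)" by (simp only: powr_diff)
      also have "(c1 * l powr (1 - 2 * \<kappa>)) * (2 * c2 * t powr (2 * \<kappa>)) \<le> 1/2 * (2 * c2 * t powr (2 * \<kappa>))"
        using c by (intro mult_right_mono) auto
      finally show ?thesis by simp
    qed
    have "layer_energy \<Omega> \<phi> t \<le> ennreal (c1 * l) * layer_energy \<Omega> \<phi> (t / l) + ennreal (c2 * t powr (2 * \<kappa>)) * ?S"
      using step Suc.prems by blast
    also have "\<dots> \<le> ennreal (c1 * l) * (ennreal (2 * c2 * (t / l) powr (2 * \<kappa>)) * ?S) + ennreal (c2 * t powr (2 * \<kappa>)) * ?S"
      by (intro add_right_mono mult_left_mono Suc.IH tl tl2) auto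
    also have "\<dots> = ennreal (c1 * l * (2 * c2 * (t / l) powr (2 * \<kappa>)) + c2 * t powr (2 * \<kappa>)) * ?S"
      using c l by (subst ennreal_plus) (auto simp: ennreal_mult distrib_right mult.assoc)
    also have "\<dots> \<le> ennreal (2 * c2 * t powr (2 * \<kappa>)) * ?S"
      using real by (intro mult_right_mono ennreal_leI) auto
    finally show ?case .
  qed
  obtain n where "t / \<delta> < l ^ n" using real_arch_pow[of l "t / \<delta>"] l by auto
  then have "t \<le> \<delta> * l ^ n" using d(1) by (simp add: field_simps)
  then show ?thesis using main t by blast
qed

text \<open>The order of quantifiers is essential: c1 and t0 do not depend on l, so l can later be
  chosen large against c1; only c2 depends on l.\<close>

lemma layer_energy_charts:
  fixes \<Omega> :: "'a::euclidean_space set"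
  assumes dom: "open \<Omega>" "bounded \<Omega>" "C2_boundary \<Omega>" and kappa: "0 < \<kappa>"
  obtains c1 t0 where "0 \<le> c1" "0 < t0"
    "\<And>l. 1 \<le> l \<Longrightarrow> \<exists>c2\<ge>0. \<forall>\<phi> t. continuous_on UNIV \<phi> \<longrightarrow> 0 < t \<longrightarrow> t < t0 \<longrightarrow>
        layer_energy \<Omega> \<phi> t \<le> ennreal (c1 * l) * layer_energy \<Omega> \<phi> (t / l)
        + ennreal (c2 * t powr (2 * \<kappa>)) * slobodeckij_sq \<Omega> \<kappa> \<phi>"
proof -
  obtain X t0 \<rho> L e s where X: "finite X" "0 < t0"
    "\<And>c. c \<in> X \<Longrightarrow> lip_chart \<Omega> c (\<rho> c) (L c) (e c) (s c)"
    "\<And>t. t \<le> t0 \<Longrightarrow> layer \<Omega> t \<subseteq> (\<Union>c\<in>X. ball c (\<rho> c / 2))"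
    by (rule finite_chart_cover[OF dom]) (rule that)
  have rho: "0 < \<rho> c" "1 \<le> L c" if "c \<in> X" for c using X(3)[OF that] by (simp_all add: lip_chart_def)
  define t1 where "t1 = Min (insert t0 ((\<lambda>c. \<rho> c / (8 * L c)) ` X))"
  have t1_le: "t1 \<le> y" if "y \<in> insert t0 ((\<lambda>c. \<rho> c / (8 * L c)) ` X)" for y
    unfolding t1_def using X(1) that by (intro Min_le) auto
  have "0 < \<rho> c / (8 * L c)" if "c \<in> X" for c using rho[OF that] by (intro divide_pos_pos) auto
  then have t1: "0 < t1" using X(1,2) by (simp add: t1_def)
  have t1': "t1 \<le> t0" "\<And>c. c \<in> X \<Longrightarrow> t1 \<le> \<rho> c / (8 * L c)" by (rule t1_le; simp)+
  define c1 where "c1 = (\<Sum>c\<in>X. 22 * (L c)\<^sup>2 * 2 ^ DIM('a))"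
  have "\<exists>c2\<ge>0. \<forall>\<phi> t. continuous_on UNIV \<phi> \<longrightarrow> 0 < t \<longrightarrow> t < t1 \<longrightarrow>
        layer_energy \<Omega> \<phi> t \<le> ennreal (c1 * l) * layer_energy \<Omega> \<phi> (t / l)
        + ennreal (c2 * t powr (2 * \<kappa>)) * slobodeckij_sq \<Omega> \<kappa> \<phi>" if l: "1 \<le> l" for l
  proof -
    define C where "C c = 2 * (2 * L c) powr (real DIM('a) + 2 * \<kappa>) * (4 * l * L c) ^ DIM('a) / unit_ball_vol (real DIM('a))" for c
    have C: "0 \<le> C c" if "c \<in> X" for c
      unfolding C_def using rho[OF that] l by (intro divide_nonneg_nonneg mult_nonneg_nonneg) (auto simp: less_imp_le)
    have "layer_energy \<Omega> \<phi> t \<le> ennreal (c1 * l) * layer_energy \<Omega> \<phi> (t / l)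
        + ennreal ((\<Sum>c\<in>X. C c) * t powr (2 * \<kappa>)) * slobodeckij_sq \<Omega> \<kappa> \<phi>"
      if phi: "continuous_on UNIV \<phi>" and t: "0 < t" "t < t1" for \<phi> t
    proof -
      let ?Y = "\<lambda>c. {x \<in> ball c (\<rho> c / 2). 0 < s c x \<and> s c x < L c * t}"
      have pm: "\<phi> \<in> borel_measurable borel" by (rule borel_measurable_continuous_onI[OF phi])
      have small: "t \<le> \<rho> c / 2" "L c * t \<le> \<rho> c / 8" if "c \<in> X" for c
      proof -
        have "t \<le> \<rho> c / (8 * L c)" using t(2) t1'(2)[OF that] by simp
        then show "L c * t \<le> \<rho> c / 8" using rho[OF that] by (simp add: field_simps)
        moreover have "1 * t \<le> L c * t" using rho[OF that] t by (intro mult_right_mono) auto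
        ultimately show "t \<le> \<rho> c / 2" using rho(1)[OF that] by linarith
      qed
      have Ym: "?Y c \<in> sets borel" if "c \<in> X" for c
      proof -
        have "continuous_on UNIV (s c)" using X(3)[OF that] by (simp add: lip_chart_def)
        then have "open {x. 0 < s c x}" "open {x. s c x < L c * t}"
          by (intro open_Collect_less continuous_intros; assumption)+
        moreover have "?Y c = ball c (\<rho> c / 2) \<inter> {x. 0 < s c x} \<inter> {x. s c x < L c * t}" by auto
        ultimately have "open (?Y c)" by auto
        then show ?thesis by simp
      qed
      have "layer_energy \<Omega> \<phi> t \<le> (\<integral>\<^sup>+x. (\<Sum>c\<in>X. ennreal ((\<phi> x)\<^sup>2) * indicator (?Y c) x) \<partial>lborel)"
        unfolding layer_energy_def
      proof (rule nn_integral_mono)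
        fix x
        show "ennreal ((\<phi> x)\<^sup>2) * indicator (layer \<Omega> t) x \<le> (\<Sum>c\<in>X. ennreal ((\<phi> x)\<^sup>2) * indicator (?Y c) x)"
        proof (cases "x \<in> layer \<Omega> t")
          case True
          then obtain c where c: "c \<in> X" "x \<in> ball c (\<rho> c / 2)" using X(4)[of t] t t1'(1) by auto
          then have "x \<in> ?Y c"
            using lip_chart_layer[OF X(3)[OF c(1)] dom(1,2) c(2) True small(1)[OF c(1)]] by auto
          then have "ennreal ((\<phi> x)\<^sup>2) * indicator (layer \<Omega> t) x = ennreal ((\<phi> x)\<^sup>2) * indicator (?Y c) x"
            using True by simp
          also have "\<dots> \<le> (\<Sum>c\<in>X. ennreal ((\<phi> x)\<^sup>2) * indicator (?Y c) x)"
            using c(1) X(1) by (intro member_le_sum) auto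
          finally show ?thesis .
        qed simp
      qed
      also have "\<dots> = (\<Sum>c\<in>X. \<integral>\<^sup>+x. ennreal ((\<phi> x)\<^sup>2) * indicator (?Y c) x \<partial>lborel)"
        using pm Ym by (intro nn_integral_sum) (auto intro!: borel_measurable_times borel_measurable_indicator)
      also have "\<dots> \<le> (\<Sum>c\<in>X. ennreal (22 * (L c)\<^sup>2 * 2 ^ DIM('a) * l) * layer_energy \<Omega> \<phi> (t / l)
          + ennreal (C c * t powr (2 * \<kappa>)) * slobodeckij_sq \<Omega> \<kappa> \<phi>)"
        unfolding C_def by (intro sum_mono lip_chart_hardy[OF X(3) dom(1) phi l t(1) small(2) kappa])
      also have "\<dots> = ennreal (c1 * l) * layer_energy \<Omega> \<phi> (t / l)
        + ennreal ((\<Sum>c\<in>X. C c) * t powr (2 * \<kappa>)) * slobodeckij_sq \<Omega> \<kappa> \<phi>"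
      proof -
        have "(\<Sum>c\<in>X. ennreal (22 * (L c)\<^sup>2 * 2 ^ DIM('a) * l)) = ennreal (c1 * l)"
          using l by (simp add: c1_def sum_distrib_right)
        moreover have "(\<Sum>c\<in>X. ennreal (C c * t powr (2 * \<kappa>))) = ennreal ((\<Sum>c\<in>X. C c) * t powr (2 * \<kappa>))"
          using C by (simp add: sum_distrib_right)
        ultimately show ?thesis by (simp only: sum.distrib sum_distrib_right[symmetric])
      qed
      finally show ?thesis .
    qed
    moreover have "0 \<le> (\<Sum>c\<in>X. C c)" using C by (rule sum_nonneg)
    ultimately show ?thesis by blast
  qed
  moreover have "0 \<le> c1" by (auto simp: c1_def intro!: sum_nonneg)
  ultimately show thesis using that t1 by blast
qed

text \<open>For \<open>\<kappa> < 1/2\<close> the boundedness of \<open>\<phi>\<close> and the volume of the layer suffice; for \<open>\<kappa> > 1/2\<close> the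
  comparison of layers of heights \<open>t\<close> and \<open>t / l\<close> is iterated with \<open>l\<close> so large that it is contractive.\<close>

lemma layer_energy_bound:
  fixes \<Omega> :: "'a::euclidean_space set"
  assumes dom: "open \<Omega>" "bounded \<Omega>" "C2_boundary \<Omega>" and kappa: "0 < \<kappa>" "\<kappa> \<noteq> 1/2"
  obtains A t0 where "0 \<le> A" "0 < t0"
    "\<And>\<phi> M t. \<phi> \<in> test_functions \<Omega> \<Longrightarrow> (\<And>x. \<bar>\<phi> x\<bar> \<le> M) \<Longrightarrow> 0 < t \<Longrightarrow> t < t0 \<Longrightarrow>
      layer_energy \<Omega> \<phi> t \<le> ennreal (A * t powr (2 * \<kappa>)) * (ennreal (M\<^sup>2) + slobodeckij_sq \<Omega> \<kappa> \<phi>)"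
proof (cases "\<kappa> < 1/2")
  case True
  obtain C t0 where C: "0 \<le> C" "0 < t0" "\<And>t. 0 < t \<Longrightarrow> t < t0 \<Longrightarrow> emeasure lborel (layer \<Omega> t) \<le> ennreal (C * t)"
    using layer_measure[OF dom] by blast
  have "layer_energy \<Omega> \<phi> t \<le> ennreal (C * t powr (2 * \<kappa>)) * (ennreal (M\<^sup>2) + slobodeckij_sq \<Omega> \<kappa> \<phi>)"
    if M: "\<And>x. \<bar>\<phi> x\<bar> \<le> M" and t: "0 < t" "t < min t0 1" for \<phi> M t
  proof -
    have "(\<phi> x)\<^sup>2 \<le> M\<^sup>2" for x using M[of x] by (metis abs_ge_zero power2_abs power_mono)
    then have "layer_energy \<Omega> \<phi> t \<le> (\<integral>\<^sup>+x. ennreal (M\<^sup>2) * indicator (layer \<Omega> t) x \<partial>lborel)"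
      unfolding layer_energy_def by (intro nn_integral_mono mult_right_mono ennreal_leI) auto
    also have "\<dots> = ennreal (M\<^sup>2) * emeasure lborel (layer \<Omega> t)"
      using open_layer[OF dom(1)] by (intro nn_integral_cmult_indicator) simp
    also have "\<dots> \<le> ennreal (M\<^sup>2) * ennreal (C * t powr (2 * \<kappa>))"
    proof (intro mult_left_mono)
      \<comment> \<open>Here t < 1 and 2 \<kappa> < 1.\<close>
      have "t powr 1 \<le> t powr (2 * \<kappa>)" using True t by (intro powr_mono') auto
      then have "C * t \<le> C * t powr (2 * \<kappa>)" using C(1) t by (intro mult_left_mono) auto
      then show "emeasure lborel (layer \<Omega> t) \<le> ennreal (C * t powr (2 * \<kappa>))"
        using C(3)[of t] t by (intro order_trans[OF C(3) ennreal_leI]) auto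
    qed simp
    also have "\<dots> \<le> ennreal (C * t powr (2 * \<kappa>)) * (ennreal (M\<^sup>2) + slobodeckij_sq \<Omega> \<kappa> \<phi>)"
      by (subst mult.commute) (intro mult_left_mono, auto)
    finally show ?thesis .
  qed
  then show thesis using that[of C "min t0 1"] C(1,2) by auto
next
  case False
  then have k: "1/2 < \<kappa>" using kappa by simp
  obtain c1 t0 where c1: "0 \<le> c1" "0 < t0"
    "\<And>l. 1 \<le> l \<Longrightarrow> \<exists>c2\<ge>0. \<forall>\<phi> t. continuous_on UNIV \<phi> \<longrightarrow> 0 < t \<longrightarrow> t < t0 \<longrightarrow>
        layer_energy \<Omega> \<phi> t \<le> ennreal (c1 * l) * layer_energy \<Omega> \<phi> (t / l)
        + ennreal (c2 * t powr (2 * \<kappa>)) * slobodeckij_sq \<Omega> \<kappa> \<phi>"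
    using layer_energy_charts[OF dom kappa(1)] by blast
  \<comment> \<open>Solves l powr (2 * \<kappa> - 1) \<ge> 2 * c1 + 1, which makes the contraction
    factor at most 1/2; the exponent is positive because \<kappa> > 1/2.\<close>
  define l where "l = max 2 ((2 * c1 + 1) powr (1 / (2 * \<kappa> - 1)))"
  have l: "2 \<le> l" "1 \<le> l" by (auto simp: l_def)
  have cl: "c1 * l powr (1 - 2 * \<kappa>) \<le> 1/2"
  proof -
    have "2 * c1 + 1 = ((2 * c1 + 1) powr (1 / (2 * \<kappa> - 1))) powr (2 * \<kappa> - 1)"
      using c1(1) k by (simp add: powr_powr)
    also have "\<dots> \<le> l powr (2 * \<kappa> - 1)" using k by (intro powr_mono2) (auto simp: l_def)
    finally have "c1 * l powr (1 - 2 * \<kappa>) * 2 \<le> l powr (2 * \<kappa> - 1) * l powr (1 - 2 * \<kappa>)"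
      using mult_right_mono[of "2 * c1" "l powr (2 * \<kappa> - 1)" "l powr (1 - 2 * \<kappa>)"] by (simp add: mult_ac)
    also have "\<dots> = 1" using l by (simp flip: powr_add)
    finally show ?thesis by simp
  qed
  obtain c2 where c2: "0 \<le> c2" "\<And>\<phi> t. continuous_on UNIV \<phi> \<Longrightarrow> 0 < t \<Longrightarrow> t < t0 \<Longrightarrow>
        layer_energy \<Omega> \<phi> t \<le> ennreal (c1 * l) * layer_energy \<Omega> \<phi> (t / l)
        + ennreal (c2 * t powr (2 * \<kappa>)) * slobodeckij_sq \<Omega> \<kappa> \<phi>"
    using c1(3)[OF l(2)] by blast
  have "layer_energy \<Omega> \<phi> t \<le> ennreal (2 * c2 * t powr (2 * \<kappa>)) * (ennreal (M\<^sup>2) + slobodeckij_sq \<Omega> \<kappa> \<phi>)"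
    if phi: "\<phi> \<in> test_functions \<Omega>" and t: "0 < t" "t < t0" for \<phi> M t
  proof -
    have "smooth \<phi>" using phi by (rule test_functionsE)
    then have "continuous_on UNIV \<phi>" by (rule smooth_continuous_on)
    then have "layer_energy \<Omega> \<phi> t \<le> ennreal (2 * c2 * t powr (2 * \<kappa>)) * slobodeckij_sq \<Omega> \<kappa> \<phi>"
      by (intro layer_energy_iterate[OF dom(1,2) phi k l(1) c1(1) c2(1) cl _ t] c2(2))
    also have "\<dots> \<le> ennreal (2 * c2 * t powr (2 * \<kappa>)) * (ennreal (M\<^sup>2) + slobodeckij_sq \<Omega> \<kappa> \<phi>)"
      by (intro mult_left_mono) auto
    finally show ?thesis .
  qed
  then show thesis using that[of "2 * c2" t0] c1(2) c2(1) by auto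
qed

subsection \<open>The Slobodeckij seminorm\<close>

abbreviation slob_kernel :: "real \<Rightarrow> ('a::euclidean_space \<Rightarrow> real) \<Rightarrow> 'a \<Rightarrow> 'a \<Rightarrow> ennreal" where
  "slob_kernel \<kappa> f x y \<equiv> ennreal ((f x - f y)\<^sup>2 / norm (x - y) powr (real DIM('a) + 2 * \<kappa>))"

lemma finite_measure_lebesgue_on: "open \<Omega> \<Longrightarrow> bounded \<Omega> \<Longrightarrow> finite_measure (lebesgue_on \<Omega>)"
  using emeasure_bounded_finite[of \<Omega>]
  by (intro finite_measureI) (auto simp: emeasure_restrict_space)

text \<open>Formulated over \<open>lebesgue_on\<close> because p itself is only Lebesgue measurable;
  the coordinate maps remain measurable into the Borel sets.\<close>

lemma slob_kernel_measurable:
  fixes f :: "'a::euclidean_space \<Rightarrow> real"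
  assumes "f \<in> borel_measurable (lebesgue_on \<Omega>)"
  shows "(\<lambda>(x, y). slob_kernel \<kappa> f x y) \<in> borel_measurable (lebesgue_on \<Omega> \<Otimes>\<^sub>M lebesgue_on \<Omega>)"
    "x \<in> \<Omega> \<Longrightarrow> slob_kernel \<kappa> f x \<in> borel_measurable (lebesgue_on \<Omega>)"
proof -
  have [measurable]: "f \<in> borel_measurable (lebesgue_on \<Omega>)" by (rule assms)
  have [measurable]: "(\<lambda>x. x) \<in> lebesgue_on \<Omega> \<rightarrow>\<^sub>M borel"
    by (rule measurable_restrict_space1, rule measurable_completion) simp
  have [measurable]: "fst \<in> (lebesgue_on \<Omega> \<Otimes>\<^sub>M lebesgue_on \<Omega>) \<rightarrow>\<^sub>M borel"
    "snd \<in> (lebesgue_on \<Omega> \<Otimes>\<^sub>M lebesgue_on \<Omega>) \<rightarrow>\<^sub>M borel"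
    using measurable_compose[OF measurable_fst, of "\<lambda>x. x" "lebesgue_on \<Omega>" borel "lebesgue_on \<Omega>"]
      measurable_compose[OF measurable_snd, of "\<lambda>x. x" "lebesgue_on \<Omega>" borel "lebesgue_on \<Omega>"] by simp_all
  show "(\<lambda>(x, y). slob_kernel \<kappa> f x y) \<in> borel_measurable (lebesgue_on \<Omega> \<Otimes>\<^sub>M lebesgue_on \<Omega>)"
    unfolding case_prod_beta by measurable
  show "slob_kernel \<kappa> f x \<in> borel_measurable (lebesgue_on \<Omega>)" if "x \<in> \<Omega>"
    by measurable
qed

lemma slobodeckij_sq_cong_AE:
  fixes f :: "'a::euclidean_space \<Rightarrow> real"
  assumes "AE x in lebesgue_on \<Omega>. f x = g x"
  shows "slobodeckij_sq \<Omega> \<kappa> f = slobodeckij_sq \<Omega> \<kappa> g"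
  unfolding slobodeckij_sq_def
proof (rule nn_integral_cong_AE)
  show "AE x in lebesgue_on \<Omega>. (\<integral>\<^sup>+y. slob_kernel \<kappa> f x y \<partial>lebesgue_on \<Omega>) = (\<integral>\<^sup>+y. slob_kernel \<kappa> g x y \<partial>lebesgue_on \<Omega>)"
    using assms
  proof eventually_elim
    case (elim x)
    show ?case by (rule nn_integral_cong_AE) (use assms in eventually_elim, simp add: elim)
  qed
qed

text \<open>A pointwise inequality between squared increments passes to the seminorms. With c = d =
  2 it replaces the triangle inequality, with d = 0 it treats composition with a Lipschitz
  function.\<close>

lemma slobodeckij_sq_combine:
  fixes f g h :: "'a::euclidean_space \<Rightarrow> real"
  assumes dom: "open \<Omega>" "bounded \<Omega>" and f: "f \<in> borel_measurable (lebesgue_on \<Omega>)"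
    and g: "g \<in> borel_measurable (lebesgue_on \<Omega>)" and c: "0 \<le> c" "0 \<le> d"
    and le: "\<And>x y. (h x - h y)\<^sup>2 \<le> c * (f x - f y)\<^sup>2 + d * (g x - g y)\<^sup>2"
  shows "slobodeckij_sq \<Omega> \<kappa> h \<le> ennreal c * slobodeckij_sq \<Omega> \<kappa> f + ennreal d * slobodeckij_sq \<Omega> \<kappa> g"
proof -
  let ?M = "lebesgue_on \<Omega>"
  interpret finite_measure ?M by (rule finite_measure_lebesgue_on[OF dom])
  note mf = slob_kernel_measurable[OF f, where \<kappa> = \<kappa>] and mg = slob_kernel_measurable[OF g, where \<kappa> = \<kappa>]
  have pt: "slob_kernel \<kappa> h x y \<le> ennreal c * slob_kernel \<kappa> f x y + ennreal d * slob_kernel \<kappa> g x y" for x y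
  proof -
    let ?n = "norm (x - y) powr (real DIM('a) + 2 * \<kappa>)"
    have "slob_kernel \<kappa> h x y \<le> ennreal ((c * (f x - f y)\<^sup>2 + d * (g x - g y)\<^sup>2) / ?n)"
      by (intro ennreal_leI divide_right_mono le) simp
    also have "(c * (f x - f y)\<^sup>2 + d * (g x - g y)\<^sup>2) / ?n = c * ((f x - f y)\<^sup>2 / ?n) + d * ((g x - g y)\<^sup>2 / ?n)"
      by (simp add: add_divide_distrib)
    also have "ennreal \<dots> = ennreal (c * ((f x - f y)\<^sup>2 / ?n)) + ennreal (d * ((g x - g y)\<^sup>2 / ?n))"
      using c by (intro ennreal_plus) auto
    also have "\<dots> = ennreal c * slob_kernel \<kappa> f x y + ennreal d * slob_kernel \<kappa> g x y"
      using c by (intro arg_cong2[of _ _ _ _ "(+)"] ennreal_mult) auto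
    finally show ?thesis .
  qed
  have "slobodeckij_sq \<Omega> \<kappa> h \<le> (\<integral>\<^sup>+x. (\<integral>\<^sup>+y. ennreal c * slob_kernel \<kappa> f x y + ennreal d * slob_kernel \<kappa> g x y \<partial>?M) \<partial>?M)"
    unfolding slobodeckij_sq_def by (intro nn_integral_mono pt)
  also have "\<dots> = (\<integral>\<^sup>+x. ennreal c * (\<integral>\<^sup>+y. slob_kernel \<kappa> f x y \<partial>?M) + ennreal d * (\<integral>\<^sup>+y. slob_kernel \<kappa> g x y \<partial>?M) \<partial>?M)"
  proof (rule nn_integral_cong)
    fix x assume "x \<in> space ?M"
    then have "x \<in> \<Omega>" by simp
    then show "(\<integral>\<^sup>+y. ennreal c * slob_kernel \<kappa> f x y + ennreal d * slob_kernel \<kappa> g x y \<partial>?M)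
      = ennreal c * (\<integral>\<^sup>+y. slob_kernel \<kappa> f x y \<partial>?M) + ennreal d * (\<integral>\<^sup>+y. slob_kernel \<kappa> g x y \<partial>?M)"
      using mf(2)[of x] mg(2)[of x]
      by (subst nn_integral_add) (auto simp: nn_integral_cmult)
  qed
  also have "\<dots> = ennreal c * slobodeckij_sq \<Omega> \<kappa> f + ennreal d * slobodeckij_sq \<Omega> \<kappa> g"
  proof -
    have "(\<lambda>x. \<integral>\<^sup>+y. slob_kernel \<kappa> f x y \<partial>?M) \<in> borel_measurable ?M"
      "(\<lambda>x. \<integral>\<^sup>+y. slob_kernel \<kappa> g x y \<partial>?M) \<in> borel_measurable ?M"
      using mf(1) mg(1) by (auto intro!: borel_measurable_nn_integral)
    then show ?thesis unfolding slobodeckij_sq_def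
      by (subst nn_integral_add) (auto simp: nn_integral_cmult)
  qed
  finally show ?thesis .
qed

text \<open>Dyadic shells: on \<open>R / 2\<^sup>k\<^sup>+\<^sup>1 \<le> norm (x - y) \<le> R / 2\<^sup>k\<close> the kernel is at most the \<open>k\<close>-th coefficient.\<close>

lemma slob_kernel_integral_bound:
  fixes \<phi> :: "'a::euclidean_space \<Rightarrow> real"
  assumes kappa: "\<kappa> < 1" "0 < \<kappa>" and B: "0 \<le> B" "\<And>x y. \<bar>\<phi> x - \<phi> y\<bar> \<le> B * norm (x - y)" and R: "0 < R"
  obtains C where "0 \<le> C" "\<And>x. (\<integral>\<^sup>+y. slob_kernel \<kappa> \<phi> x y * indicator (cball x R) y \<partial>lborel) \<le> ennreal C"
proof -
  \<comment> \<open>On the k-th shell the numerator is bounded at the outer radius, the denominator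
    at the inner one.\<close>
  define a where "a k = B\<^sup>2 * (R / 2 ^ k)\<^sup>2 / (R / 2 ^ Suc k) powr (real DIM('a) + 2 * \<kappa>)" for k :: nat
  have a: "0 \<le> a k" for k by (simp add: a_def)
  define D where "D = unit_ball_vol (real DIM('a)) * B\<^sup>2 * R powr (2 - 2 * \<kappa>) * 2 powr (real DIM('a) + 2 * \<kappa>)"
  \<comment> \<open>The ratio of consecutive shell contributions; it is below 1 because \<kappa> <
    1, so the sum over shells is geometric.\<close>
  define \<theta> where "\<theta> = 2 powr (- (2 - 2 * \<kappa>))"
  have th: "0 \<le> \<theta>" "\<theta> < 1" unfolding \<theta>_def using kappa powr_less_mono[of "- (2 - 2 * \<kappa>)" 0 2] by auto
  have D: "0 \<le> D" by (auto simp: D_def less_imp_le)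
  have av: "a k * (unit_ball_vol (real DIM('a)) * (R / 2 ^ k) ^ DIM('a)) = D * \<theta> ^ k" for k
  proof -
    define P where "P = R / 2 ^ k"
    have P: "P > 0" using R by (simp add: P_def)
    have ak: "a k = B\<^sup>2 * P\<^sup>2 / (P / 2) powr (real DIM('a) + 2 * \<kappa>)" by (simp add: a_def P_def mult.commute)
    have "a k * (unit_ball_vol (real DIM('a)) * P ^ DIM('a))
        = unit_ball_vol (real DIM('a)) * B\<^sup>2 * (P powr 2 * P powr real DIM('a) / (P powr (real DIM('a) + 2 * \<kappa>) / 2 powr (real DIM('a) + 2 * \<kappa>)))"
      unfolding ak using P by (simp add: powr_divide powr_realpow[OF P])
    also have "\<dots> = unit_ball_vol (real DIM('a)) * B\<^sup>2 * (P powr 2 * P powr real DIM('a) / P powr (real DIM('a) + 2 * \<kappa>)) * 2 powr (real DIM('a) + 2 * \<kappa>)"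
      by simp
    also have "P powr 2 * P powr real DIM('a) / P powr (real DIM('a) + 2 * \<kappa>) = P powr (2 - 2 * \<kappa>)"
      by (simp flip: powr_add powr_diff)
    also have "P powr (2 - 2 * \<kappa>) = R powr (2 - 2 * \<kappa>) * \<theta> ^ k"
    proof -
      have "P powr (2 - 2 * \<kappa>) = R powr (2 - 2 * \<kappa>) / (2 ^ k) powr (2 - 2 * \<kappa>)"
        using R by (simp add: P_def powr_divide)
      also have "(2 ^ k) powr (2 - 2 * \<kappa>) = (2 powr (2 - 2 * \<kappa>)) ^ k"
        by (simp add: powr_realpow[symmetric] powr_powr mult.commute)
      also have "R powr (2 - 2 * \<kappa>) / (2 powr (2 - 2 * \<kappa>)) ^ k = R powr (2 - 2 * \<kappa>) * \<theta> ^ k"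
        by (simp only: \<theta>_def powr_minus power_inverse divide_inverse)
      finally show ?thesis .
    qed
    finally show ?thesis unfolding P_def[symmetric] by (simp add: D_def mult_ac)
  qed
  have "(\<integral>\<^sup>+y. slob_kernel \<kappa> \<phi> x y * indicator (cball x R) y \<partial>lborel) \<le> ennreal (D * (1 / (1 - \<theta>)))" for x
  proof -
    have pt: "slob_kernel \<kappa> \<phi> x y * indicator (cball x R) y \<le> (\<Sum>k. ennreal (a k) * indicator (cball x (R / 2 ^ k)) y)" for y
    proof (cases "x = y \<or> y \<notin> cball x R")
      case True
      then show ?thesis by auto
    next
      case False
      define q where "q = R / norm (x - y)"
      have n: "0 < norm (x - y)" "norm (x - y) \<le> R" using False by (auto simp: dist_norm)
      have q: "1 \<le> q" using n by (simp add: q_def)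
      obtain k where k: "2 ^ k \<le> q" "q < 2 ^ Suc k"
      proof -
        obtain n where "q < 2 ^ n" using real_arch_pow[of 2 q] by auto
        then have ex: "\<exists>n. q < 2 ^ n" by blast
        define m where "m = (LEAST n. q < 2 ^ n)"
        have m: "q < 2 ^ m" unfolding m_def by (rule LeastI_ex[OF ex])
        then have "m \<noteq> 0" using q by (cases m) auto
        then obtain k where k: "m = Suc k" by (cases m) auto
        then have "\<not> q < 2 ^ k" using not_less_Least[of k "\<lambda>n. q < 2 ^ n"] by (simp add: m_def)
        then show thesis using that[of k] m k by simp
      qed
      have k1: "norm (x - y) \<le> R / 2 ^ k" using k(1) n by (simp add: q_def field_simps)
      have k2: "R / 2 ^ Suc k \<le> norm (x - y)" using k(2) n by (simp add: q_def field_simps)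
      have "(\<phi> x - \<phi> y)\<^sup>2 = \<bar>\<phi> x - \<phi> y\<bar>\<^sup>2" by simp
      also have "\<dots> \<le> (B * (R / 2 ^ k))\<^sup>2"
        using B k1 by (intro power_mono order_trans[OF B(2)] mult_left_mono) auto
      finally have "(\<phi> x - \<phi> y)\<^sup>2 / norm (x - y) powr (real DIM('a) + 2 * \<kappa>) \<le> a k"
        unfolding a_def power_mult_distrib[symmetric] using k2 R kappa
        by (intro frac_le powr_mono2) auto
      then have "slob_kernel \<kappa> \<phi> x y * indicator (cball x R) y \<le> ennreal (a k) * indicator (cball x (R / 2 ^ k)) y"
        using False k1 by (simp add: dist_norm ennreal_leI)
      also have "\<dots> \<le> (\<Sum>k. ennreal (a k) * indicator (cball x (R / 2 ^ k)) y)"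
      proof -
        define f where "f k = ennreal (a k) * indicator (cball x (R / 2 ^ k)) y" for k
        have "sum f {k} \<le> suminf f" by (rule sum_le_suminf) auto
        then have "f k \<le> suminf f" by simp
        then show ?thesis unfolding f_def[abs_def] .
      qed
      finally show ?thesis .
    qed
    have m: "(\<lambda>y. ennreal (a k) * indicator (cball x (R / 2 ^ k)) y) \<in> borel_measurable borel" for k
    proof -
      have [measurable]: "cball x (R / 2 ^ k) \<in> sets borel" by simp
      show ?thesis by measurable
    qed
    have "(\<integral>\<^sup>+y. slob_kernel \<kappa> \<phi> x y * indicator (cball x R) y \<partial>lborel)
      \<le> (\<integral>\<^sup>+y. (\<Sum>k. ennreal (a k) * indicator (cball x (R / 2 ^ k)) y) \<partial>lborel)"
      by (intro nn_integral_mono pt)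
    also have "\<dots> = (\<Sum>k. \<integral>\<^sup>+y. ennreal (a k) * indicator (cball x (R / 2 ^ k)) y \<partial>lborel)"
      by (intro nn_integral_suminf) (auto simp: m)
    also have "\<dots> = (\<Sum>k. ennreal (D * \<theta> ^ k))"
    proof (rule suminf_cong)
      fix k
      have "(\<integral>\<^sup>+y. ennreal (a k) * indicator (cball x (R / 2 ^ k)) y \<partial>lborel) = ennreal (a k) * emeasure lborel (cball x (R / 2 ^ k))"
        by (intro nn_integral_cmult_indicator) auto
      also have "\<dots> = ennreal (a k * (unit_ball_vol (real DIM('a)) * (R / 2 ^ k) ^ DIM('a)))"
        using R a by (subst emeasure_cball) (auto simp: ennreal_mult)
      finally show "(\<integral>\<^sup>+y. ennreal (a k) * indicator (cball x (R / 2 ^ k)) y \<partial>lborel) = ennreal (D * \<theta> ^ k)"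
        by (simp only: av)
    qed
    also have "\<dots> = ennreal (D * (1 / (1 - \<theta>)))"
    proof (rule suminf_ennreal_eq)
      show "0 \<le> D * \<theta> ^ k" for k using D th by simp
      show "(\<lambda>k. D * \<theta> ^ k) sums (D * (1 / (1 - \<theta>)))"
        using th by (intro sums_mult geometric_sums) auto
    qed
    finally show ?thesis .
  qed
  moreover have "0 \<le> D * (1 / (1 - \<theta>))" using D th by simp
  ultimately show thesis using that by blast
qed

lemma test_function_lipschitz:
  fixes \<phi> :: "'a::euclidean_space \<Rightarrow> real"
  assumes "\<phi> \<in> test_functions \<Omega>"
  obtains B where "0 \<le> B" "\<And>x y. \<bar>\<phi> x - \<phi> y\<bar> \<le> B * norm (x - y)"
proof -
  have sm: "smooth \<phi>" using assms by (rule test_functionsE)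
  have "\<exists>B. \<forall>x. \<bar>pd b \<phi> x\<bar> \<le> B" if b: "b \<in> Basis" for b
    using test_function_bounded[OF test_functions_pd[OF assms b]] by metis
  then obtain B where B: "\<And>b x. b \<in> Basis \<Longrightarrow> \<bar>pd b \<phi> x\<bar> \<le> B b" by metis
  define C where "C = Max (B ` Basis)"
  have C: "\<bar>pd b \<phi> x\<bar> \<le> C" if "b \<in> Basis" for b x
    unfolding C_def using that by (intro order_trans[OF B] Max_ge) auto
  have "0 \<le> C" using C[OF SOME_Basis] by (meson abs_ge_zero order_trans)
  moreover have "\<bar>\<phi> x - \<phi> y\<bar> \<le> real DIM('a) * C * norm (x - y)" for x y
    by (rule lipschitz_from_pd[of UNIV]) (use smooth_differentiable[OF sm] C in auto)
  ultimately show thesis using that[of "real DIM('a) * C"] by simp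
qed

text \<open>\<open>sobolev_norm\<close> passes through \<open>enn2real\<close>, which sends infinity
  to 0. A small norm says something about the seminorm only once the seminorm is known to be
  finite.\<close>

lemma slobodeckij_sq_test_finite:
  fixes \<phi> :: "'a::euclidean_space \<Rightarrow> real"
  assumes dom: "open \<Omega>" "bounded \<Omega>" and kappa: "0 < \<kappa>" "\<kappa> < 1" and phi: "\<phi> \<in> test_functions \<Omega>"
  shows "slobodeckij_sq \<Omega> \<kappa> \<phi> < \<infinity>"
proof -
  obtain B where B: "0 \<le> B" "\<And>x y. \<bar>\<phi> x - \<phi> y\<bar> \<le> B * norm (x - y)"
    by (rule test_function_lipschitz[OF phi]) (rule that)
  obtain r where r: "0 < r" "\<Omega> \<subseteq> ball 0 r" using bounded_subset_ballD[OF dom(2), of 0] by blast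
  obtain C where C: "0 \<le> C" "\<And>x. (\<integral>\<^sup>+y. slob_kernel \<kappa> \<phi> x y * indicator (cball x (2 * r)) y \<partial>lborel) \<le> ennreal C"
    using slob_kernel_integral_bound[OF kappa(2,1) B, of "2 * r"] r(1) by auto
  have "slobodeckij_sq \<Omega> \<kappa> \<phi> \<le> (\<integral>\<^sup>+x. ennreal C * indicator \<Omega> x \<partial>lborel)"
    unfolding slobodeckij_sq_lborel[OF dom(1)]
  proof (rule nn_integral_mono)
    fix x
    show "(\<integral>\<^sup>+y. slob_kernel \<kappa> \<phi> x y * indicator \<Omega> y \<partial>lborel) * indicator \<Omega> x \<le> ennreal C * indicator \<Omega> x"
    proof (cases "x \<in> \<Omega>")
      case True
      have "y \<in> cball x (2 * r)" if "y \<in> \<Omega>" for y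
      proof -
        have "norm x < r" "norm y < r" using True that r(2) by auto
        then show ?thesis using norm_triangle_ineq4[of x y] by (simp add: dist_norm)
      qed
      then have "(\<integral>\<^sup>+y. slob_kernel \<kappa> \<phi> x y * indicator \<Omega> y \<partial>lborel) \<le> (\<integral>\<^sup>+y. slob_kernel \<kappa> \<phi> x y * indicator (cball x (2 * r)) y \<partial>lborel)"
        by (intro nn_integral_mono mult_left_mono) (auto simp: indicator_def)
      then show ?thesis using C(2)[of x] True by simp
    qed simp
  qed
  also have "\<dots> = ennreal C * emeasure lborel \<Omega>" using dom(1) by (intro nn_integral_cmult_indicator) simp
  also have "\<dots> < \<infinity>" using emeasure_bounded_finite[OF dom(2)] by (simp add: ennreal_mult_less_top)
  finally show ?thesis .
qed

text \<open>Composition with the truncation T again: p = T(p) a.e., so the L2 error grows at most by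
  the factor M, and squared increments by M^2. Neither M nor S depends on the required
  accuracy.\<close>

lemma sobolev0_fractional_approx:
  fixes \<Omega> :: "'a::euclidean_space set"
  assumes dom: "open \<Omega>" "bounded \<Omega>" and kappa: "0 < \<kappa>" "\<kappa> < 1" and p: "p \<in> sobolev0 \<Omega> \<kappa>"
    and R: "AE x in lebesgue_on \<Omega>. \<bar>p x\<bar> \<le> R" "R > 0"
  obtains M S where "0 \<le> S" "\<And>\<delta>. 0 < \<delta> \<Longrightarrow> \<exists>\<phi>\<in>test_functions \<Omega>. (\<forall>x. \<bar>\<phi> x\<bar> \<le> M) \<and>
      L2_norm \<Omega> (\<lambda>x. p x - \<phi> x) \<le> \<delta> \<and> slobodeckij_sq \<Omega> \<kappa> \<phi> \<le> ennreal S"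
proof -
  obtain T M where T: "smooth T" "M \<ge> 0" "\<And>s. \<bar>T s\<bar> \<le> M" "\<And>s. \<bar>pd 1 T s\<bar> \<le> M" "\<And>s. \<bar>s\<bar> \<le> R \<Longrightarrow> T s = s"
    using smooth_truncation[OF R(2)] by metis
  have T0: "T 0 = 0" using T(5)[of 0] R(2) by simp
  have fl: "nat \<lfloor>\<kappa>\<rfloor> = 0" "frac \<kappa> = \<kappa>" using kappa by (simp_all add: frac_eq floor_eq_iff)
  obtain \<phi> where ps: "p \<in> sobolev \<Omega> \<kappa>" and phi: "\<And>n. \<phi> n \<in> test_functions \<Omega>"
    and lim: "(\<lambda>n. sobolev_norm \<Omega> \<kappa> (\<lambda>x. \<phi> n x - p x)) \<longlonglongrightarrow> 0"
    using p unfolding sobolev0_def by blast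
  have pL: "p \<in> L2 \<Omega>" using ps by (rule sobolevL2)
  have ploc: "locally_integrable \<Omega> p" using ps by (rule sobolev_locally_integrable)
  have Sp: "slobodeckij_sq \<Omega> \<kappa> p < \<infinity>"
  proof -
    have "slobodeckij_sq \<Omega> \<kappa> (weak_deriv \<Omega> [] p) < \<infinity>"
      using ps kappa unfolding sobolev_def fl by (auto simp: basis_words_simps)
    then show ?thesis using slobodeckij_sq_cong_AE[OF weak_deriv_Nil[OF dom(1) ploc]] by simp
  qed
  define P where "P = enn2real (slobodeckij_sq \<Omega> \<kappa> p)"
  have P: "slobodeckij_sq \<Omega> \<kappa> p = ennreal P" using Sp by (simp add: P_def)
  \<comment> \<open>Twice the squared seminorm of the error, at most 1, plus twice that of p, times
    the squared Lipschitz constant.\<close>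
  define S where "S = M\<^sup>2 * (2 + 2 * P)"
  have "0 \<le> S" by (simp add: S_def P_def)
  moreover have "\<exists>\<psi>\<in>test_functions \<Omega>. (\<forall>x. \<bar>\<psi> x\<bar> \<le> M) \<and>
      L2_norm \<Omega> (\<lambda>x. p x - \<psi> x) \<le> \<delta> \<and> slobodeckij_sq \<Omega> \<kappa> \<psi> \<le> ennreal S" if d: "0 < \<delta>" for \<delta>
  proof -
    \<comment> \<open>The 1 keeps the seminorm of the error bounded, the other entry delivers the L2
      accuracy.\<close>
    define d where "d = min 1 (\<delta> / (M + 1))"
    have d0: "0 < d" using d T(2) by (simp add: d_def)
    obtain n where n: "sobolev_norm \<Omega> \<kappa> (\<lambda>x. \<phi> n x - p x) < d"
      using order_tendstoD(2)[OF lim d0] by (auto simp: eventually_sequentially)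
    have sm: "smooth (\<phi> n)" using phi[of n] by (rule test_functionsE)
    have L: "h \<in> L2 \<Omega>" if "smooth h" for h
      using continuous_L2[OF dom(2,1) smooth_continuous_on[OF that]] .
    let ?\<psi> = "\<lambda>x. T (\<phi> n x)" and ?e = "\<lambda>x. \<phi> n x - p x"
    have smT: "smooth ?\<psi>" by (rule smooth_compose[OF T(1) sm])
    have 0: "?\<psi> \<in> test_functions \<Omega>" by (rule test_functions_compose[OF phi T(1) T0])
    have dp: "?e \<in> L2 \<Omega>" by (intro L2_diff L sm pL)
    have dloc: "locally_integrable \<Omega> ?e"
      by (intro locally_integrable_diff continuous_locally_integrable smooth_continuous_on sm ploc)
    have "L2_norm \<Omega> (\<lambda>x. p x - ?\<psi> x) \<le> L2_norm \<Omega> (\<lambda>x. M * ?e x)"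
    proof (rule L2_bound(2)[OF _ L2_scale(1)[OF dp]])
      show "(\<lambda>x. p x - ?\<psi> x) \<in> borel_measurable (lebesgue_on \<Omega>)"
        by (rule L2D(1)[OF L2_diff[OF pL L[OF smT]]])
      show "AE x in lebesgue_on \<Omega>. \<bar>p x - ?\<psi> x\<bar> \<le> \<bar>M * ?e x\<bar>"
        using R(1)
      proof eventually_elim
        case (elim x)
        have "\<bar>T (p x) - ?\<psi> x\<bar> \<le> M * \<bar>p x - \<phi> n x\<bar>" by (rule smooth_bounded_deriv_lipschitz[OF T(1,4)])
        then show ?case using T(5)[OF elim] T(2) by (simp add: abs_mult abs_minus_commute)
      qed
    qed
    also have "\<dots> = M * L2_norm \<Omega> ?e" using L2_scale(2)[OF dp] T(2) by simp
    also have "\<dots> \<le> (M + 1) * d"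
      using L2_norm_le_sobolev_norm[OF dom(1) dp dloc, of \<kappa>] n T(2)
      by (intro mult_mono) (auto simp: L2_norm_nonneg)
    also have "\<dots> \<le> (M + 1) * (\<delta> / (M + 1))" using T(2) by (intro mult_left_mono) (auto simp: d_def)
    also have "\<dots> = \<delta>" using T(2) by simp
    finally have 1: "L2_norm \<Omega> (\<lambda>x. p x - ?\<psi> x) \<le> \<delta>" .
    \<comment> \<open>Finiteness has to come first, otherwise the small value of
      \<open>enn2real\<close> could stand for infinity.\<close>
    have Se_fin: "slobodeckij_sq \<Omega> \<kappa> ?e < \<infinity>"
    proof -
      have "slobodeckij_sq \<Omega> \<kappa> ?e \<le> ennreal 2 * slobodeckij_sq \<Omega> \<kappa> (\<phi> n) + ennreal 2 * slobodeckij_sq \<Omega> \<kappa> p"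
      proof (rule slobodeckij_sq_combine[OF dom L2D(1)[OF L[OF sm]] L2D(1)[OF pL]])
        fix x y
        have "0 \<le> ((\<phi> n x - \<phi> n y) + (p x - p y))\<^sup>2" by simp
        then show "(?e x - ?e y)\<^sup>2 \<le> 2 * (\<phi> n x - \<phi> n y)\<^sup>2 + 2 * (p x - p y)\<^sup>2"
          by (simp add: power2_eq_square algebra_simps)
      qed auto
      also have "\<dots> < \<infinity>"
        using slobodeckij_sq_test_finite[OF dom kappa phi[of n]] Sp by (simp add: ennreal_mult_less_top)
      finally show ?thesis .
    qed
    have Se: "slobodeckij_sq \<Omega> \<kappa> ?e \<le> ennreal 1"
    proof -
      have eq: "slobodeckij_sq \<Omega> \<kappa> (weak_deriv \<Omega> [] ?e) = slobodeckij_sq \<Omega> \<kappa> ?e"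
        by (rule slobodeckij_sq_cong_AE[OF weak_deriv_Nil[OF dom(1) dloc]])
      have "sqrt (enn2real (slobodeckij_sq \<Omega> \<kappa> ?e)) \<le> sobolev_norm \<Omega> \<kappa> ?e"
        unfolding sobolev_norm_def fl using kappa
        by (intro real_sqrt_le_mono) (simp add: basis_words_simps eq)
      also have "\<dots> \<le> 1" using n by (simp add: d_def)
      finally have "enn2real (slobodeckij_sq \<Omega> \<kappa> ?e) \<le> 1" by simp
      then have "ennreal (enn2real (slobodeckij_sq \<Omega> \<kappa> ?e)) \<le> ennreal 1" by (rule ennreal_leI)
      then show ?thesis using Se_fin by simp
    qed
    have Sphi: "slobodeckij_sq \<Omega> \<kappa> (\<phi> n) \<le> ennreal 2 * slobodeckij_sq \<Omega> \<kappa> ?e + ennreal 2 * slobodeckij_sq \<Omega> \<kappa> p"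
    proof (rule slobodeckij_sq_combine[OF dom L2D(1)[OF dp] L2D(1)[OF pL]])
      fix x y
      have "0 \<le> ((?e x - ?e y) - (p x - p y))\<^sup>2" by simp
      then show "(\<phi> n x - \<phi> n y)\<^sup>2 \<le> 2 * (?e x - ?e y)\<^sup>2 + 2 * (p x - p y)\<^sup>2"
        by (simp add: power2_eq_square algebra_simps)
    qed auto
    have "slobodeckij_sq \<Omega> \<kappa> ?\<psi> \<le> ennreal (M\<^sup>2) * slobodeckij_sq \<Omega> \<kappa> (\<phi> n) + ennreal 0 * slobodeckij_sq \<Omega> \<kappa> (\<phi> n)"
    proof (rule slobodeckij_sq_combine[OF dom L2D(1)[OF L[OF sm]] L2D(1)[OF L[OF sm]]])
      fix x y
      have "\<bar>?\<psi> x - ?\<psi> y\<bar>\<^sup>2 \<le> (M * \<bar>\<phi> n x - \<phi> n y\<bar>)\<^sup>2"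
        by (intro power_mono smooth_bounded_deriv_lipschitz[OF T(1,4)]) auto
      then show "(?\<psi> x - ?\<psi> y)\<^sup>2 \<le> M\<^sup>2 * (\<phi> n x - \<phi> n y)\<^sup>2 + 0 * (\<phi> n x - \<phi> n y)\<^sup>2"
        by (simp add: power_mult_distrib)
    qed auto
    also have "\<dots> \<le> ennreal (M\<^sup>2) * (ennreal 2 * ennreal 1 + ennreal 2 * ennreal P)"
      using order_trans[OF Sphi add_right_mono[OF mult_left_mono[OF Se]]] by (simp add: P mult_left_mono)
    also have "\<dots> = ennreal S"
    proof -
      have "ennreal S = ennreal (M\<^sup>2) * ennreal (2 * 1 + 2 * P)"
        unfolding S_def by (subst ennreal_mult[symmetric]) (auto simp: P_def)
      also have "ennreal (2 * 1 + 2 * P) = ennreal (2 * 1) + ennreal (2 * P)"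
        by (rule ennreal_plus) (auto simp: P_def)
      also have "\<dots> = ennreal 2 * ennreal 1 + ennreal 2 * ennreal P"
        by (intro arg_cong2[of _ _ _ _ "(+)"] ennreal_mult) (auto simp: P_def)
      finally show ?thesis by (rule sym)
    qed
    finally have 2: "slobodeckij_sq \<Omega> \<kappa> ?\<psi> \<le> ennreal S" .
    show ?thesis
    proof (intro bexI[OF _ 0] conjI allI)
      show "\<bar>?\<psi> x\<bar> \<le> M" for x by (rule T(3))
    qed (rule 1, rule 2)
  qed
  ultimately show thesis by (rule that)
qed

subsection \<open>Mollification\<close>

text \<open>Subtracting the linear part at p leaves q with partial derivatives pd b g y - pd b g p,
  of size at most C r on the ball of radius r = |x - p|; the Lipschitz estimate there yields the
  square. Uniformity in p permits integration of the remainder.\<close>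

lemma smooth_taylor:
  fixes g :: "'a::euclidean_space \<Rightarrow> real"
  assumes "g \<in> test_functions UNIV"
  obtains K where "0 \<le> K" "\<And>x p. \<bar>g x - g p - (\<Sum>b\<in>Basis. ((x - p) \<bullet> b) * pd b g p)\<bar> \<le> K * (norm (x - p))\<^sup>2"
proof -
  have sm: "smooth g" using assms by (rule test_functionsE)
  have "\<exists>B. \<forall>x y. \<bar>pd b g x - pd b g y\<bar> \<le> B * norm (x - y)" if b: "b \<in> Basis" for b
    by (rule test_function_lipschitz[OF test_functions_pd[OF assms b]]) blast
  then obtain B where B: "\<And>b x y. b \<in> Basis \<Longrightarrow> \<bar>pd b g x - pd b g y\<bar> \<le> B b * norm (x - y)" by metis
  define C where "C = Max (insert 0 (B ` Basis))"
  have C0: "0 \<le> C" by (simp add: C_def)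
  have C: "\<bar>pd b g x - pd b g y\<bar> \<le> C * norm (x - y)" if "b \<in> Basis" for b x y
  proof -
    have "B b \<le> C" unfolding C_def using that by (intro Max_ge) auto
    then show ?thesis using that by (intro order_trans[OF B] mult_right_mono) auto
  qed
  have "\<bar>g x - g p - (\<Sum>b\<in>Basis. ((x - p) \<bullet> b) * pd b g p)\<bar> \<le> real DIM('a) * C * (norm (x - p))\<^sup>2" for x p
  proof -
    define r where "r = norm (x - p)"
    define q where "q y = g y - (\<Sum>b\<in>Basis. ((y - p) \<bullet> b) * pd b g p)" for y
    have qd: "(q has_derivative (\<lambda>v. frechet_derivative g (at y) v - (\<Sum>b\<in>Basis. (v \<bullet> b) * pd b g p))) (at y)" for y
      unfolding q_def by (auto intro!: derivative_eq_intros smooth_has_derivative[OF sm])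
    have qpd: "pd b q y = pd b g y - pd b g p" if b: "b \<in> Basis" for b y
    proof -
      have "pd b q y = pd b g y - (\<Sum>b'\<in>Basis. (b \<bullet> b') * pd b' g p)" by (rule pd_eqI[OF qd])
      also have "(\<Sum>b'\<in>Basis. (b \<bullet> b') * pd b' g p) = (\<Sum>b'\<in>Basis. if b' = b then pd b' g p else 0)"
        using b by (intro sum.cong) (auto simp: inner_Basis)
      finally show ?thesis using b by simp
    qed
    have "\<bar>q x - q p\<bar> \<le> real DIM('a) * (C * r) * norm (x - p)"
    proof (rule lipschitz_from_pd[of "cball p r"])
      show "q differentiable at y" for y using qd by (auto simp: differentiable_def)
      show "\<bar>pd b q y\<bar> \<le> C * r" if "y \<in> cball p r" "b \<in> Basis" for y b
        using that C0 unfolding qpd[OF that(2)]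
        by (intro order_trans[OF C] mult_left_mono) (auto simp: dist_norm norm_minus_commute)
    qed (auto simp: r_def dist_norm norm_minus_commute)
    then show ?thesis by (simp add: q_def r_def power2_eq_square algebra_simps)
  qed
  then show thesis using that[of "real DIM('a) * C"] C0 by simp
qed

lemma has_derivative_quadratic:
  fixes h :: "'a::euclidean_space \<Rightarrow> real"
  assumes "bounded_linear D" "\<And>y. \<bar>h y - h x - D (y - x)\<bar> \<le> K * (norm (y - x))\<^sup>2"
  shows "(h has_derivative D) (at x)"
proof (rule has_derivativeI_sandwich[of 1])
  show "((\<lambda>y. K * norm (y - x)) \<longlongrightarrow> 0) (at x)"
    by (rule tendsto_eq_intros refl | simp)+
  fix y assume "y \<noteq> x"
  then show "norm (h y - h x - D (y - x)) / norm (y - x) \<le> K * norm (y - x)"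
    using assms(2)[of y] by (simp add: divide_le_eq power2_eq_square mult.assoc)
qed (use assms in auto)

lemma convolution_integrable:
  fixes g :: "'a::euclidean_space \<Rightarrow> real"
  assumes f: "integrable lborel f" and g: "g \<in> test_functions UNIV"
  shows "integrable lborel (\<lambda>y. f y * g (c *\<^sub>R x + d *\<^sub>R y))"
proof -
  obtain B where B: "0 \<le> B" "\<And>z. \<bar>g z\<bar> \<le> B" using test_function_bounded[OF g] by metis
  have "smooth g" using g by (rule test_functionsE)
  then have [measurable]: "g \<in> borel_measurable borel" by (rule smooth_borel_measurable)
  have [measurable]: "f \<in> borel_measurable borel" using f by auto
  show ?thesis
  proof (rule Bochner_Integration.integrable_bound[OF integrable_mult_right[OF f, of B]])
    show "(\<lambda>y. f y * g (c *\<^sub>R x + d *\<^sub>R y)) \<in> borel_measurable lborel" by measurable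
    show "AE y in lborel. norm (f y * g (c *\<^sub>R x + d *\<^sub>R y)) \<le> norm (B * f y)"
      using B by (intro AE_I2) (auto simp: abs_mult mult.commute[of B] intro!: mult_left_mono)
  qed
qed

text \<open>The quadratic remainder, uniform in y, is integrated against |f|, which gives the
  derivative directly. \<open>h\<close> is abstracted over the kernel, so each partial derivative is
  the same construction with kernel \<open>pd b g\<close> and factor c.\<close>

lemma convolution_derivative:
  fixes g :: "'a::euclidean_space \<Rightarrow> real" and c d :: real
  assumes f: "integrable lborel f" and g: "g \<in> test_functions UNIV"
  defines "h \<equiv> \<lambda>G x. LINT y|lborel. f y * G (c *\<^sub>R x + d *\<^sub>R y)"
  shows "h g differentiable at x" "b \<in> Basis \<Longrightarrow> pd b (h g) x = c * h (pd b g) x"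
proof -
  obtain K where K: "0 \<le> K" "\<And>x p. \<bar>g x - g p - (\<Sum>b\<in>Basis. ((x - p) \<bullet> b) * pd b g p)\<bar> \<le> K * (norm (x - p))\<^sup>2"
    by (rule smooth_taylor[OF g]) (rule that)
  define D where "D v = (\<Sum>b\<in>Basis. (v \<bullet> b) * (c * h (pd b g) x))" for v
  note i0 = convolution_integrable[OF f g] and ib = convolution_integrable[OF f test_functions_pd[OF g]]
  have "(h g has_derivative D) (at x)"
  proof (rule has_derivative_quadratic)
    show "bounded_linear D" unfolding D_def
      by (intro bounded_linear_sum bounded_linear_mult_left[THEN bounded_linear_compose] bounded_linear_inner_left)
    fix x' :: 'a
    let ?p = "\<lambda>y::'a. c *\<^sub>R x + d *\<^sub>R y" and ?p' = "\<lambda>y::'a. c *\<^sub>R x' + d *\<^sub>R y"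
    let ?r = "\<lambda>y. g (?p' y) - g (?p y) - (\<Sum>b\<in>Basis. ((?p' y - ?p y) \<bullet> b) * pd b g (?p y))"
    have pp: "?p' y - ?p y = c *\<^sub>R (x' - x)" for y by (simp add: algebra_simps)
    have isum: "integrable lborel (\<lambda>y. \<Sum>b\<in>Basis. ((x' - x) \<bullet> b) * (c * (f y * pd b g (?p y))))"
      by (intro Bochner_Integration.integrable_sum integrable_mult_right ib) auto
    have "D (x' - x) = (\<Sum>b\<in>Basis. LINT y|lborel. ((x' - x) \<bullet> b) * (c * (f y * pd b g (?p y))))"
      by (simp add: D_def h_def)
    also have "\<dots> = (LINT y|lborel. (\<Sum>b\<in>Basis. ((x' - x) \<bullet> b) * (c * (f y * pd b g (?p y)))))"
      by (intro Bochner_Integration.integral_sum[symmetric] integrable_mult_right ib) auto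
    finally have "h g x' - h g x - D (x' - x) = (LINT y|lborel. f y * g (?p' y) - f y * g (?p y)
        - (\<Sum>b\<in>Basis. ((x' - x) \<bullet> b) * (c * (f y * pd b g (?p y)))))"
      using i0 isum by (simp add: h_def)
    also have "\<dots> = (LINT y|lborel. f y * ?r y)"
      unfolding pp by (intro Bochner_Integration.integral_cong refl) (simp add: algebra_simps sum_distrib_left)
    finally have E: "h g x' - h g x - D (x' - x) = (LINT y|lborel. f y * ?r y)" .
    have le: "\<bar>LINT y|lborel. f y * ?r y\<bar> \<le> (LINT y|lborel. \<bar>f y\<bar> * (K * (c\<^sup>2 * (norm (x' - x))\<^sup>2)))"
    proof (rule integral_abs_le)
      show "integrable lborel (\<lambda>y. \<bar>f y\<bar> * (K * (c\<^sup>2 * (norm (x' - x))\<^sup>2)))"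
        using f by (intro integrable_mult_left integrable_abs)
      show "AE y in lborel. \<bar>f y * ?r y\<bar> \<le> \<bar>f y\<bar> * (K * (c\<^sup>2 * (norm (x' - x))\<^sup>2))"
      proof (rule AE_I2)
        fix y
        have "\<bar>?r y\<bar> \<le> K * (norm (?p' y - ?p y))\<^sup>2" by (rule K(2))
        also have "\<dots> = K * (c\<^sup>2 * (norm (x' - x))\<^sup>2)" unfolding pp by (simp add: power_mult_distrib)
        finally show "\<bar>f y * ?r y\<bar> \<le> \<bar>f y\<bar> * (K * (c\<^sup>2 * (norm (x' - x))\<^sup>2))"
          unfolding abs_mult by (rule mult_left_mono) simp
      qed
    qed
    have "(LINT y|lborel. \<bar>f y\<bar> * (K * (c\<^sup>2 * (norm (x' - x))\<^sup>2)))
        = (LINT y|lborel. \<bar>f y\<bar>) * K * c\<^sup>2 * (norm (x' - x))\<^sup>2"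
      unfolding Bochner_Integration.integral_mult_left_zero by (simp only: mult.assoc)
    then show "\<bar>h g x' - h g x - D (x' - x)\<bar> \<le> (LINT y|lborel. \<bar>f y\<bar>) * K * c\<^sup>2 * (norm (x' - x))\<^sup>2"
      using le unfolding E by (rule subst)
  qed
  note der = this
  show "h g differentiable at x" using der by (auto simp: differentiable_def)
  show "pd b (h g) x = c * h (pd b g) x" if b: "b \<in> Basis"
  proof -
    have "pd b (h g) x = (\<Sum>b'\<in>Basis. (b \<bullet> b') * (c * h (pd b' g) x))"
      using pd_eqI[OF der, of b] by (simp add: D_def)
    also have "\<dots> = (\<Sum>b'\<in>Basis. if b' = b then c * h (pd b' g) x else 0)"
      using b by (intro sum.cong) (auto simp: inner_Basis)
    finally show ?thesis using b by simp
  qed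
qed

text \<open>Differentiation keeps the form of a convolution with a test function, so the induction
  on the order runs over all kernels.\<close>

lemma convolution_smooth:
  fixes g :: "'a::euclidean_space \<Rightarrow> real"
  assumes f: "integrable lborel f" and g: "g \<in> test_functions UNIV"
  shows "smooth (\<lambda>x. LINT y|lborel. f y * g (c *\<^sub>R x + d *\<^sub>R y))"
proof -
  have "C_k k (\<lambda>x. LINT y|lborel. f y * g (c *\<^sub>R x + d *\<^sub>R y))" for k
    using g
  proof (induction k arbitrary: g)
    case 0
    then show ?case
      using convolution_derivative(1)[OF f 0, where c = c and d = d]
      by (auto intro!: continuous_at_imp_continuous_on differentiable_imp_continuous_within)
  next
    case (Suc k)
    note cd = convolution_derivative[OF f Suc.prems, where c = c and d = d]
    have "C_k k (pd b (\<lambda>x. LINT y|lborel. f y * g (c *\<^sub>R x + d *\<^sub>R y)))" if b: "b \<in> Basis" for b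
      unfolding cd(2)[OF b] by (intro C_k_mult C_k_const Suc.IH test_functions_pd[OF Suc.prems b])
    then show ?case unfolding C_k.simps using cd(1) by blast
  qed
  then show ?thesis by (simp add: smooth_def)
qed

section \<open>Rescaled kernels and the modulus of continuity in L2\<close>

text \<open>Substitution y = x - \<epsilon> z with Jacobian \<epsilon>^DIM.\<close>

lemma integral_rescale:
  fixes g :: "'a::euclidean_space \<Rightarrow> real"
  assumes "g \<in> borel_measurable borel" "0 < \<epsilon>"
  shows "(LINT y|lborel. g ((1 / \<epsilon>) *\<^sub>R x + (- (1 / \<epsilon>)) *\<^sub>R y)) = \<epsilon> ^ DIM('a) * (LINT z|lborel. g z)"
proof -
  have [measurable]: "g \<in> borel_measurable borel" by (rule assms(1))
  have aff: "lborel = density (distr lborel borel (\<lambda>z. x + (- \<epsilon>) *\<^sub>R z)) (\<lambda>_. ennreal (\<bar>- \<epsilon>\<bar> ^ DIM('a)))"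
    by (rule lborel_affine) (use assms(2) in simp)
  have "(LINT y|lborel. g ((1 / \<epsilon>) *\<^sub>R x + (- (1 / \<epsilon>)) *\<^sub>R y))
    = (LINT y|density (distr lborel borel (\<lambda>z. x + (- \<epsilon>) *\<^sub>R z)) (\<lambda>_. ennreal (\<bar>- \<epsilon>\<bar> ^ DIM('a))). g ((1 / \<epsilon>) *\<^sub>R x + (- (1 / \<epsilon>)) *\<^sub>R y))"
    using arg_cong[OF aff, of "\<lambda>M. LINT y|M. g ((1 / \<epsilon>) *\<^sub>R x + (- (1 / \<epsilon>)) *\<^sub>R y)"] .
  also have "\<dots> = (LINT z|lborel. \<epsilon> ^ DIM('a) * g ((1 / \<epsilon>) *\<^sub>R x + (- (1 / \<epsilon>)) *\<^sub>R (x + (- \<epsilon>) *\<^sub>R z)))"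
    using assms(2) by (subst integral_density) (auto simp: integral_distr)
  also have "\<dots> = (LINT z|lborel. \<epsilon> ^ DIM('a) * g z)"
    using assms(2) by (intro Bochner_Integration.integral_cong refl) (simp add: algebra_simps)
  finally show ?thesis by simp
qed

text \<open>Cauchy-Schwarz on the ball of radius \<epsilon> that carries the kernel. Stated for
  increments f y - f x so that one bound serves the mollification error and, since derivatives of
  the mollifier have mean 0, also the gradient.\<close>

lemma convolution_difference_bound:
  fixes g :: "'a::euclidean_space \<Rightarrow> real"
  assumes f: "f \<in> borel_measurable borel" and g: "g \<in> borel_measurable borel" "\<And>z. \<bar>g z\<bar> \<le> K" "\<And>z. 1 < norm z \<Longrightarrow> g z = 0"
    and eps: "0 < \<epsilon>"
  shows "ennreal ((LINT y|lborel. (f y - f x) * g ((1 / \<epsilon>) *\<^sub>R x + (- (1 / \<epsilon>)) *\<^sub>R y))\<^sup>2)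
    \<le> ennreal (K\<^sup>2 * (unit_ball_vol (real DIM('a)) * \<epsilon> ^ DIM('a)))
      * (\<integral>\<^sup>+y. ennreal ((f y - f x)\<^sup>2) * indicator (cball x \<epsilon>) y \<partial>lborel)"
proof -
  have [measurable]: "f \<in> borel_measurable borel" "g \<in> borel_measurable borel" by (rule f g(1))+
  have [measurable]: "cball x \<epsilon> \<in> sets borel" by simp
  let ?g = "\<lambda>y. g ((1 / \<epsilon>) *\<^sub>R x + (- (1 / \<epsilon>)) *\<^sub>R y)"
  let ?I = "LINT y|lborel. (f y - f x) * ?g y"
  let ?a = "\<lambda>y. ennreal \<bar>f y - f x\<bar> * indicator (cball x \<epsilon>) y" and ?b = "\<lambda>y. ennreal K * indicator (cball x \<epsilon>) y"
  have K: "0 \<le> K" using g(2)[of 0] by simp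
  have g0: "?g y = 0" if "y \<notin> cball x \<epsilon>" for y
  proof (rule g(3))
    have "(1 / \<epsilon>) *\<^sub>R x + (- (1 / \<epsilon>)) *\<^sub>R y = (1 / \<epsilon>) *\<^sub>R (x - y)" by (simp add: algebra_simps)
    then show "1 < norm ((1 / \<epsilon>) *\<^sub>R x + (- (1 / \<epsilon>)) *\<^sub>R y)" using that eps by (simp add: dist_norm)
  qed
  have "ennreal \<bar>?I\<bar> \<le> (\<integral>\<^sup>+y. ?a y * ?b y \<partial>lborel)"
  \<comment> \<open>In the other case the Bochner integral is 0 and nothing is to be shown.\<close>
  proof (cases "integrable lborel (\<lambda>y. (f y - f x) * ?g y)")
    case True
    have "ennreal (norm ?I) \<le> (\<integral>\<^sup>+y. ennreal (norm ((f y - f x) * ?g y)) \<partial>lborel)"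
      by (rule integral_norm_bound_ennreal[OF True])
    also have "\<dots> \<le> (\<integral>\<^sup>+y. ?a y * ?b y \<partial>lborel)"
    proof (rule nn_integral_mono)
      fix y
      show "ennreal (norm ((f y - f x) * ?g y)) \<le> ?a y * ?b y"
      proof (cases "y \<in> cball x \<epsilon>")
        case c: True
        have "ennreal (norm ((f y - f x) * ?g y)) \<le> ennreal (\<bar>f y - f x\<bar> * K)"
          using g(2) by (intro ennreal_leI) (auto simp: abs_mult intro!: mult_left_mono)
        also have "\<dots> = ennreal \<bar>f y - f x\<bar> * ennreal K" by (intro ennreal_mult K) simp
        finally show ?thesis using c by simp
      qed (use g0 in simp)
    qed
    finally show ?thesis by simp
  qed (simp add: not_integrable_integral_eq)
  then have "(ennreal \<bar>?I\<bar>)\<^sup>2 \<le> (\<integral>\<^sup>+y. ?a y * ?b y \<partial>lborel)\<^sup>2" by (rule power_mono) simp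
  also have "\<dots> \<le> (\<integral>\<^sup>+y. (?a y)\<^sup>2 \<partial>lborel) * (\<integral>\<^sup>+y. (?b y)\<^sup>2 \<partial>lborel)"
    by (rule Cauchy_Schwarz_nn_integral) measurable
  also have "(\<integral>\<^sup>+y. (?a y)\<^sup>2 \<partial>lborel) = (\<integral>\<^sup>+y. ennreal ((f y - f x)\<^sup>2) * indicator (cball x \<epsilon>) y \<partial>lborel)"
    by (intro nn_integral_cong) (auto simp: indicator_def ennreal_power)
  also have "(\<integral>\<^sup>+y. (?b y)\<^sup>2 \<partial>lborel) = (\<integral>\<^sup>+y. ennreal (K\<^sup>2) * indicator (cball x \<epsilon>) y \<partial>lborel)"
    using K by (intro nn_integral_cong) (auto simp: indicator_def ennreal_power)
  also have "\<dots> = ennreal (K\<^sup>2) * emeasure lborel (cball x \<epsilon>)"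
    by (rule nn_integral_cmult_indicator) simp
  also have "\<dots> = ennreal (K\<^sup>2 * (unit_ball_vol (real DIM('a)) * \<epsilon> ^ DIM('a)))"
    using eps by (subst emeasure_cball) (auto simp: ennreal_mult)
  also have "(ennreal \<bar>?I\<bar>)\<^sup>2 = ennreal (?I\<^sup>2)" by (simp add: ennreal_power)
  finally show ?thesis by (simp add: mult.commute)
qed

text \<open>The truncation \<open>f\<close> of \<open>\<phi>\<close> to the complement of a boundary layer inherits the modulus of continuity in \<open>L2\<close>
  from the Slobodeckij seminorm, up to the energy of \<open>\<phi>\<close> in a slightly thicker layer.\<close>

lemma truncated_modulus:
  fixes \<phi> :: "'a::euclidean_space \<Rightarrow> real" and \<epsilon> :: real
  assumes dom: "open \<Omega>" "bounded \<Omega>" and phi: "\<phi> \<in> borel_measurable borel" and kappa: "0 < \<kappa>" and eps: "0 < \<epsilon>"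
  defines "f \<equiv> \<lambda>x. if 2 * \<epsilon> \<le> infdist x (- \<Omega>) then \<phi> x else 0"
  shows "(\<integral>\<^sup>+x. (\<integral>\<^sup>+y. ennreal ((f y - f x)\<^sup>2) * indicator (cball x \<epsilon>) y \<partial>lborel) \<partial>lborel)
    \<le> ennreal (\<epsilon> powr (real DIM('a) + 2 * \<kappa>)) * slobodeckij_sq \<Omega> \<kappa> \<phi>
      + 2 * (ennreal (unit_ball_vol (real DIM('a)) * \<epsilon> ^ DIM('a)) * layer_energy \<Omega> \<phi> (4 * \<epsilon>))"
proof -
  have [measurable]: "\<phi> \<in> borel_measurable borel" by (rule phi)
  have [measurable]: "\<Omega> \<in> sets borel" "layer \<Omega> (4 * \<epsilon>) \<in> sets borel" using dom(1) open_layer[OF dom(1), of "4 * \<epsilon>"] by simp_all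
  let ?V = "ennreal (unit_ball_vol (real DIM('a)) * \<epsilon> ^ DIM('a))"
  let ?P = "ennreal (\<epsilon> powr (real DIM('a) + 2 * \<kappa>))"
  define e where "e x = ennreal ((\<phi> x)\<^sup>2) * indicator (layer \<Omega> (4 * \<epsilon>)) x" for x
  have le: "layer_energy \<Omega> \<phi> (4 * \<epsilon>) = (\<integral>\<^sup>+x. e x \<partial>lborel)" by (simp add: layer_energy_def e_def)
  define c where "c x y = (if dist x y \<le> \<epsilon> then 1 else 0 :: ennreal)" for x y :: 'a
  have em[measurable]: "e \<in> borel_measurable borel" unfolding e_def by measurable
  have cm: "(\<lambda>(x, y). c x y) \<in> borel_measurable (borel \<Otimes>\<^sub>M borel)" unfolding c_def by measurable
  have cm1[measurable]: "c x \<in> borel_measurable borel" for x unfolding c_def by measurable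
  have cV: "(\<integral>\<^sup>+y. c x y \<partial>lborel) = ?V" for x
  proof -
    have "(\<integral>\<^sup>+y. c x y \<partial>lborel) = (\<integral>\<^sup>+y. indicator (cball x \<epsilon>) y \<partial>lborel)"
      by (intro nn_integral_cong) (auto simp: c_def indicator_def)
    then show ?thesis using eps by (simp add: emeasure_cball)
  qed
  have inO: "x \<in> \<Omega>" if "0 < infdist x (- \<Omega>)" for x
    using that by (metis ComplI infdist_zero less_irrefl)
  let ?k = "\<lambda>x y. slob_kernel \<kappa> \<phi> x y * indicator \<Omega> y"
  \<comment> \<open>If both points are retained the kernel pays for the increment. If exactly one
    is, its distance to the complement lies between 2 \<epsilon> and 3 \<epsilon>, so it belongs to
    the layer of height 4 \<epsilon> and its own value is charged to \<open>e\<close>.\<close>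
  have pt: "ennreal ((f y - f x)\<^sup>2) * indicator (cball x \<epsilon>) y \<le> ?P * (?k x y * indicator \<Omega> x) + (e x * c x y + e y * c x y)" for x y
  proof (cases "y \<in> cball x \<epsilon>")
    case True
    then have d: "dist x y \<le> \<epsilon>" "c x y = 1" by (auto simp: c_def)
    have inf: "infdist x (- \<Omega>) \<le> infdist y (- \<Omega>) + \<epsilon>" "infdist y (- \<Omega>) \<le> infdist x (- \<Omega>) + \<epsilon>"
      using infdist_triangle[of x "- \<Omega>" y] infdist_triangle[of y "- \<Omega>" x] d(1) by (auto simp: dist_commute)
    consider "2 * \<epsilon> \<le> infdist x (- \<Omega>)" "2 * \<epsilon> \<le> infdist y (- \<Omega>)"
      | "2 * \<epsilon> \<le> infdist x (- \<Omega>)" "\<not> 2 * \<epsilon> \<le> infdist y (- \<Omega>)"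
      | "\<not> 2 * \<epsilon> \<le> infdist x (- \<Omega>)" "2 * \<epsilon> \<le> infdist y (- \<Omega>)"
      | "\<not> 2 * \<epsilon> \<le> infdist x (- \<Omega>)" "\<not> 2 * \<epsilon> \<le> infdist y (- \<Omega>)" by blast
    then show ?thesis
    proof cases
      case 1
      then have o: "x \<in> \<Omega>" "y \<in> \<Omega>" using eps by (auto intro!: inO)
      have "(f y - f x)\<^sup>2 = (\<phi> x - \<phi> y)\<^sup>2" using 1 by (simp add: f_def power2_commute)
      also have "\<dots> \<le> \<epsilon> powr (real DIM('a) + 2 * \<kappa>) * ((\<phi> x - \<phi> y)\<^sup>2 / norm (x - y) powr (real DIM('a) + 2 * \<kappa>))"
        using d(1) kappa eps by (intro difference_sq_le_kernel) (auto simp: dist_norm)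
      finally have "ennreal ((f y - f x)\<^sup>2) \<le> ennreal (\<epsilon> powr (real DIM('a) + 2 * \<kappa>) * ((\<phi> x - \<phi> y)\<^sup>2 / norm (x - y) powr (real DIM('a) + 2 * \<kappa>)))"
        by (rule ennreal_leI)
      also have "\<dots> = ?P * slob_kernel \<kappa> \<phi> x y" by (rule ennreal_mult) auto
      finally have "ennreal ((f y - f x)\<^sup>2) \<le> ?P * slob_kernel \<kappa> \<phi> x y" .
      then show ?thesis using o True by (simp add: add_increasing2)
    next
      case 2
      then have "x \<in> layer \<Omega> (4 * \<epsilon>)" using eps inf by (auto simp: layer_def intro!: inO)
      then have "ennreal ((f y - f x)\<^sup>2) * indicator (cball x \<epsilon>) y = e x * c x y" using 2 True d(2) by (simp add: f_def e_def)
      then show ?thesis by (simp add: add_increasing add_increasing2)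
    next
      case 3
      then have "y \<in> layer \<Omega> (4 * \<epsilon>)" using eps inf by (auto simp: layer_def intro!: inO)
      then have "ennreal ((f y - f x)\<^sup>2) * indicator (cball x \<epsilon>) y = e y * c x y" using 3 True d(2) by (simp add: f_def e_def)
      then show ?thesis by (simp add: add_increasing)
    next
      case 4
      then show ?thesis by (simp add: f_def)
    qed
  qed simp
  have km: "(\<lambda>(x, y). ?k x y) \<in> borel_measurable (borel \<Otimes>\<^sub>M borel)" by measurable
  have km1[measurable]: "?k x \<in> borel_measurable borel" for x by measurable
  have ecm: "(\<lambda>(x, y). e y * c x y) \<in> borel_measurable (borel \<Otimes>\<^sub>M borel)" using cm em by measurable
  have "(\<integral>\<^sup>+x. (\<integral>\<^sup>+y. ennreal ((f y - f x)\<^sup>2) * indicator (cball x \<epsilon>) y \<partial>lborel) \<partial>lborel)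
    \<le> (\<integral>\<^sup>+x. (\<integral>\<^sup>+y. ?P * (?k x y * indicator \<Omega> x) + (e x * c x y + e y * c x y) \<partial>lborel) \<partial>lborel)"
    by (intro nn_integral_mono pt)
  also have "\<dots> = (\<integral>\<^sup>+x. ?P * ((\<integral>\<^sup>+y. ?k x y \<partial>lborel) * indicator \<Omega> x) + (?V * e x + (\<integral>\<^sup>+y. e y * c x y \<partial>lborel)) \<partial>lborel)"
  proof (rule nn_integral_cong)
    fix x :: 'a
    have m1: "(\<lambda>y. e y * c x y) \<in> borel_measurable lborel" by measurable
    have m2: "?k x \<in> borel_measurable lborel" using km1[of x] by simp
    have m3: "c x \<in> borel_measurable lborel" using cm1[of x] by simp
    have "(\<integral>\<^sup>+y. ?P * (?k x y * indicator \<Omega> x) + (e x * c x y + e y * c x y) \<partial>lborel)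
      = (\<integral>\<^sup>+y. ?P * (?k x y * indicator \<Omega> x) \<partial>lborel) + (\<integral>\<^sup>+y. e x * c x y + e y * c x y \<partial>lborel)"
      using m1 m2 m3 by (intro nn_integral_add) auto
    also have "(\<integral>\<^sup>+y. e x * c x y + e y * c x y \<partial>lborel) = (\<integral>\<^sup>+y. e x * c x y \<partial>lborel) + (\<integral>\<^sup>+y. e y * c x y \<partial>lborel)"
      using m1 m3 by (intro nn_integral_add) auto
    also have "(\<integral>\<^sup>+y. e x * c x y \<partial>lborel) = ?V * e x" using m3 by (simp add: nn_integral_cmult cV mult.commute)
    also have "(\<integral>\<^sup>+y. ?P * (?k x y * indicator \<Omega> x) \<partial>lborel) = ?P * ((\<integral>\<^sup>+y. ?k x y \<partial>lborel) * indicator \<Omega> x)"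
      using m2 by (simp add: nn_integral_cmult nn_integral_multc)
    finally show "(\<integral>\<^sup>+y. ?P * (?k x y * indicator \<Omega> x) + (e x * c x y + e y * c x y) \<partial>lborel)
      = ?P * ((\<integral>\<^sup>+y. ?k x y \<partial>lborel) * indicator \<Omega> x) + (?V * e x + (\<integral>\<^sup>+y. e y * c x y \<partial>lborel))" .
  qed
  also have "\<dots> = ?P * slobodeckij_sq \<Omega> \<kappa> \<phi> + (?V * layer_energy \<Omega> \<phi> (4 * \<epsilon>) + (\<integral>\<^sup>+x. (\<integral>\<^sup>+y. e y * c x y \<partial>lborel) \<partial>lborel))"
  proof -
    have m1: "(\<lambda>x. \<integral>\<^sup>+y. e y * c x y \<partial>lborel) \<in> borel_measurable lborel"
      using ecm by (intro lborel.borel_measurable_nn_integral) simp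
    have m2: "(\<lambda>x. \<integral>\<^sup>+y. ?k x y \<partial>lborel) \<in> borel_measurable lborel"
      using km by (intro lborel.borel_measurable_nn_integral) simp
    have m3: "(\<lambda>x. (\<integral>\<^sup>+y. ?k x y \<partial>lborel) * indicator \<Omega> x) \<in> borel_measurable lborel"
      using m2 by measurable
    have m4: "e \<in> borel_measurable lborel" by simp
    show ?thesis unfolding slobodeckij_sq_lborel[OF dom(1)] le
      using m1 m3 m4 by (subst nn_integral_add, simp, simp, subst nn_integral_add) (simp_all add: nn_integral_cmult)
  qed
  finally have T1: "(\<integral>\<^sup>+x. (\<integral>\<^sup>+y. ennreal ((f y - f x)\<^sup>2) * indicator (cball x \<epsilon>) y \<partial>lborel) \<partial>lborel)
    \<le> ?P * slobodeckij_sq \<Omega> \<kappa> \<phi> + (?V * layer_energy \<Omega> \<phi> (4 * \<epsilon>) + (\<integral>\<^sup>+x. (\<integral>\<^sup>+y. e y * c x y \<partial>lborel) \<partial>lborel))" .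
  \<comment> \<open>By symmetry of \<open>c\<close> this is a second copy of the layer term; hence
    the factor 2.\<close>
  have "(\<integral>\<^sup>+x. (\<integral>\<^sup>+y. e y * c x y \<partial>lborel) \<partial>lborel) = (\<integral>\<^sup>+y. (\<integral>\<^sup>+x. e y * c x y \<partial>lborel) \<partial>lborel)"
    using lborel_pair.Fubini'[of "\<lambda>x y. e y * c x y"] ecm by simp
  also have "\<dots> = (\<integral>\<^sup>+y. ?V * e y \<partial>lborel)"
  proof (rule nn_integral_cong)
    fix y
    have "(\<integral>\<^sup>+x. e y * c x y \<partial>lborel) = (\<integral>\<^sup>+x. e y * c y x \<partial>lborel)" by (simp add: c_def dist_commute)
    also have "\<dots> = ?V * e y" using cm1[of y] by (simp add: nn_integral_cmult cV mult.commute)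
    finally show "(\<integral>\<^sup>+x. e y * c x y \<partial>lborel) = ?V * e y" .
  qed
  also have "\<dots> = ?V * layer_energy \<Omega> \<phi> (4 * \<epsilon>)" unfolding le by (rule nn_integral_cmult) simp
  finally have T2: "(\<integral>\<^sup>+x. (\<integral>\<^sup>+y. e y * c x y \<partial>lborel) \<partial>lborel) = ?V * layer_energy \<Omega> \<phi> (4 * \<epsilon>)" .
  show ?thesis using T1 unfolding T2 by (simp only: mult_2)
qed

lemma L2_norm_le_nn_integral:
  assumes "open \<Omega>" "h \<in> L2 \<Omega>" "0 \<le> c" "(\<integral>\<^sup>+x. ennreal ((h x)\<^sup>2) * indicator \<Omega> x \<partial>lborel) \<le> ennreal (c\<^sup>2)"
  shows "L2_norm \<Omega> h \<le> c"
proof -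
  have "ennreal ((L2_norm \<Omega> h)\<^sup>2) = (\<integral>\<^sup>+x. ennreal ((h x)\<^sup>2) \<partial>lebesgue_on \<Omega>)"
    using nn_integral_eq_integral[OF L2D(2)[OF assms(2)]] by (simp add: L2_norm_sq power2_eq_square[of "h _"])
  also have "\<dots> \<le> ennreal (c\<^sup>2)" using assms(1,4) by (simp add: nn_integral_lebesgue_on)
  finally have "(L2_norm \<Omega> h)\<^sup>2 \<le> c\<^sup>2" by simp
  then show ?thesis using assms(3) by (rule power2_le_imp_le)
qed

section \<open>The mollified approximants\<close>

text \<open>Left unnormalised; its mass is divided out together with \<epsilon>^DIM. The inner
  product instead of the norm makes smoothness evident.\<close>

definition mollifier :: "'a::euclidean_space \<Rightarrow> real" where
  "mollifier z = exp_bump (1 - z \<bullet> z)"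

lemma mollifier_zero: "1 \<le> norm z \<Longrightarrow> mollifier z = 0"
  using power_mono[of 1 "norm z" 2] by (simp add: mollifier_def exp_bump_nonpos power2_norm_eq_inner)

lemma mollifier_nonneg: "0 \<le> mollifier z"
  by (simp add: mollifier_def exp_bump_nonneg)

lemma mollifier_test: "mollifier \<in> test_functions (UNIV :: 'a::euclidean_space set)"
proof (rule test_functionsI[of _ "cball 0 1"])
  have "smooth (\<lambda>z::'a. \<Sum>b\<in>Basis. (z \<bullet> b) * (z \<bullet> b))"
    by (intro smooth_sum smooth_mult smooth_inner) auto
  then have "smooth (\<lambda>z::'a. z \<bullet> z)" by (simp add: euclidean_inner[of _ _, where 'a = 'a, symmetric])
  then show "smooth (mollifier :: 'a \<Rightarrow> real)"
    unfolding mollifier_def[abs_def] by (intro smooth_compose[OF smooth_exp_bump] smooth_diff smooth_const)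
qed (auto intro: mollifier_zero)

text \<open>A vanishing integral would make the unit ball a null set, since the mollifier is
  positive inside it.\<close>

lemma mollifier_integral_pos: "0 < (LINT z|lborel. mollifier (z :: 'a::euclidean_space))"
proof -
  have t: "smooth (mollifier :: 'a \<Rightarrow> real)" using mollifier_test by (rule test_functionsE)
  have int: "integrable lborel (mollifier :: 'a \<Rightarrow> real)"
    by (rule compact_support_integrable[OF smooth_continuous_on[OF t] compact_cball[of 0 1]]) (auto intro: mollifier_zero)
  have "0 \<noteq> (LINT z|lborel. mollifier (z :: 'a))"
  proof
    assume "0 = (LINT z|lborel. mollifier (z :: 'a))"
    then have "AE z in lborel. mollifier (z :: 'a) = 0"
      using integral_nonneg_eq_0_iff_AE[OF int] mollifier_nonneg by auto
    then have "AE z in lborel. (z :: 'a) \<notin> ball 0 1"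
    proof eventually_elim
      case (elim z)
      show ?case
      proof
        assume "z \<in> ball 0 1"
        then have "norm z < 1" by simp
        then have "(norm z)\<^sup>2 < 1" by (simp add: power_less_one_iff)
        then have "0 < mollifier z" unfolding mollifier_def by (intro exp_bump_pos) (simp add: power2_norm_eq_inner)
        then show False using elim by simp
      qed
    qed
    then have "ball (0::'a) 1 \<in> null_sets lborel"
      by (subst (asm) AE_iff_null_sets[symmetric]) auto
    then show False using emeasure_ball[of 1 "0::'a"] unit_ball_vol_pos[of "real DIM('a)"]
      by (auto simp: null_sets_def)
  qed
  moreover have "0 \<le> (LINT z|lborel. mollifier (z :: 'a))" by (rule Bochner_Integration.integral_nonneg) (rule mollifier_nonneg)
  ultimately show ?thesis by simp
qed

text \<open>F averages the truncation f over balls of radius \<epsilon>, which preserves the bound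
  M. Both F - f and the partial derivatives of F are integrals of increments of f against a kernel
  on these balls, so one modulus of continuity controls both, with an extra 1 / \<epsilon> for the
  gradient. The constant is fixed before \<phi> and \<epsilon>.\<close>

lemma mollified_approx:
  fixes \<Omega> :: "'a::euclidean_space set"
  assumes dom: "open \<Omega>" "bounded \<Omega>" and kappa: "0 < \<kappa>" "\<kappa> < 1"
    and A: "0 \<le> A" and Q: "0 \<le> S"
  shows "\<exists>C\<ge>0. \<forall>\<phi>\<in>test_functions \<Omega>. \<forall>\<epsilon>>0. (\<forall>x. \<bar>\<phi> x\<bar> \<le> M) \<longrightarrow> slobodeckij_sq \<Omega> \<kappa> \<phi> \<le> ennreal S \<longrightarrow>
      layer_energy \<Omega> \<phi> (4 * \<epsilon>) \<le> ennreal (A * \<epsilon> powr (2 * \<kappa>)) \<longrightarrow>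
      (\<exists>F\<in>test_functions \<Omega>. (\<forall>x. \<bar>F x\<bar> \<le> M) \<and> L2_norm \<Omega> (\<lambda>x. \<phi> x - F x) \<le> C * \<epsilon> powr \<kappa> \<and>
        (\<Sum>b\<in>Basis. L2_norm \<Omega> (pd b F)) \<le> C * \<epsilon> powr (\<kappa> - 1))"
proof -
  let ?\<eta> = "mollifier :: 'a \<Rightarrow> real"
  define I where "I = (LINT z|lborel. ?\<eta> z)"
  have I: "0 < I" unfolding I_def by (rule mollifier_integral_pos)
  have "\<exists>B. \<forall>z. \<bar>pd b ?\<eta> z\<bar> \<le> B" if b: "b \<in> Basis" for b
    using test_function_bounded[OF test_functions_pd[OF mollifier_test b]] by metis
  then obtain B where B: "\<And>b z. b \<in> Basis \<Longrightarrow> \<bar>pd b ?\<eta> z\<bar> \<le> B b" by metis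
  obtain B0 where B0: "\<And>z. \<bar>?\<eta> z\<bar> \<le> B0" using test_function_bounded[OF mollifier_test] by metis
  define K where "K = Max (insert B0 (B ` Basis))"
  have KB: "k \<le> K" if "k \<in> insert B0 (B ` Basis)" for k
    unfolding K_def using that by (intro Max_ge) auto
  have K1: "\<bar>?\<eta> z\<bar> \<le> K" for z using B0[of z] KB[of B0] by simp
  have K2: "\<bar>pd b ?\<eta> z\<bar> \<le> K" if "b \<in> Basis" for b z using B[OF that, of z] KB[of "B b"] that by simp
  have K0: "0 \<le> K" using K1[of 0] by simp
  define \<omega> where "\<omega> = unit_ball_vol (real DIM('a))"
  have w: "0 \<le> \<omega>" by (simp add: \<omega>_def)
  \<comment> \<open>S from pairs of retained points, 2 \<omega> A from the layer, after the common
    factor \<epsilon>^DIM * \<epsilon> powr (2 * \<kappa>) is removed.\<close>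
  define c3 where "c3 = S + 2 * \<omega> * A"
  have c3: "0 \<le> c3" using A Q w by (simp add: c3_def)
  define C0 where "C0 = sqrt (K\<^sup>2 * \<omega> * c3) / I"
  have C0: "0 \<le> C0" using K0 w c3 I by (simp add: C0_def)
  define C where "C = sqrt A + C0 + real DIM('a) * C0"
  have "0 \<le> C" using C0 A by (simp add: C_def)
  have sme: "smooth ?\<eta>" using mollifier_test by (rule test_functionsE)
  have main: "\<exists>F\<in>test_functions \<Omega>. (\<forall>x. \<bar>F x\<bar> \<le> M) \<and> L2_norm \<Omega> (\<lambda>x. \<phi> x - F x) \<le> C * \<epsilon> powr \<kappa> \<and>
        (\<Sum>b\<in>Basis. L2_norm \<Omega> (pd b F)) \<le> C * \<epsilon> powr (\<kappa> - 1)"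
    if phi: "\<phi> \<in> test_functions \<Omega>" and M: "\<And>x. \<bar>\<phi> x\<bar> \<le> M" and S: "slobodeckij_sq \<Omega> \<kappa> \<phi> \<le> ennreal S"
      and eps: "0 < \<epsilon>" and E: "layer_energy \<Omega> \<phi> (4 * \<epsilon>) \<le> ennreal (A * \<epsilon> powr (2 * \<kappa>))" for \<phi> \<epsilon>
  proof -
    obtain Kp where Kp: "smooth \<phi>" "compact Kp" "Kp \<subseteq> \<Omega>" "\<And>x. x \<notin> Kp \<Longrightarrow> \<phi> x = 0"
      using test_functionsE[OF phi] by metis
    have [measurable]: "\<phi> \<in> borel_measurable borel" by (rule smooth_borel_measurable[OF Kp(1)])
    have M0: "0 \<le> M" using M[of undefined] by simp
    \<comment> \<open>The threshold 2 \<epsilon> leaves a margin: after averaging over radius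
      \<epsilon> the support still has distance at least \<epsilon> from the complement.\<close>
    define f where "f x = (if 2 * \<epsilon> \<le> infdist x (- \<Omega>) then \<phi> x else 0)" for x
    have [measurable]: "(\<lambda>x. infdist x (- \<Omega>)) \<in> borel_measurable borel"
      by (intro borel_measurable_continuous_onI continuous_intros)
    have fm[measurable]: "f \<in> borel_measurable borel" unfolding f_def[abs_def] by measurable
    have fM: "\<bar>f x\<bar> \<le> M" for x using M[of x] M0 by (simp add: f_def)
    have fint: "integrable lborel f"
    proof (rule Bochner_Integration.integrable_bound)
      show "integrable lborel \<phi>" by (rule compact_support_integrable[OF smooth_continuous_on[OF Kp(1)] Kp(2,4)])
      show "AE x in lborel. norm (f x) \<le> norm (\<phi> x)" by (intro AE_I2) (simp add: f_def)
    qed simp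
    let ?z = "\<lambda>x y::'a. (1 / \<epsilon>) *\<^sub>R x + (- (1 / \<epsilon>)) *\<^sub>R y"
    have zn: "norm (?z x y) = dist x y / \<epsilon>" for x y
    proof -
      have "?z x y = (1 / \<epsilon>) *\<^sub>R (x - y)" by (simp add: algebra_simps)
      then show ?thesis using eps by (simp add: dist_norm)
    qed
    define J where "J = \<epsilon> ^ DIM('a) * I"
    have J: "0 < J" using eps I by (simp add: J_def)
    define H where "H g x = (LINT y|lborel. f y * g (?z x y))" for g x
    define F where "F x = (1 / J) * H ?\<eta> x" for x
    have bm: "?\<eta> \<in> borel_measurable borel" by (rule smooth_borel_measurable[OF sme])
    have Hs: "smooth (H ?\<eta>)" unfolding H_def by (rule convolution_smooth[OF fint mollifier_test])
    have sF: "smooth F" unfolding F_def[abs_def] by (intro smooth_mult smooth_const Hs)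
    have etaint: "integrable lborel (\<lambda>y. g (?z x y))" "(LINT y|lborel. g (?z x y)) = \<epsilon> ^ DIM('a) * (LINT z|lborel. g z)"
      if g: "g \<in> test_functions UNIV" for g x
    proof -
      have sg: "smooth g" using g by (rule test_functionsE)
      have sgz: "smooth (\<lambda>y. g (?z x y))"
        using smooth_affine[OF sg, of "- (1 / \<epsilon>)" "(1 / \<epsilon>) *\<^sub>R x"] by (simp add: add.commute)
      obtain Kg where Kg: "compact Kg" "\<And>z. z \<notin> Kg \<Longrightarrow> g z = 0" using test_functionsE[OF g] by metis
      have "?z x y \<notin> Kg" if "y \<notin> (\<lambda>z. x + (- \<epsilon>) *\<^sub>R z) ` Kg" for y
      proof
        assume "?z x y \<in> Kg"
        moreover have "y = x + (- \<epsilon>) *\<^sub>R (?z x y)" using eps by (simp add: algebra_simps)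
        ultimately show False using that by blast
      qed
      moreover have "compact ((\<lambda>z. x + (- \<epsilon>) *\<^sub>R z) ` Kg)"
        by (intro compact_continuous_image Kg continuous_intros)
      ultimately show "integrable lborel (\<lambda>y. g (?z x y))"
        using Kg(2) by (intro compact_support_integrable[OF smooth_continuous_on[OF sgz]]) auto
      show "(LINT y|lborel. g (?z x y)) = \<epsilon> ^ DIM('a) * (LINT z|lborel. g z)"
        by (rule integral_rescale[OF smooth_borel_measurable[OF sg] eps])
    qed
    have Hdiff: "(LINT y|lborel. (f y - f x) * g (?z x y)) = H g x - f x * (\<epsilon> ^ DIM('a) * (LINT z|lborel. g z))"
      if g: "g \<in> test_functions UNIV" for g x
      using etaint[OF g, of x] convolution_integrable[OF fint g, of "1 / \<epsilon>" x "- (1 / \<epsilon>)"]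
      by (simp add: H_def left_diff_distrib)
    have F1: "F x - f x = (1 / J) * (LINT y|lborel. (f y - f x) * ?\<eta> (?z x y))" for x
    proof -
      have eqJ: "\<epsilon> ^ DIM('a) * (LINT z|lborel. ?\<eta> z) = J" by (simp add: J_def I_def)
      show ?thesis unfolding Hdiff[OF mollifier_test] eqJ using J by (simp add: F_def right_diff_distrib)
    qed
    have F2: "pd b F x = (1 / (J * \<epsilon>)) * (LINT y|lborel. (f y - f x) * pd b ?\<eta> (?z x y))" if b: "b \<in> Basis" for b x
    proof -
      \<comment> \<open>Mean zero allows f x to be subtracted inside the convolution for the
        derivative.\<close>
      have "(LINT z|lborel. pd b ?\<eta> z) = 0"
        by (rule integral_pd_zero[OF sme compact_cball[of 0 1] _ b]) (auto intro: mollifier_zero)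
      then have "(LINT y|lborel. (f y - f x) * pd b ?\<eta> (?z x y)) = H (pd b ?\<eta>) x"
        unfolding Hdiff[OF test_functions_pd[OF mollifier_test b]] by simp
      moreover have "pd b F x = (1 / J) * pd b (H ?\<eta>) x"
        unfolding F_def[abs_def] using pd_mult[OF smooth_const[of "1 / J"] Hs, where v = b and x = x] by simp
      moreover have "pd b (H ?\<eta>) x = (1 / \<epsilon>) * H (pd b ?\<eta>) x"
        unfolding H_def using convolution_derivative(2)[OF fint mollifier_test b, where c = "1 / \<epsilon>" and d = "- (1 / \<epsilon>)"] by simp
      ultimately show ?thesis by simp
    qed
    have FM: "\<bar>F x\<bar> \<le> M" for x
    proof -
      have "\<bar>H ?\<eta> x\<bar> \<le> (LINT y|lborel. M * ?\<eta> (?z x y))"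
        unfolding H_def using etaint(1)[OF mollifier_test, of x] fM mollifier_nonneg
        by (intro integral_abs_le integrable_mult_right AE_I2) (auto simp: abs_mult abs_of_nonneg[OF mollifier_nonneg] intro!: mult_right_mono mollifier_nonneg)
      also have "\<dots> = M * J" using etaint(2)[OF mollifier_test, of x] by (simp add: J_def I_def)
      finally have "(1 / J) * \<bar>H ?\<eta> x\<bar> \<le> (1 / J) * (M * J)" using J by (intro mult_left_mono) auto
      then show ?thesis using J by (simp add: F_def abs_mult)
    qed
    let ?K = "{x. \<epsilon> \<le> infdist x (- \<Omega>)}"
    have inO: "x \<in> \<Omega>" if "0 < infdist x (- \<Omega>)" for x
      using that by (metis ComplI infdist_zero less_irrefl)
    have "?K \<subseteq> \<Omega>" using eps inO by force
    moreover have "closed ?K" by (intro closed_Collect_le continuous_intros)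
    ultimately have K: "compact ?K" "?K \<subseteq> \<Omega>"
      using bounded_subset[OF dom(2)] by (auto simp: compact_eq_bounded_closed)
    have Fsupp: "F x = 0" if "x \<notin> ?K" for x
    proof -
      have z: "f y * ?\<eta> (?z x y) = 0" for y
      proof (cases "dist x y < \<epsilon>")
        case True
        then have "infdist y (- \<Omega>) < 2 * \<epsilon>" using that infdist_triangle[of y "- \<Omega>" x] by (simp add: dist_commute)
        then show ?thesis by (simp add: f_def)
      next
        case False
        then have "1 \<le> norm (?z x y)" unfolding zn using eps by simp
        then have "?\<eta> (?z x y) = 0" by (rule mollifier_zero)
        then show ?thesis by simp
      qed
      show ?thesis unfolding F_def H_def z by simp
    qed
    have Ftest: "F \<in> test_functions \<Omega>" by (rule test_functionsI[OF sF K Fsupp])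
    let ?D = "\<lambda>x. \<integral>\<^sup>+y. ennreal ((f y - f x)\<^sup>2) * indicator (cball x \<epsilon>) y \<partial>lborel"
    have ed: "\<epsilon> powr (real DIM('a) + 2 * \<kappa>) = \<epsilon> ^ DIM('a) * \<epsilon> powr (2 * \<kappa>)"
      using eps by (simp add: powr_add powr_realpow)
    have D: "(\<integral>\<^sup>+x. ?D x \<partial>lborel) \<le> ennreal (\<epsilon> ^ DIM('a) * \<epsilon> powr (2 * \<kappa>) * c3)"
    proof -
      have "(\<integral>\<^sup>+x. ?D x \<partial>lborel) \<le> ennreal (\<epsilon> powr (real DIM('a) + 2 * \<kappa>)) * slobodeckij_sq \<Omega> \<kappa> \<phi>
          + 2 * (ennreal (\<omega> * \<epsilon> ^ DIM('a)) * layer_energy \<Omega> \<phi> (4 * \<epsilon>))"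
        unfolding \<omega>_def f_def by (rule truncated_modulus[OF dom _ kappa(1) eps]) simp
      also have "\<dots> \<le> ennreal (\<epsilon> powr (real DIM('a) + 2 * \<kappa>)) * ennreal S
          + 2 * (ennreal (\<omega> * \<epsilon> ^ DIM('a)) * ennreal (A * \<epsilon> powr (2 * \<kappa>)))"
        by (intro add_mono mult_left_mono S E) auto
      also have "\<dots> = ennreal (\<epsilon> powr (real DIM('a) + 2 * \<kappa>) * S + 2 * ((\<omega> * \<epsilon> ^ DIM('a)) * (A * \<epsilon> powr (2 * \<kappa>))))"
      proof -
        have "ennreal (\<epsilon> powr (real DIM('a) + 2 * \<kappa>) * S + 2 * ((\<omega> * \<epsilon> ^ DIM('a)) * (A * \<epsilon> powr (2 * \<kappa>))))
          = ennreal (\<epsilon> powr (real DIM('a) + 2 * \<kappa>) * S) + ennreal (2 * ((\<omega> * \<epsilon> ^ DIM('a)) * (A * \<epsilon> powr (2 * \<kappa>))))"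
          using Q A w eps by (intro ennreal_plus) auto
        also have "ennreal (\<epsilon> powr (real DIM('a) + 2 * \<kappa>) * S) = ennreal (\<epsilon> powr (real DIM('a) + 2 * \<kappa>)) * ennreal S"
          using Q by (intro ennreal_mult) auto
        also have "ennreal (2 * ((\<omega> * \<epsilon> ^ DIM('a)) * (A * \<epsilon> powr (2 * \<kappa>)))) = ennreal 2 * ennreal ((\<omega> * \<epsilon> ^ DIM('a)) * (A * \<epsilon> powr (2 * \<kappa>)))"
          using A w eps by (intro ennreal_mult) auto
        also have "ennreal ((\<omega> * \<epsilon> ^ DIM('a)) * (A * \<epsilon> powr (2 * \<kappa>))) = ennreal (\<omega> * \<epsilon> ^ DIM('a)) * ennreal (A * \<epsilon> powr (2 * \<kappa>))"
          using A w eps by (intro ennreal_mult) auto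
        finally show ?thesis by simp
      qed
      also have "\<epsilon> powr (real DIM('a) + 2 * \<kappa>) * S + 2 * ((\<omega> * \<epsilon> ^ DIM('a)) * (A * \<epsilon> powr (2 * \<kappa>))) = \<epsilon> ^ DIM('a) * \<epsilon> powr (2 * \<kappa>) * c3"
        unfolding ed c3_def by (simp add: algebra_simps)
      finally show ?thesis .
    qed
    have L: "h \<in> L2 \<Omega>" if "smooth h" for h
      using continuous_L2[OF dom(2,1) smooth_continuous_on[OF that]] .
    \<comment> \<open>Used with s = 1 and kernel \<eta> for the error, and with s = 1 / \<epsilon>
      and a partial derivative of \<eta> for the gradient.\<close>
    have norm_bound: "L2_norm \<Omega> h \<le> C0 * \<epsilon> powr \<kappa> * s"
      if h: "h \<in> L2 \<Omega>" and s: "0 \<le> s" and g: "g \<in> test_functions UNIV" "\<And>z. \<bar>g z\<bar> \<le> K" "\<And>z. 1 < norm z \<Longrightarrow> g z = 0"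
        and eq: "\<And>x. h x = s / J * (LINT y|lborel. (f y - f x) * g (?z x y))" for h g s
    proof (rule L2_norm_le_nn_integral[OF dom(1) h])
      show "0 \<le> C0 * \<epsilon> powr \<kappa> * s" using C0 s by simp
      have "smooth g" using g(1) by (rule test_functionsE)
      then have gm: "g \<in> borel_measurable borel" by (rule smooth_borel_measurable)
      let ?c = "(s / J)\<^sup>2 * (K\<^sup>2 * (\<omega> * \<epsilon> ^ DIM('a)))"
      have "ennreal ((h x)\<^sup>2) * indicator \<Omega> x \<le> ennreal ?c * ?D x" for x
      proof -
        have "ennreal ((h x)\<^sup>2) * indicator \<Omega> x \<le> ennreal ((h x)\<^sup>2)" by (simp add: indicator_def)
        also have "\<dots> = ennreal ((s / J)\<^sup>2) * ennreal ((LINT y|lborel. (f y - f x) * g (?z x y))\<^sup>2)"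
          unfolding eq power_mult_distrib by (intro ennreal_mult) auto
        also have "\<dots> \<le> ennreal ((s / J)\<^sup>2) * (ennreal (K\<^sup>2 * (\<omega> * \<epsilon> ^ DIM('a))) * ?D x)"
          unfolding \<omega>_def by (intro mult_left_mono convolution_difference_bound fm gm g(2,3) eps) auto
        also have "\<dots> = ennreal ?c * ?D x"
        proof -
          have "ennreal ?c = ennreal ((s / J)\<^sup>2) * ennreal (K\<^sup>2 * (\<omega> * \<epsilon> ^ DIM('a)))"
            using w eps by (intro ennreal_mult) auto
          then show ?thesis by (simp add: mult.assoc)
        qed
        finally show ?thesis .
      qed
      then have "(\<integral>\<^sup>+x. ennreal ((h x)\<^sup>2) * indicator \<Omega> x \<partial>lborel) \<le> (\<integral>\<^sup>+x. ennreal ?c * ?D x \<partial>lborel)"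
        by (rule nn_integral_mono)
      also have "\<dots> = ennreal ?c * (\<integral>\<^sup>+x. ?D x \<partial>lborel)"
      proof (rule nn_integral_cmult)
        have "(\<lambda>(x, y). ennreal ((f y - f x)\<^sup>2) * (if dist x y \<le> \<epsilon> then 1 else 0)) \<in> borel_measurable (borel \<Otimes>\<^sub>M borel)"
          by measurable
        then have "(\<lambda>x. \<integral>\<^sup>+y. ennreal ((f y - f x)\<^sup>2) * (if dist x y \<le> \<epsilon> then 1 else 0) \<partial>lborel) \<in> borel_measurable lborel"
          by (intro lborel.borel_measurable_nn_integral) simp
        moreover have "(if dist x y \<le> \<epsilon> then 1 else 0) = (indicator (cball x \<epsilon>) y :: ennreal)" for x y :: 'a
          by (simp add: indicator_def)
        ultimately show "?D \<in> borel_measurable lborel" by simp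
      qed
      also have "\<dots> \<le> ennreal ?c * ennreal (\<epsilon> ^ DIM('a) * \<epsilon> powr (2 * \<kappa>) * c3)"
        by (intro mult_left_mono D) simp
      also have "\<dots> = ennreal (?c * (\<epsilon> ^ DIM('a) * \<epsilon> powr (2 * \<kappa>) * c3))"
        using w eps c3 by (intro ennreal_mult[symmetric]) auto
      \<comment> \<open>One \<epsilon>^DIM from Cauchy-Schwarz and one from the modulus cancel
        against the square of the normaliser \<open>J\<close>.\<close>
      also have "?c * (\<epsilon> ^ DIM('a) * \<epsilon> powr (2 * \<kappa>) * c3) = (C0 * \<epsilon> powr \<kappa> * s)\<^sup>2"
      proof -
        have "\<epsilon> powr (2 * \<kappa>) = (\<epsilon> powr \<kappa>)\<^sup>2" using eps by (simp add: power2_eq_square flip: powr_add)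
        moreover have "C0\<^sup>2 = K\<^sup>2 * \<omega> * c3 / I\<^sup>2" using w c3 by (simp add: C0_def power_divide)
        ultimately show ?thesis using eps I
          by (simp add: J_def power_mult_distrib power_divide field_simps power2_eq_square[of "\<epsilon> ^ DIM('a)"])
      qed
      finally show "(\<integral>\<^sup>+x. ennreal ((h x)\<^sup>2) * indicator \<Omega> x \<partial>lborel) \<le> ennreal ((C0 * \<epsilon> powr \<kappa> * s)\<^sup>2)" .
    qed
    have fL: "f \<in> L2 \<Omega>"
      using fM M0 by (intro L2_bounded(1)[OF dom(2,1) borel_measurable_lebesgue_on[OF fm]] AE_I2) auto
    have n1: "L2_norm \<Omega> (\<lambda>x. F x - f x) \<le> C0 * \<epsilon> powr \<kappa>"
    proof -
      have "L2_norm \<Omega> (\<lambda>x. F x - f x) \<le> C0 * \<epsilon> powr \<kappa> * 1"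
        by (rule norm_bound[OF L2_diff[OF L[OF sF] fL] zero_le_one mollifier_test K1 _ F1]) (simp add: mollifier_zero)
      then show ?thesis by simp
    qed
    \<comment> \<open>The discarded part lives where the distance is below 2 \<epsilon>, inside the
      layer of height 4 \<epsilon>.\<close>
    have n2: "L2_norm \<Omega> (\<lambda>x. \<phi> x - f x) \<le> sqrt A * \<epsilon> powr \<kappa>"
    proof (rule L2_norm_le_nn_integral[OF dom(1) L2_diff[OF L[OF Kp(1)] fL]])
      have "(\<integral>\<^sup>+x. ennreal ((\<phi> x - f x)\<^sup>2) * indicator \<Omega> x \<partial>lborel) \<le> layer_energy \<Omega> \<phi> (4 * \<epsilon>)"
        unfolding layer_energy_def using eps
        by (intro nn_integral_mono) (auto simp: f_def layer_def indicator_def)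
      also note E
      also have "A * \<epsilon> powr (2 * \<kappa>) = (sqrt A * \<epsilon> powr \<kappa>)\<^sup>2"
        using A eps by (simp add: power_mult_distrib power2_eq_square[of "\<epsilon> powr \<kappa>"] flip: powr_add)
      finally show "(\<integral>\<^sup>+x. ennreal ((\<phi> x - f x)\<^sup>2) * indicator \<Omega> x \<partial>lborel) \<le> ennreal ((sqrt A * \<epsilon> powr \<kappa>)\<^sup>2)" .
    qed (use A in simp)
    have "L2_norm \<Omega> (\<lambda>x. \<phi> x - F x) \<le> L2_norm \<Omega> (\<lambda>x. \<phi> x - f x) + L2_norm \<Omega> (\<lambda>x. F x - f x)"
      using L2_norm_diff_triangle[OF L2_diff[OF L[OF Kp(1)] fL] L2_diff[OF L[OF sF] fL]] by simp
    also have "\<dots> \<le> (sqrt A + C0) * \<epsilon> powr \<kappa>" using n1 n2 by (simp add: distrib_right)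
    also have "\<dots> \<le> C * \<epsilon> powr \<kappa>" using C0 by (intro mult_right_mono) (auto simp: C_def)
    finally have 1: "L2_norm \<Omega> (\<lambda>x. \<phi> x - F x) \<le> C * \<epsilon> powr \<kappa>" .
    have "L2_norm \<Omega> (pd b F) \<le> C0 * \<epsilon> powr (\<kappa> - 1)" if b: "b \<in> Basis" for b
    proof -
      have "L2_norm \<Omega> (pd b F) \<le> C0 * \<epsilon> powr \<kappa> * (1 / \<epsilon>)"
      proof (rule norm_bound[OF L[OF smooth_pd[OF sF b]] _ test_functions_pd[OF mollifier_test b] K2[OF b]])
        show "pd b ?\<eta> z = 0" if "1 < norm z" for z
          by (rule pd_eq_0[OF compact_cball[of 0 1]]) (use that in \<open>auto intro: mollifier_zero\<close>)
        show "pd b F x = 1 / \<epsilon> / J * (LINT y|lborel. (f y - f x) * pd b ?\<eta> (?z x y))" for x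
          unfolding F2[OF b] by (simp add: mult.commute)
      qed (use eps in simp)
      also have "\<dots> = C0 * \<epsilon> powr (\<kappa> - 1)" using eps by (simp add: powr_diff)
      finally show ?thesis .
    qed
    then have "(\<Sum>b\<in>Basis. L2_norm \<Omega> (pd b F)) \<le> (\<Sum>b\<in>(Basis::'a set). C0 * \<epsilon> powr (\<kappa> - 1))"
      by (rule sum_mono)
    also have "\<dots> = (real DIM('a) * C0) * \<epsilon> powr (\<kappa> - 1)" by simp
    also have "\<dots> \<le> C * \<epsilon> powr (\<kappa> - 1)" using C0 A by (intro mult_right_mono) (auto simp: C_def)
    finally have 2: "(\<Sum>b\<in>Basis. L2_norm \<Omega> (pd b F)) \<le> C * \<epsilon> powr (\<kappa> - 1)" .
    show ?thesis
    proof (intro bexI[OF _ Ftest] conjI allI)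
      show "\<bar>F x\<bar> \<le> M" for x by (rule FM)
    qed (rule 1, rule 2)
  qed
  show ?thesis
  proof (intro exI[of _ C] conjI ballI allI impI)
    fix \<phi> :: "'a \<Rightarrow> real" and \<epsilon> :: real
    assume h: "\<phi> \<in> test_functions \<Omega>" "0 < \<epsilon>" "\<forall>x. \<bar>\<phi> x\<bar> \<le> M" "slobodeckij_sq \<Omega> \<kappa> \<phi> \<le> ennreal S"
      "layer_energy \<Omega> \<phi> (4 * \<epsilon>) \<le> ennreal (A * \<epsilon> powr (2 * \<kappa>))"
    show "\<exists>F\<in>test_functions \<Omega>. (\<forall>x. \<bar>F x\<bar> \<le> M) \<and> L2_norm \<Omega> (\<lambda>x. \<phi> x - F x) \<le> C * \<epsilon> powr \<kappa> \<and>
        (\<Sum>b\<in>Basis. L2_norm \<Omega> (pd b F)) \<le> C * \<epsilon> powr (\<kappa> - 1)"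
      by (rule main[OF h(1) _ h(4) h(2) h(5)]) (rule spec[OF h(3)])
  qed (rule \<open>0 \<le> C\<close>)
qed

section \<open>Fractional approximation rate and conclusion\<close>

text \<open>For each \<epsilon> the bounded approximant is taken with L2 error \<epsilon>^\<kappa>,
  of the order of the mollification error. That it varies with \<epsilon> is harmless, because the
  supremum, seminorm and layer bounds are uniform.\<close>

lemma approx_rate_fractional:
  fixes \<Omega> :: "'a::euclidean_space set"
  assumes dom: "open \<Omega>" "bounded \<Omega>" "C2_boundary \<Omega>" and kappa: "0 < \<kappa>" "\<kappa> < 1" "\<kappa> \<noteq> 1/2"
    and p: "p \<in> sobolev0 \<Omega> \<kappa>" and R: "AE x in lebesgue_on \<Omega>. \<bar>p x\<bar> \<le> R" "R > 0"
  shows "approx_rate \<Omega> p \<kappa>"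
proof -
  obtain M S where S: "0 \<le> S" and app: "\<And>\<delta>. 0 < \<delta> \<Longrightarrow> \<exists>\<phi>\<in>test_functions \<Omega>. (\<forall>x. \<bar>\<phi> x\<bar> \<le> M) \<and>
      L2_norm \<Omega> (\<lambda>x. p x - \<phi> x) \<le> \<delta> \<and> slobodeckij_sq \<Omega> \<kappa> \<phi> \<le> ennreal S"
    by (rule sobolev0_fractional_approx[OF dom(1,2) kappa(1,2) p R]) (rule that)
  obtain A t0 where A: "0 \<le> A" "0 < t0" and lay: "\<forall>\<phi> M t. \<phi> \<in> test_functions \<Omega> \<longrightarrow> (\<forall>x. \<bar>\<phi> x\<bar> \<le> M) \<longrightarrow> 0 < t \<longrightarrow> t < t0 \<longrightarrow>
      layer_energy \<Omega> \<phi> t \<le> ennreal (A * t powr (2 * \<kappa>)) * (ennreal (M\<^sup>2) + slobodeckij_sq \<Omega> \<kappa> \<phi>)"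
  proof (rule layer_energy_bound[OF dom kappa(1,3)])
    fix A t0 :: real
    assume A: "0 \<le> A" "0 < t0" and l: "\<And>\<phi> M t. \<phi> \<in> test_functions \<Omega> \<Longrightarrow> (\<And>x. \<bar>\<phi> x\<bar> \<le> M) \<Longrightarrow> 0 < t \<Longrightarrow> t < t0 \<Longrightarrow>
      layer_energy \<Omega> \<phi> t \<le> ennreal (A * t powr (2 * \<kappa>)) * (ennreal (M\<^sup>2) + slobodeckij_sq \<Omega> \<kappa> \<phi>)"
    have "\<forall>\<phi> M t. \<phi> \<in> test_functions \<Omega> \<longrightarrow> (\<forall>x. \<bar>\<phi> x\<bar> \<le> M) \<longrightarrow> 0 < t \<longrightarrow> t < t0 \<longrightarrow>
      layer_energy \<Omega> \<phi> t \<le> ennreal (A * t powr (2 * \<kappa>)) * (ennreal (M\<^sup>2) + slobodeckij_sq \<Omega> \<kappa> \<phi>)"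
      by (intro allI impI, rule l) simp_all
    then show thesis by (rule that[OF A])
  qed
  \<comment> \<open>The layer bound at height t = 4 \<epsilon>, with supremum and seminorm replaced
    by M and S.\<close>
  define A' where "A' = A * 4 powr (2 * \<kappa>) * (M\<^sup>2 + S)"
  have A': "0 \<le> A'" using A S by (simp add: A'_def)
  obtain C where C: "0 \<le> C" and mol: "\<forall>\<phi>\<in>test_functions \<Omega>. \<forall>\<epsilon>>0. (\<forall>x. \<bar>\<phi> x\<bar> \<le> M) \<longrightarrow> slobodeckij_sq \<Omega> \<kappa> \<phi> \<le> ennreal S \<longrightarrow>
      layer_energy \<Omega> \<phi> (4 * \<epsilon>) \<le> ennreal (A' * \<epsilon> powr (2 * \<kappa>)) \<longrightarrow>
      (\<exists>F\<in>test_functions \<Omega>. (\<forall>x. \<bar>F x\<bar> \<le> M) \<and> L2_norm \<Omega> (\<lambda>x. \<phi> x - F x) \<le> C * \<epsilon> powr \<kappa> \<and>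
        (\<Sum>b\<in>Basis. L2_norm \<Omega> (pd b F)) \<le> C * \<epsilon> powr (\<kappa> - 1))"
    by (rule exE[OF mollified_approx[OF dom(1,2) kappa(1,2) A' S, where M = M]]) (elim conjE, rule that)
  have pL: "p \<in> L2 \<Omega>" using p sobolevL2 by (auto simp: sobolev0_def)
  have L: "h \<in> L2 \<Omega>" if "h \<in> test_functions \<Omega>" for h
  proof -
    have "smooth h" using that by (rule test_functionsE)
    then show ?thesis using continuous_L2[OF dom(2,1) smooth_continuous_on] by blast
  qed
  have main: "\<exists>F\<in>test_functions \<Omega>. (\<forall>x. \<bar>F x\<bar> \<le> M) \<and> L2_norm \<Omega> (\<lambda>x. p x - F x) \<le> (C + 1) * \<epsilon> powr \<kappa> \<and>
        (\<Sum>b\<in>Basis. L2_norm \<Omega> (pd b F)) \<le> (C + 1) * \<epsilon> powr (\<kappa> - 1)" if eps: "0 < \<epsilon>" "\<epsilon> < t0 / 4" for \<epsilon>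
  proof -
    obtain \<phi> where phi: "\<phi> \<in> test_functions \<Omega>" "\<And>x. \<bar>\<phi> x\<bar> \<le> M" "L2_norm \<Omega> (\<lambda>x. p x - \<phi> x) \<le> \<epsilon> powr \<kappa>"
      "slobodeckij_sq \<Omega> \<kappa> \<phi> \<le> ennreal S"
      using app[of "\<epsilon> powr \<kappa>"] eps(1) by auto
    have "layer_energy \<Omega> \<phi> (4 * \<epsilon>) \<le> ennreal (A * (4 * \<epsilon>) powr (2 * \<kappa>)) * (ennreal (M\<^sup>2) + slobodeckij_sq \<Omega> \<kappa> \<phi>)"
      using lay phi(1,2) eps by simp
    also have "\<dots> \<le> ennreal (A * (4 * \<epsilon>) powr (2 * \<kappa>)) * (ennreal (M\<^sup>2) + ennreal S)"
      by (intro mult_left_mono add_left_mono phi(4)) simp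
    also have "\<dots> = ennreal (A' * \<epsilon> powr (2 * \<kappa>))"
    proof -
      have "ennreal (M\<^sup>2) + ennreal S = ennreal (M\<^sup>2 + S)" using S by (intro ennreal_plus[symmetric]) auto
      moreover have "ennreal (A * (4 * \<epsilon>) powr (2 * \<kappa>)) * ennreal (M\<^sup>2 + S) = ennreal (A * (4 * \<epsilon>) powr (2 * \<kappa>) * (M\<^sup>2 + S))"
        using A S by (intro ennreal_mult[symmetric]) auto
      moreover have "A * (4 * \<epsilon>) powr (2 * \<kappa>) * (M\<^sup>2 + S) = A' * \<epsilon> powr (2 * \<kappa>)"
        using eps by (simp add: A'_def powr_mult)
      ultimately show ?thesis by simp
    qed
    finally obtain F where F: "F \<in> test_functions \<Omega>" "\<And>x. \<bar>F x\<bar> \<le> M" "L2_norm \<Omega> (\<lambda>x. \<phi> x - F x) \<le> C * \<epsilon> powr \<kappa>"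
        "(\<Sum>b\<in>Basis. L2_norm \<Omega> (pd b F)) \<le> C * \<epsilon> powr (\<kappa> - 1)"
      using mol phi(1,2,4) eps(1) by blast
    have "L2_norm \<Omega> (\<lambda>x. p x - F x) \<le> L2_norm \<Omega> (\<lambda>x. p x - \<phi> x) + L2_norm \<Omega> (\<lambda>x. \<phi> x - F x)"
      using L2_norm_triangle[OF L2_diff[OF pL L[OF phi(1)]] L2_diff[OF L[OF phi(1)] L[OF F(1)]]] by simp
    also have "\<dots> \<le> (C + 1) * \<epsilon> powr \<kappa>" using phi(3) F(3) by (simp add: distrib_right)
    finally have 1: "L2_norm \<Omega> (\<lambda>x. p x - F x) \<le> (C + 1) * \<epsilon> powr \<kappa>" .
    have 2: "(\<Sum>b\<in>Basis. L2_norm \<Omega> (pd b F)) \<le> (C + 1) * \<epsilon> powr (\<kappa> - 1)"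
      using F(4) by (simp add: distrib_right add_increasing2)
    show ?thesis
    proof (intro bexI[OF _ F(1)] conjI allI)
      show "\<bar>F x\<bar> \<le> M" for x by (rule F(2))
    qed (rule 1, rule 2)
  qed
  show ?thesis unfolding approx_rate_def
    by (intro exI[of _ M] exI[of _ "C + 1"] exI[of _ "t0 / 4"] conjI allI impI main) (use A(2) C in simp_all)
qed

theorem theorem3p3:
  fixes \<Omega> :: "'a::euclidean_space set"
    and a f g qd qs :: "'a \<Rightarrow> real"
    and u :: "('a \<Rightarrow> real) \<Rightarrow> 'a \<Rightarrow> real"
    and qlo qhi a0 c0 \<kappa> :: real
  assumes dim: "DIM('a) = 2 \<or> DIM('a) = 3"
    and domain: "open \<Omega>" "bounded \<Omega>" "connected \<Omega>" "C2_boundary \<Omega>"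
    and a: "a \<in> W1_inf \<Omega>" "a0 > 0" "AE x in lebesgue_on \<Omega>. a0 \<le> a x"
    and f: "f \<in> L2 \<Omega>"
    and g: "g \<in> sobolev_boundary \<Omega> (3/2)"
    and bounds: "0 < qlo" "qlo \<le> qhi"
    and u: "\<And>q. q \<in> admissible_set \<Omega> qlo qhi \<Longrightarrow> solves_bvp \<Omega> a f g q (u q)"
    and qd: "qd \<in> admissible_set \<Omega> qlo qhi"
    and qs: "qs \<in> admissible_set \<Omega> qlo qhi"
    and c0: "c0 > 0" "AE x in lebesgue_on \<Omega>. c0 \<le> \<bar>u qd x\<bar>"
    and kappa: "\<kappa> > 0" "\<kappa> \<noteq> 1/2" "(\<lambda>x. qd x - qs x) \<in> sobolev0 \<Omega> \<kappa>"
  shows "(\<kappa> > 1 \<longrightarrow>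
            variational_source_condition \<Omega> (admissible_set \<Omega> qlo qhi) u qd qs 1)
       \<and> (\<kappa> \<in> {0<..<1/2} \<union> {1/2<..1} \<longrightarrow>
            (\<forall>\<eta>>0. \<exists>\<alpha>>0. 2 * \<kappa> / (1 + \<kappa>) - \<eta> < \<alpha> \<and> \<alpha> < 2 * \<kappa> / (1 + \<kappa>) \<and>
               variational_source_condition \<Omega> (admissible_set \<Omega> qlo qhi) u qd qs \<alpha>))"
proof -
  let ?p = "\<lambda>x. qd x - qs x"
  have Q: "qhi > 0" using bounds by simp
  have R: "AE x in lebesgue_on \<Omega>. \<bar>?p x\<bar> \<le> qhi"
    using admissible_setD(3)[OF qd bounds(1)] admissible_setD(3)[OF qs bounds(1)] by eventually_elim auto
  note vsc = vsc_from_approx_rate[OF domain(2,1) a(1) bounds u qd qs c0]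
  have 1: "variational_source_condition \<Omega> (admissible_set \<Omega> qlo qhi) u qd qs 1" if "\<kappa> > 1"
  proof -
    \<comment> \<open>Order 1 already gives the exponent 2 * 1 / (1 + 1) = 1.\<close>
    have "approx_rate \<Omega> ?p 1"
      by (rule approx_rate_1[OF domain(2,1) _ kappa(3) R Q]) (use that in simp)
    from vsc[OF _ _ _ this, of 1] show ?thesis by simp
  qed
  have 2: "\<exists>\<alpha>>0. 2 * \<kappa> / (1 + \<kappa>) - \<eta> < \<alpha> \<and> \<alpha> < 2 * \<kappa> / (1 + \<kappa>) \<and>
      variational_source_condition \<Omega> (admissible_set \<Omega> qlo qhi) u qd qs \<alpha>"
    if k: "\<kappa> \<in> {0<..<1/2} \<union> {1/2<..1}" and eta: "\<eta> > 0" for \<eta>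
  proof -
    have k1: "\<kappa> \<le> 1" using k by auto
    have rate: "approx_rate \<Omega> ?p \<kappa>"
    proof (cases "\<kappa> = 1")
      case True
      then show ?thesis using approx_rate_1[OF domain(2,1) _ kappa(3) R Q] by simp
    next
      case False
      then show ?thesis
        using k1 by (intro approx_rate_fractional[OF domain(1,2,4) kappa(1) _ kappa(2,3) R Q]) simp
    qed
    define \<beta> where "\<beta> = 2 * \<kappa> / (1 + \<kappa>)"
    have beta: "0 < \<beta>" using kappa(1) by (simp add: \<beta>_def)
    \<comment> \<open>The first entry keeps the exponent positive for large \<eta>, the second keeps
      it within \<eta> of \<beta>; both lie strictly below \<beta>.\<close>
    define \<alpha> where "\<alpha> = max (\<beta> / 2) (\<beta> - \<eta> / 2)"
    have al: "0 < \<alpha>" "\<beta> - \<eta> < \<alpha>" "\<alpha> < \<beta>" using beta eta by (auto simp: \<alpha>_def)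
    have "variational_source_condition \<Omega> (admissible_set \<Omega> qlo qhi) u qd qs \<alpha>"
      by (rule vsc[OF _ kappa(1) k1 rate al(1)]) (use al(3) in \<open>simp_all add: \<beta>_def\<close>)
    then show ?thesis using al unfolding \<beta>_def by blast
  qed
  show ?thesis using 1 2 by blast
qed

end
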